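(* Let $\mathcal{G}$ be a locally compact étale groupoid with unit space $\mathcal{G}^{(0)}$, and let $X$ be a dense subset of $\mathcal{G}^{(0)}$. For $(T_x)_{x\in X}\in\prod_{x\in X}\mathcal{B}(\ell^2(\mathcal{G}_x))$, the following are equivalent: (1) there exists $T\in\mathcal{L}(L^2(\mathcal{G}))$ with $\Phi_x(T)=T_x$ for all $x\in X$; (2) the map $x\mapsto T_x$ is a continuous extendable section of $E_X$, and both families $(T_x)_{x\in X}$ and $(T_x^* )_{x\in X}$ are vector-wise uniformly quasi-local. Moreover, the requirement of extendability in (2) can be omitted when $\mathcal{G}^{(0)}$ is the Stone–Čech compactification of $X$ (with the inclusion map).
   Context: Locally compact spaces are assumed Hausdorff. A locally compact étale groupoid $\mathcal{G}$ is a topological groupoid with locally compact topology whose range map $\mathrm{r}$ (hence source map $\mathrm{s}$) is a local homeomorphism; $\mathcal{G}_x=\mathrm{s}^{-1}(x)$ (discrete). For $A,B\subseteq\mathcal{G}$, $AB=\{\alpha\beta:\alpha\in A,\beta\in B,\mathrm{s}(\alpha)=\mathrm{r}(\beta)\}$. Characteristic functions act by pointwise multiplication. $\prod_{x\in X}$ denotes uniformly norm-bounded families. Stone–Čech compactifications are considered for locally compact Hausdorff spaces $X$ (so that $X$ is open in it). $L^2(\mathcal{G})$ is the Hilbert $C_0(\mathcal{G}^{(0)})$-module obtained by completing $C_c(\mathcal{G})$ for $\langle\eta,\xi\rangle(x)=\sum_{\gamma\in\mathcal{G}_x}\overline{\eta(\gamma)}\xi(\gamma)$, with $(\xi f)(\gamma)=\xi(\gamma)f(\mathrm{s}(\gamma))$;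 its elements are regarded as functions in $C_0(\mathcal{G})$. $\mathcal{L}(L^2(\mathcal{G}))$ is the $C^*$-algebra of adjointable operators. The slice $\Phi_x(T)\in\mathcal{B}(\ell^2(\mathcal{G}_x))$ of $T\in\mathcal{L}(L^2(\mathcal{G}))$ is defined by $\Phi_x(T)(\xi|_{\mathcal{G}_x})=T(\xi)|_{\mathcal{G}_x}$ for $\xi\in L^2(\mathcal{G})$. $E_X=\bigsqcup_{x\in X}\mathcal{B}(\ell^2(\mathcal{G}_x))$ with topology: a net $\sigma_{x_i}\in\mathcal{B}(\ell^2(\mathcal{G}_{x_i}))$ converges to $\sigma_x\in\mathcal{B}(\ell^2(\mathcal{G}_x))$ iff $x_i\to x$ and for any $\gamma_i'\to\gamma'$, $\gamma_i''\to\gamma''$ in $\mathcal{G}$ with $\mathrm{s}(\gamma_i')=x_i=\mathrm{s}(\gamma_i'')$, $\langle\delta_{\gamma_i''},\sigma_{x_i}(\delta_{\gamma_i'})\rangle\to\langle\delta_{\gamma''},\sigma_x(\delta_{\gamma'})\rangle$. A norm-bounded continuous section $\sigma$ of $E_X$ is extendable if for any $\omega\in\mathcal{G}^{(0)}\setminus X$ and $\gamma',\gamma''\in\mathcal{G}_\omega$ there is $c_{\gamma',\gamma''}\in\mathbb{C}$ such that for any net $x_i\in X$ with $x_i\to\omega$ and any $\gamma_i',\gamma_i''\in\mathcal{G}_{x_i}$ with $\gamma_i'\to\gamma'$, $\gamma_i''\to\gamma''$, one has $\langle\delta_{\gamma_i''},\sigma(x_i)(\delta_{\gamma_i'})\rangle\to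 c_{\gamma',\gamma''}$. $(T_x)_{x\in X}$ is vector-wise uniformly quasi-local if for any $\varepsilon>0$ and $\xi\in C_c(\mathcal{G})$ there is a compact $K\subseteq\mathcal{G}$ such that for any $x\in X$ and $A_x,B_x\subseteq\mathcal{G}_x$ with $A_x\cap(KB_x)=\emptyset$ we have $\|(\chi_{A_x}T_x\chi_{B_x})(\xi|_{\mathcal{G}_x})\|<\varepsilon$. *)

theory Defs
  imports "HOL-Analysis.Analysis"
begin

section \<open>Locally compact etale groupoids\<close>

text \<open>The arrows are the points of the topological space \<open>gtop\<close>; units are identified with
  identity arrows.  Products \<open>gmult G \<alpha> \<beta>\<close> are meaningful only if \<open>gsrc G \<alpha> = grng G \<beta>\<close>.\<close>

record 'g tgroupoid =
  gtop :: "'g topology"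
  grng :: "'g \<Rightarrow> 'g"
  gsrc :: "'g \<Rightarrow> 'g"
  gmult :: "'g \<Rightarrow> 'g \<Rightarrow> 'g"
  ginv :: "'g \<Rightarrow> 'g"

definition units :: "'g tgroupoid \<Rightarrow> 'g set" where
  "units G = gsrc G ` topspace (gtop G)"

definition unit_space :: "'g tgroupoid \<Rightarrow> 'g topology" where
  "unit_space G = subtopology (gtop G) (units G)"

definition fib :: "'g tgroupoid \<Rightarrow> 'g \<Rightarrow> 'g set" where
  "fib G x = {\<gamma> \<in> topspace (gtop G). gsrc G \<gamma> = x}"

definition composable :: "'g tgroupoid \<Rightarrow> ('g \<times> 'g) set" where
  "composable G = {(\<alpha>, \<beta>). \<alpha> \<in> topspace (gtop G) \<and> \<beta> \<in> topspace (gtop G) \<and> gsrc G \<alpha> = grng G \<beta>}"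

definition set_mult :: "'g tgroupoid \<Rightarrow> 'g set \<Rightarrow> 'g set \<Rightarrow> 'g set" where
  "set_mult G A B = {gmult G \<alpha> \<beta> | \<alpha> \<beta>. \<alpha> \<in> A \<and> \<beta> \<in> B \<and> gsrc G \<alpha> = grng G \<beta>}"

definition algebraic_groupoid :: "'g tgroupoid \<Rightarrow> bool" where
  "algebraic_groupoid G \<longleftrightarrow>
     (\<forall>\<gamma> \<in> topspace (gtop G).
        gsrc G \<gamma> \<in> topspace (gtop G) \<and> grng G \<gamma> \<in> topspace (gtop G) \<and>
        gsrc G (gsrc G \<gamma>) = gsrc G \<gamma> \<and> grng G (gsrc G \<gamma>) = gsrc G \<gamma> \<and>
        gsrc G (grng G \<gamma>) = grng G \<gamma> \<and> grng G (grng G \<gamma>) = grng G \<gamma> \<and>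
        gmult G \<gamma> (gsrc G \<gamma>) = \<gamma> \<and> gmult G (grng G \<gamma>) \<gamma> = \<gamma>) \<and>
     (\<forall>(\<alpha>, \<beta>) \<in> composable G.
        gmult G \<alpha> \<beta> \<in> topspace (gtop G) \<and>
        gsrc G (gmult G \<alpha> \<beta>) = gsrc G \<beta> \<and> grng G (gmult G \<alpha> \<beta>) = grng G \<alpha>) \<and>
     (\<forall>\<alpha> \<beta> \<gamma>. (\<alpha>, \<beta>) \<in> composable G \<and> (\<beta>, \<gamma>) \<in> composable G \<longrightarrow>
        gmult G (gmult G \<alpha> \<beta>) \<gamma> = gmult G \<alpha> (gmult G \<beta> \<gamma>)) \<and>
     (\<forall>\<gamma> \<in> topspace (gtop G).
        ginv G \<gamma> \<in> topspace (gtop G) \<and>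
        gsrc G (ginv G \<gamma>) = grng G \<gamma> \<and> grng G (ginv G \<gamma>) = gsrc G \<gamma> \<and>
        gmult G \<gamma> (ginv G \<gamma>) = grng G \<gamma> \<and> gmult G (ginv G \<gamma>) \<gamma> = gsrc G \<gamma>)"

definition topological_groupoid :: "'g tgroupoid \<Rightarrow> bool" where
  "topological_groupoid G \<longleftrightarrow> algebraic_groupoid G \<and>
     continuous_map (subtopology (prod_topology (gtop G) (gtop G)) (composable G)) (gtop G)
       (\<lambda>(\<alpha>, \<beta>). gmult G \<alpha> \<beta>) \<and>
     continuous_map (gtop G) (gtop G) (ginv G)"

definition local_homeomorphism :: "'a topology \<Rightarrow> 'b topology \<Rightarrow> ('a \<Rightarrow> 'b) \<Rightarrow> bool" where
  "local_homeomorphism S S' f \<longleftrightarrow>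
     (\<forall>p \<in> topspace S. \<exists>U. openin S U \<and> p \<in> U \<and> openin S' (f ` U) \<and>
        homeomorphic_map (subtopology S U) (subtopology S' (f ` U)) f)"

definition lc_etale_groupoid :: "'g tgroupoid \<Rightarrow> bool" where
  "lc_etale_groupoid G \<longleftrightarrow> topological_groupoid G \<and>
     Hausdorff_space (gtop G) \<and> locally_compact_space (gtop G) \<and>
     local_homeomorphism (gtop G) (unit_space G) (grng G)"


section \<open>Bounded operators on \<open>\<ell>\<^sup>2(A)\<close>\<close>

text \<open>Elements of \<open>\<ell>\<^sup>2(A)\<close> are extended by zero outside \<open>A\<close>.  Inner products are conjugate linear
  in the first variable.\<close>

definition l2 :: "'g set \<Rightarrow> ('g \<Rightarrow> complex) set" where
  "l2 A = {f. (\<forall>\<gamma>. \<gamma> \<notin> A \<longrightarrow> f \<gamma> = 0) \<and> (\<lambda>\<gamma>. (cmod (f \<gamma>))\<^sup>2) summable_on A}"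

definition l2_inner :: "'g set \<Rightarrow> ('g \<Rightarrow> complex) \<Rightarrow> ('g \<Rightarrow> complex) \<Rightarrow> complex" where
  "l2_inner A f g = (\<Sum>\<^sub>\<infinity>\<gamma>\<in>A. cnj (f \<gamma>) * g \<gamma>)"

definition l2_norm :: "'g set \<Rightarrow> ('g \<Rightarrow> complex) \<Rightarrow> real" where
  "l2_norm A f = sqrt (\<Sum>\<^sub>\<infinity>\<gamma>\<in>A. (cmod (f \<gamma>))\<^sup>2)"

text \<open>Multiplication by the characteristic function of \<open>A\<close>.  With functions on \<open>A\<close> extended by
  zero, this is also the restriction of \<open>f\<close> to \<open>A\<close>.\<close>

definition chi :: "'g set \<Rightarrow> ('g \<Rightarrow> complex) \<Rightarrow> 'g \<Rightarrow> complex" where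
  "chi A f = (\<lambda>\<gamma>. indicator A \<gamma> * f \<gamma>)"

definition delta :: "'g \<Rightarrow> 'g \<Rightarrow> complex" where
  "delta \<gamma> = indicator {\<gamma>}"

type_synonym 'g oper = "('g \<Rightarrow> complex) \<Rightarrow> ('g \<Rightarrow> complex)"

text \<open>Operators are extensional, so that HOL equality is equality of operators on \<open>\<ell>\<^sup>2(A)\<close>.\<close>

definition bounded_ops :: "'g set \<Rightarrow> 'g oper set" where
  "bounded_ops A = {T \<in> l2 A \<rightarrow>\<^sub>E l2 A.
     (\<forall>f \<in> l2 A. \<forall>g \<in> l2 A. T (\<lambda>\<gamma>. f \<gamma> + g \<gamma>) = (\<lambda>\<gamma>. T f \<gamma> + T g \<gamma>)) \<and>
     (\<forall>c. \<forall>f \<in> l2 A. T (\<lambda>\<gamma>. c * f \<gamma>) = (\<lambda>\<gamma>. c * T f \<gamma>)) \<and>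
     (\<exists>C. \<forall>f \<in> l2 A. l2_norm A (T f) \<le> C * l2_norm A f)}"

definition op_norm :: "'g set \<Rightarrow> 'g oper \<Rightarrow> real" where
  "op_norm A T = (SUP f \<in> {f \<in> l2 A. l2_norm A f \<le> 1}. l2_norm A (T f))"

definition op_adj :: "'g set \<Rightarrow> 'g oper \<Rightarrow> 'g oper" where
  "op_adj A T = (THE S. S \<in> bounded_ops A \<and>
     (\<forall>f \<in> l2 A. \<forall>g \<in> l2 A. l2_inner A (T f) g = l2_inner A f (S g)))"

definition bounded_families :: "'g tgroupoid \<Rightarrow> 'g set \<Rightarrow> ('g \<Rightarrow> 'g oper) set" where
  "bounded_families G X = {T. (\<forall>x \<in> X. T x \<in> bounded_ops (fib G x)) \<and>
     (\<exists>C. \<forall>x \<in> X. op_norm (fib G x) (T x) \<le> C)}"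


section \<open>The Hilbert module \<open>L\<^sup>2(G)\<close>, adjointable operators and slices\<close>

definition Cc :: "'g tgroupoid \<Rightarrow> ('g \<Rightarrow> complex) set" where
  "Cc G = {\<xi>. (\<forall>\<gamma>. \<gamma> \<notin> topspace (gtop G) \<longrightarrow> \<xi> \<gamma> = 0) \<and>
     continuous_map (gtop G) euclidean \<xi> \<and>
     compactin (gtop G) (gtop G closure_of {\<gamma> \<in> topspace (gtop G). \<xi> \<gamma> \<noteq> 0})}"

definition C0 :: "'g tgroupoid \<Rightarrow> ('g \<Rightarrow> complex) set" where
  "C0 G = {\<xi>. (\<forall>\<gamma>. \<gamma> \<notin> topspace (gtop G) \<longrightarrow> \<xi> \<gamma> = 0) \<and>
     continuous_map (gtop G) euclidean \<xi> \<and>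
     (\<forall>\<epsilon>>0. \<exists>K. compactin (gtop G) K \<and> (\<forall>\<gamma> \<in> topspace (gtop G) - K. cmod (\<xi> \<gamma>) < \<epsilon>))}"

definition L2_inner :: "'g tgroupoid \<Rightarrow> ('g \<Rightarrow> complex) \<Rightarrow> ('g \<Rightarrow> complex) \<Rightarrow> 'g \<Rightarrow> complex" where
  "L2_inner G \<eta> \<xi> x = l2_inner (fib G x) \<eta> \<xi>"

text \<open>The norm of the module is \<open>\<parallel>\<xi>\<parallel> = sup\<^sub>x (\<langle>\<xi>,\<xi>\<rangle>(x))\<^sup>1\<^sup>/\<^sup>2\<close>, i.e. the supremum of the norms of the
  restrictions of \<open>\<xi>\<close> to the fibres.  It is complete on the space of all functions for which this
  supremum of fibrewise \<open>\<ell>\<^sup>2\<close>-norms is finite (the \<open>\<ell>\<^sup>\<infinity>\<close>-sum of the \<open>\<ell>\<^sup>2(G\<^sub>x)\<close>), and it dominates the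
  uniform norm; hence the completion of \<open>C\<^sub>c(G)\<close> is its closure below, and consists of
  \<open>C\<^sub>0\<close>-functions.\<close>

definition L2 :: "'g tgroupoid \<Rightarrow> ('g \<Rightarrow> complex) set" where
  "L2 G = {\<xi> \<in> C0 G. \<forall>\<epsilon>>0. \<exists>\<eta> \<in> Cc G. \<forall>x \<in> units G.
     chi (fib G x) (\<lambda>\<gamma>. \<xi> \<gamma> - \<eta> \<gamma>) \<in> l2 (fib G x) \<and>
     l2_norm (fib G x) (\<lambda>\<gamma>. \<xi> \<gamma> - \<eta> \<gamma>) \<le> \<epsilon>}"

text \<open>As usual for Hilbert modules, an adjointable operator is a map that has an adjoint for the
  module-valued inner product; linearity over \<open>C\<^sub>0(G\<^sup>(\<^sup>0\<^sup>))\<close> and boundedness are automatic.\<close>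

definition adjointable :: "'g tgroupoid \<Rightarrow> 'g oper set" where
  "adjointable G = {T \<in> L2 G \<rightarrow>\<^sub>E L2 G. \<exists>S \<in> L2 G \<rightarrow>\<^sub>E L2 G.
     \<forall>\<xi> \<in> L2 G. \<forall>\<eta> \<in> L2 G. \<forall>x \<in> units G. L2_inner G (T \<xi>) \<eta> x = L2_inner G \<xi> (S \<eta>) x}"

definition slice :: "'g tgroupoid \<Rightarrow> 'g \<Rightarrow> 'g oper \<Rightarrow> 'g oper" where
  "slice G x T = (THE S. S \<in> bounded_ops (fib G x) \<and>
     (\<forall>\<xi> \<in> L2 G. S (chi (fib G x) \<xi>) = chi (fib G x) (T \<xi>)))"


section \<open>The bundle \<open>E\<^sub>X\<close> and its sections\<close>

definition E_bundle :: "'g tgroupoid \<Rightarrow> 'g set \<Rightarrow> ('g \<times> 'g oper) set" where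
  "E_bundle G X = (SIGMA x:X. bounded_ops (fib G x))"

definition matrix_coeff :: "'g tgroupoid \<Rightarrow> 'g \<times> 'g oper \<Rightarrow> 'g \<Rightarrow> 'g \<Rightarrow> complex" where
  "matrix_coeff G \<sigma> \<gamma>'' \<gamma>' = l2_inner (fib G (fst \<sigma>)) (delta \<gamma>'') (snd \<sigma> (delta \<gamma>'))"

text \<open>Nets are rendered by filters: a net indexed by a directed set is the family together with the
  filter of eventual sets on the index type.\<close>

definition E_converges ::
    "'g tgroupoid \<Rightarrow> 'g set \<Rightarrow> ('i \<Rightarrow> 'g \<times> 'g oper) \<Rightarrow> 'g \<times> 'g oper \<Rightarrow> 'i filter \<Rightarrow> bool" where
  "E_converges G X \<sigma> \<sigma>0 F \<longleftrightarrow>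
     \<sigma>0 \<in> E_bundle G X \<and> (\<forall>\<^sub>F i in F. \<sigma> i \<in> E_bundle G X) \<and>
     limitin (gtop G) (\<lambda>i. fst (\<sigma> i)) (fst \<sigma>0) F \<and>
     (\<forall>g' g'' \<gamma>' \<gamma>''.
        limitin (gtop G) g' \<gamma>' F \<and> limitin (gtop G) g'' \<gamma>'' F \<and>
        (\<forall>\<^sub>F i in F. g' i \<in> fib G (fst (\<sigma> i)) \<and> g'' i \<in> fib G (fst (\<sigma> i))) \<longrightarrow>
        ((\<lambda>i. matrix_coeff G (\<sigma> i) (g'' i) (g' i)) \<longlongrightarrow> matrix_coeff G \<sigma>0 \<gamma>'' \<gamma>') F)"

text \<open>The topology with these convergent nets; lemma \<open>limitin_E_topology\<close> below confirms that its
  convergence is exactly \<open>E_converges\<close>.  Up to equivalence every net in \<open>E\<^sub>X\<close> is the identity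
  family along a filter on \<open>E\<^sub>X\<close>.\<close>

definition E_topology :: "'g tgroupoid \<Rightarrow> 'g set \<Rightarrow> ('g \<times> 'g oper) topology" where
  "E_topology G X = topology (\<lambda>U. U \<subseteq> E_bundle G X \<and>
     (\<forall>\<sigma>0 \<in> U. \<forall>F. E_converges G X (\<lambda>\<sigma>. \<sigma>) \<sigma>0 F \<longrightarrow> (\<forall>\<^sub>F \<sigma> in F. \<sigma> \<in> U)))"

definition continuous_section :: "'g tgroupoid \<Rightarrow> 'g set \<Rightarrow> ('g \<Rightarrow> 'g oper) \<Rightarrow> bool" where
  "continuous_section G X T \<longleftrightarrow>
     continuous_map (subtopology (gtop G) X) (E_topology G X) (\<lambda>x. (x, T x))"

text \<open>The index type \<open>'g \<times> 'g\<close> is no restriction: a net \<open>(x\<^sub>i, \<gamma>'\<^sub>i, \<gamma>''\<^sub>i)\<close> with \<open>\<gamma>'\<^sub>i, \<gamma>''\<^sub>i\<close> in the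
  fibre over \<open>x\<^sub>i\<close> can be replaced by the filter it induces on the pairs \<open>(\<gamma>'\<^sub>i, \<gamma>''\<^sub>i)\<close>.\<close>

definition extendable :: "'g tgroupoid \<Rightarrow> 'g set \<Rightarrow> ('g \<Rightarrow> 'g oper) \<Rightarrow> bool" where
  "extendable G X T \<longleftrightarrow>
     (\<forall>\<omega> \<in> units G - X. \<forall>\<gamma>' \<in> fib G \<omega>. \<forall>\<gamma>'' \<in> fib G \<omega>. \<exists>c.
        \<forall>(F :: ('g \<times> 'g) filter) x g' g''.
          (\<forall>\<^sub>F i in F. x i \<in> X \<and> g' i \<in> fib G (x i) \<and> g'' i \<in> fib G (x i)) \<and>
          limitin (gtop G) x \<omega> F \<and> limitin (gtop G) g' \<gamma>' F \<and> limitin (gtop G) g'' \<gamma>'' F \<longrightarrow>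
          ((\<lambda>i. matrix_coeff G (x i, T (x i)) (g'' i) (g' i)) \<longlongrightarrow> c) F)"

definition vectorwise_uniformly_quasi_local ::
    "'g tgroupoid \<Rightarrow> 'g set \<Rightarrow> ('g \<Rightarrow> 'g oper) \<Rightarrow> bool" where
  "vectorwise_uniformly_quasi_local G X T \<longleftrightarrow>
     (\<forall>\<epsilon>>0. \<forall>\<xi> \<in> Cc G. \<exists>K. compactin (gtop G) K \<and>
        (\<forall>x \<in> X. \<forall>A B. A \<subseteq> fib G x \<and> B \<subseteq> fib G x \<and> A \<inter> set_mult G K B = {} \<longrightarrow>
           l2_norm (fib G x) (chi A (T x (chi B (chi (fib G x) \<xi>)))) < \<epsilon>))"


section \<open>Stone-Cech compactifications\<close>

text \<open>The space \<open>S\<close>, with the inclusion of \<open>X\<close>, is the Stone-Cech compactification of the locally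
  compact Hausdorff space \<open>X\<close> (unique extensibility of maps to compact Hausdorff spaces \<open>K\<close>;
  uniqueness is automatic by density).  HOL cannot quantify over the types carrying \<open>K\<close>, but the type
  used here is large enough: one may replace \<open>K\<close> by the closure of the image of \<open>X\<close>, which has at
  most \<open>2^(2^|X|)\<close> points and hence embeds into \<open>('a \<Rightarrow> real) \<Rightarrow> real\<close>.\<close>

definition is_Stone_Cech_compactification :: "'a topology \<Rightarrow> 'a set \<Rightarrow> bool" where
  "is_Stone_Cech_compactification S X \<longleftrightarrow>
     X \<subseteq> topspace S \<and>
     locally_compact_space (subtopology S X) \<and> Hausdorff_space (subtopology S X) \<and>
     compact_space S \<and> Hausdorff_space S \<and> S closure_of X = topspace S \<and>
     (\<forall>(K :: (('a \<Rightarrow> real) \<Rightarrow> real) topology) f.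
        compact_space K \<and> Hausdorff_space K \<and> continuous_map (subtopology S X) K f \<longrightarrow>
        (\<exists>h. continuous_map S K h \<and> (\<forall>x \<in> X. h x = f x)))"


section \<open>Convergence in \<open>E\<^sub>X\<close>\<close>

lemma openin_E_topology:
  "openin (E_topology G X) U \<longleftrightarrow> U \<subseteq> E_bundle G X \<and>
     (\<forall>\<sigma>0 \<in> U. \<forall>F. E_converges G X (\<lambda>\<sigma>. \<sigma>) \<sigma>0 F \<longrightarrow> (\<forall>\<^sub>F \<sigma> in F. \<sigma> \<in> U))"
proof -
  let ?P = "\<lambda>U. U \<subseteq> E_bundle G X \<and>
     (\<forall>\<sigma>0 \<in> U. \<forall>F. E_converges G X (\<lambda>\<sigma>. \<sigma>) \<sigma>0 F \<longrightarrow> (\<forall>\<^sub>F \<sigma> in F. \<sigma> \<in> U))"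
  have "istopology ?P"
    unfolding istopology_def
  proof (intro conjI allI impI)
    fix U V assume "?P U" "?P V"
    then show "U \<inter> V \<subseteq> E_bundle G X" by blast
    show "\<forall>\<sigma>0 \<in> U \<inter> V. \<forall>F. E_converges G X (\<lambda>\<sigma>. \<sigma>) \<sigma>0 F \<longrightarrow> (\<forall>\<^sub>F \<sigma> in F. \<sigma> \<in> U \<inter> V)"
      using \<open>?P U\<close> \<open>?P V\<close> by (auto simp: eventually_conj_iff)
  next
    fix \<U> assume *: "\<forall>U\<in>\<U>. ?P U"
    then show "\<Union>\<U> \<subseteq> E_bundle G X" by blast
    show "\<forall>\<sigma>0 \<in> \<Union>\<U>. \<forall>F. E_converges G X (\<lambda>\<sigma>. \<sigma>) \<sigma>0 F \<longrightarrow> (\<forall>\<^sub>F \<sigma> in F. \<sigma> \<in> \<Union>\<U>)"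
    proof (intro ballI allI impI)
      fix \<sigma>0 F assume "\<sigma>0 \<in> \<Union>\<U>" and c: "E_converges G X (\<lambda>\<sigma>. \<sigma>) \<sigma>0 F"
      then obtain U where U: "U \<in> \<U>" "\<sigma>0 \<in> U" by blast
      with * c have "\<forall>\<^sub>F \<sigma> in F. \<sigma> \<in> U" by blast
      then show "\<forall>\<^sub>F \<sigma> in F. \<sigma> \<in> \<Union>\<U>" by (rule eventually_mono) (use U in blast)
    qed
  qed
  then show ?thesis
    unfolding E_topology_def by (simp add: topology_inverse')
qed

lemma topspace_E_topology [simp]: "topspace (E_topology G X) = E_bundle G X"
proof -
  have "openin (E_topology G X) (E_bundle G X)"
    by (auto simp: openin_E_topology E_converges_def)
  then show ?thesis
    by (metis openin_E_topology openin_subset openin_topspace subset_antisym)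
qed

lemma lc_etale_groupoidD:
  assumes "lc_etale_groupoid G"
  shows "\<And>\<gamma>. \<gamma> \<in> topspace (gtop G) \<Longrightarrow> ginv G \<gamma> \<in> topspace (gtop G)"
    and "\<And>\<gamma>. \<gamma> \<in> topspace (gtop G) \<Longrightarrow> grng G (ginv G \<gamma>) = gsrc G \<gamma>"
    and "\<And>\<gamma>. \<gamma> \<in> topspace (gtop G) \<Longrightarrow> ginv G (ginv G \<gamma>) = \<gamma>"
    and "continuous_map (gtop G) (gtop G) (ginv G)"
    and "Hausdorff_space (gtop G)"
proof -
  have a: "algebraic_groupoid G"
    using assms by (simp add: lc_etale_groupoid_def topological_groupoid_def)
  show c: "continuous_map (gtop G) (gtop G) (ginv G)" "Hausdorff_space (gtop G)"
    using assms by (simp_all add: lc_etale_groupoid_def topological_groupoid_def)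
  fix \<gamma> assume g: "\<gamma> \<in> topspace (gtop G)"
  show i: "ginv G \<gamma> \<in> topspace (gtop G)" and r: "grng G (ginv G \<gamma>) = gsrc G \<gamma>"
    using a g by (auto simp: algebraic_groupoid_def)
  let ?i = "ginv G \<gamma>" and ?j = "ginv G (ginv G \<gamma>)"
  have j: "?j \<in> topspace (gtop G)" using a i by (auto simp: algebraic_groupoid_def)
  have s: "gsrc G ?i = grng G \<gamma>" "gsrc G ?j = grng G ?i" "grng G ?j = gsrc G ?i"
    "gmult G ?i ?j = grng G ?i" "gmult G \<gamma> ?i = grng G \<gamma>"
    using a g i by (auto simp: algebraic_groupoid_def)
  have "gmult G (gmult G \<gamma> ?i) ?j = gmult G \<gamma> (gmult G ?i ?j)"
  proof -
    have "(\<gamma>, ?i) \<in> composable G" "(?i, ?j) \<in> composable G"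
      using g i j s r by (auto simp: composable_def)
    then show ?thesis using a unfolding algebraic_groupoid_def by blast
  qed
  moreover have "gmult G (grng G ?j) ?j = ?j" "gmult G \<gamma> (gsrc G \<gamma>) = \<gamma>"
    using a g j unfolding algebraic_groupoid_def by blast+
  ultimately show "?j = \<gamma>" using s r by simp
qed

lemma source_local_homeomorphism:
  assumes G: "lc_etale_groupoid G"
  shows "local_homeomorphism (gtop G) (unit_space G) (gsrc G)"
  unfolding local_homeomorphism_def
proof
  note D = lc_etale_groupoidD[OF G]
  fix p assume p: "p \<in> topspace (gtop G)"
  let ?i = "ginv G"
  have "local_homeomorphism (gtop G) (unit_space G) (grng G)"
    using G by (simp add: lc_etale_groupoid_def)
  then obtain U where U: "openin (gtop G) U" "?i p \<in> U" "openin (unit_space G) (grng G ` U)"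
    "homeomorphic_map (subtopology (gtop G) U) (subtopology (unit_space G) (grng G ` U)) (grng G)"
    unfolding local_homeomorphism_def using D(1)[OF p] by meson
  have sub: "U \<subseteq> topspace (gtop G)" using U(1) by (rule openin_subset)
  define V where "V = ?i ` U"
  have Ve: "V = {x \<in> topspace (gtop G). ?i x \<in> U}"
    unfolding V_def using sub D(1,3) by (force simp: image_iff)
  have oV: "openin (gtop G) V"
    unfolding Ve using D(4) U(1) by (rule openin_continuous_map_preimage)
  have pV: "p \<in> V" using p U(2) by (simp add: Ve)
  have s: "gsrc G x = grng G (?i x)" if "x \<in> V" for x using that D(2) by (simp add: Ve)
  have iV: "?i ` V = U" unfolding V_def using sub D(3) by (force simp: image_iff)
  have im: "gsrc G ` V = grng G ` U"
    unfolding iV[symmetric] image_image using s by (rule image_cong[OF refl])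
  have hi: "homeomorphic_map (subtopology (gtop G) V) (subtopology (gtop G) U) ?i"
    unfolding homeomorphic_map_maps homeomorphic_maps_def
  proof (intro exI[of _ ?i] conjI)
    show "continuous_map (subtopology (gtop G) V) (subtopology (gtop G) U) ?i"
      using D(4) iV by (intro continuous_map_into_subtopology continuous_map_from_subtopology) auto
    show "continuous_map (subtopology (gtop G) U) (subtopology (gtop G) V) ?i"
      using D(4) by (intro continuous_map_into_subtopology continuous_map_from_subtopology)
        (auto simp: V_def)
  qed (use D(3) sub oV openin_subset in \<open>auto simp: Ve\<close>)
  have "homeomorphic_map (subtopology (gtop G) V) (subtopology (unit_space G) (gsrc G ` V))
      (grng G \<circ> ?i)"
    unfolding im using hi U(4) by (rule homeomorphic_map_compose)
  moreover have "homeomorphic_map (subtopology (gtop G) V)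
      (subtopology (unit_space G) (gsrc G ` V)) (gsrc G) \<longleftrightarrow>
    homeomorphic_map (subtopology (gtop G) V)
      (subtopology (unit_space G) (gsrc G ` V)) (grng G \<circ> ?i)"
    by (rule iffI; erule homeomorphic_map_eq) (auto simp: s)
  ultimately show "\<exists>U. openin (gtop G) U \<and> p \<in> U \<and> openin (unit_space G) (gsrc G ` U) \<and>
        homeomorphic_map (subtopology (gtop G) U) (subtopology (unit_space G) (gsrc G ` U)) (gsrc G)"
    using oV pV U(3) im by metis
qed

lemma local_section:
  assumes G: "lc_etale_groupoid G" and p: "p \<in> topspace (gtop G)"
  obtains U t where "openin (gtop G) U" "p \<in> U" "openin (unit_space G) (gsrc G ` U)"
    "continuous_map (subtopology (unit_space G) (gsrc G ` U)) (subtopology (gtop G) U) t"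
    "\<And>\<gamma>. \<gamma> \<in> U \<Longrightarrow> t (gsrc G \<gamma>) = \<gamma>"
proof -
  obtain U where U: "openin (gtop G) U" "p \<in> U" "openin (unit_space G) (gsrc G ` U)"
    "homeomorphic_map (subtopology (gtop G) U) (subtopology (unit_space G) (gsrc G ` U)) (gsrc G)"
    using source_local_homeomorphism[OF G] p unfolding local_homeomorphism_def by meson
  then obtain t where "homeomorphic_maps (subtopology (gtop G) U)
      (subtopology (unit_space G) (gsrc G ` U)) (gsrc G) t"
    unfolding homeomorphic_map_maps by blast
  moreover have "U \<subseteq> topspace (gtop G)" using U(1) by (rule openin_subset)
  ultimately show thesis
    using U by (intro that[of U t]) (auto simp: homeomorphic_maps_def)
qed

lemma limitin_E_topology:
  assumes G: "lc_etale_groupoid G" and X: "X \<subseteq> units G"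
  shows "limitin (E_topology G X) \<sigma> \<sigma>0 F \<longleftrightarrow> E_converges G X \<sigma> \<sigma>0 F"
proof
  assume c: "E_converges G X \<sigma> \<sigma>0 F"
  have c': "E_converges G X (\<lambda>\<sigma>. \<sigma>) \<sigma>0 (filtermap \<sigma> F)"
    unfolding E_converges_def eventually_filtermap
  proof (intro conjI allI impI)
    show "\<sigma>0 \<in> E_bundle G X" "\<forall>\<^sub>F i in F. \<sigma> i \<in> E_bundle G X"
      "limitin (gtop G) fst (fst \<sigma>0) (filtermap \<sigma> F)"
      using c by (simp_all add: E_converges_def limitin_def eventually_filtermap)
    fix g' g'' \<gamma>' \<gamma>''
    assume h: "limitin (gtop G) g' \<gamma>' (filtermap \<sigma> F) \<and> limitin (gtop G) g'' \<gamma>'' (filtermap \<sigma> F) \<and>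
      (\<forall>\<^sub>F i in F. g' (\<sigma> i) \<in> fib G (fst (\<sigma> i)) \<and> g'' (\<sigma> i) \<in> fib G (fst (\<sigma> i)))"
    then have "limitin (gtop G) (\<lambda>i. g' (\<sigma> i)) \<gamma>' F" "limitin (gtop G) (\<lambda>i. g'' (\<sigma> i)) \<gamma>'' F"
      by (auto simp: limitin_def eventually_filtermap)
    with h c have "((\<lambda>i. matrix_coeff G (\<sigma> i) (g'' (\<sigma> i)) (g' (\<sigma> i))) \<longlongrightarrow> matrix_coeff G \<sigma>0 \<gamma>'' \<gamma>') F"
      unfolding E_converges_def by blast
    then show "((\<lambda>\<sigma>. matrix_coeff G \<sigma> (g'' \<sigma>) (g' \<sigma>)) \<longlongrightarrow> matrix_coeff G \<sigma>0 \<gamma>'' \<gamma>') (filtermap \<sigma> F)"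
      by (simp add: filterlim_filtermap)
  qed
  have "\<forall>\<^sub>F i in F. \<sigma> i \<in> U" if "openin (E_topology G X) U" "\<sigma>0 \<in> U" for U
  proof -
    have "\<forall>\<^sub>F q in filtermap \<sigma> F. q \<in> U"
      using c' that unfolding openin_E_topology by blast
    then show ?thesis by (simp add: eventually_filtermap)
  qed
  moreover have "\<sigma>0 \<in> E_bundle G X" using c by (simp add: E_converges_def)
  ultimately show "limitin (E_topology G X) \<sigma> \<sigma>0 F"
    by (simp add: limitin_def)
next
  assume l: "limitin (E_topology G X) \<sigma> \<sigma>0 F"
  note D = lc_etale_groupoidD[OF G]
  let ?E = "E_bundle G X"
  have s0: "\<sigma>0 \<in> ?E" using limitin_topspace[OF l] by simp
  have ev: "\<forall>\<^sub>F i in F. \<sigma> i \<in> W" if "openin (E_topology G X) W" "\<sigma>0 \<in> W" for W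
    using l that by (auto simp: limitin_def)
  have unitsG: "units G \<subseteq> topspace (gtop G)"
    using G by (auto simp: lc_etale_groupoid_def topological_groupoid_def algebraic_groupoid_def
      units_def)
  have evE: "\<forall>\<^sub>F i in F. \<sigma> i \<in> ?E" using ev[of ?E] s0 openin_topspace[of "E_topology G X"] by simp
  have fst_lim: "limitin (gtop G) (\<lambda>i. fst (\<sigma> i)) (fst \<sigma>0) F"
    unfolding limitin_def
  proof (intro conjI allI impI)
    show "fst \<sigma>0 \<in> topspace (gtop G)" using s0 X unitsG by (auto simp: E_bundle_def)
    fix V assume V: "openin (gtop G) V \<and> fst \<sigma>0 \<in> V"
    have "openin (E_topology G X) {q \<in> ?E. fst q \<in> V}"
      using V by (auto simp: openin_E_topology E_converges_def limitin_def eventually_conj_iff)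
    from ev[OF this] V s0 show "\<forall>\<^sub>F i in F. fst (\<sigma> i) \<in> V"
      by (auto elim: eventually_mono)
  qed
  show "E_converges G X \<sigma> \<sigma>0 F"
    unfolding E_converges_def
  proof (intro conjI allI impI s0 evE fst_lim)
    fix g' g'' \<gamma>' \<gamma>''
    assume "limitin (gtop G) g' \<gamma>' F \<and> limitin (gtop G) g'' \<gamma>'' F \<and>
      (\<forall>\<^sub>F i in F. g' i \<in> fib G (fst (\<sigma> i)) \<and> g'' i \<in> fib G (fst (\<sigma> i)))"
    then have l1: "limitin (gtop G) g' \<gamma>' F" and l2: "limitin (gtop G) g'' \<gamma>'' F"
      and fb: "\<forall>\<^sub>F i in F. g' i \<in> fib G (fst (\<sigma> i)) \<and> g'' i \<in> fib G (fst (\<sigma> i))" by auto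
    show "((\<lambda>i. matrix_coeff G (\<sigma> i) (g'' i) (g' i)) \<longlongrightarrow> matrix_coeff G \<sigma>0 \<gamma>'' \<gamma>') F"
    proof (cases "F = bot")
      case nb: False
      obtain U' t' where U': "openin (gtop G) U'" "\<gamma>' \<in> U'" "openin (unit_space G) (gsrc G ` U')"
        "continuous_map (subtopology (unit_space G) (gsrc G ` U')) (subtopology (gtop G) U') t'"
        "\<And>\<gamma>. \<gamma> \<in> U' \<Longrightarrow> t' (gsrc G \<gamma>) = \<gamma>"
        using local_section[OF G limitin_topspace[OF l1]] by metis
      obtain U'' t'' where U'': "openin (gtop G) U''" "\<gamma>'' \<in> U''"
        "openin (unit_space G) (gsrc G ` U'')"
        "continuous_map (subtopology (unit_space G) (gsrc G ` U'')) (subtopology (gtop G) U'') t''"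
        "\<And>\<gamma>. \<gamma> \<in> U'' \<Longrightarrow> t'' (gsrc G \<gamma>) = \<gamma>"
        using local_section[OF G limitin_topspace[OF l2]] by metis
      have src_cont: "continuous_map (gtop G) (gtop G) (gsrc G)"
      proof -
        have "continuous_map (gtop G) (prod_topology (gtop G) (gtop G)) (\<lambda>\<gamma>. (ginv G \<gamma>, \<gamma>))"
          using D(4) by (intro continuous_map_pairedI) auto
        then have "continuous_map (gtop G)
            (subtopology (prod_topology (gtop G) (gtop G)) (composable G)) (\<lambda>\<gamma>. (ginv G \<gamma>, \<gamma>))"
          using G by (intro continuous_map_into_subtopology)
            (auto simp: composable_def lc_etale_groupoid_def topological_groupoid_def
              algebraic_groupoid_def)
        moreover have "continuous_map (subtopology (prod_topology (gtop G) (gtop G)) (composable G))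
            (gtop G) (\<lambda>(\<alpha>, \<beta>). gmult G \<alpha> \<beta>)"
          using G by (simp add: lc_etale_groupoid_def topological_groupoid_def)
        ultimately have "continuous_map (gtop G) (gtop G)
            ((\<lambda>(\<alpha>, \<beta>). gmult G \<alpha> \<beta>) \<circ> (\<lambda>\<gamma>. (ginv G \<gamma>, \<gamma>)))"
          by (rule continuous_map_compose)
        then show ?thesis
          by (rule continuous_map_eq) (use G in \<open>auto simp: lc_etale_groupoid_def
            topological_groupoid_def algebraic_groupoid_def\<close>)
      qed
      have src: "gsrc G \<gamma> = fst \<sigma>0"
        if lg: "limitin (gtop G) g \<gamma> F" and fg: "\<forall>\<^sub>F i in F. g i \<in> fib G (fst (\<sigma> i))" for g \<gamma>
      proof -
        have "limitin (gtop G) (gsrc G \<circ> g) (gsrc G \<gamma>) F"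
          using src_cont lg by (rule continuous_map_limit)
        moreover have "\<forall>\<^sub>F i in F. (gsrc G \<circ> g) i = fst (\<sigma> i)"
          using fg by (auto simp: fib_def elim: eventually_mono)
        ultimately have "limitin (gtop G) (\<lambda>i. fst (\<sigma> i)) (gsrc G \<gamma>) F"
          by (rule limitin_transform_eventually[rotated])
        then show ?thesis
          using fst_lim D(5) nb limitin_Hausdorff_unique by metis
      qed
      have src': "gsrc G \<gamma>' = fst \<sigma>0" by (rule src[OF l1]) (use fb in \<open>auto elim: eventually_mono\<close>)
      have src'': "gsrc G \<gamma>'' = fst \<sigma>0" by (rule src[OF l2]) (use fb in \<open>auto elim: eventually_mono\<close>)
      have lift: "limitin (gtop G) (\<lambda>q. t (fst q)) (t (fst q0)) F'"
          "\<forall>\<^sub>F q in F'. t (fst q) \<in> fib G (fst q)" "\<forall>\<^sub>F q in F'. fst q \<in> gsrc G ` U"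
        if c: "E_converges G X (\<lambda>\<sigma>. \<sigma>) q0 F'" and oU: "openin (gtop G) U"
          and o: "openin (unit_space G) (gsrc G ` U)" and q: "fst q0 \<in> gsrc G ` U"
          and t: "continuous_map (subtopology (unit_space G) (gsrc G ` U)) (subtopology (gtop G) U) t"
          and ti: "\<And>\<gamma>. \<gamma> \<in> U \<Longrightarrow> t (gsrc G \<gamma>) = \<gamma>"
        for q0 F' U t
      proof -
        have sub: "U \<subseteq> topspace (gtop G)" using oU by (rule openin_subset)
        obtain W where W: "openin (gtop G) W" "gsrc G ` U = W \<inter> units G"
          using o by (auto simp: unit_space_def openin_subtopology)
        have "\<forall>\<^sub>F q in F'. fst q \<in> W"
          using c W q by (auto simp: E_converges_def limitin_def)
        moreover have "\<forall>\<^sub>F q in F'. fst q \<in> units G"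
          using c X by (auto simp: E_converges_def E_bundle_def elim!: eventually_mono)
        ultimately show e: "\<forall>\<^sub>F q in F'. fst q \<in> gsrc G ` U"
          using W(2) by (simp add: eventually_conj_iff)
        then show "\<forall>\<^sub>F q in F'. t (fst q) \<in> fib G (fst q)"
          by (rule eventually_mono) (use ti sub in \<open>auto simp: fib_def\<close>)
        have "limitin (subtopology (unit_space G) (gsrc G ` U)) fst (fst q0) F'"
          using c q e W(2)
          by (auto simp: unit_space_def limitin_subtopology subtopology_subtopology E_converges_def
            elim!: eventually_mono)
        then have "limitin (subtopology (gtop G) U) (t \<circ> fst) (t (fst q0)) F'"
          using t by (metis continuous_map_limit)
        then show "limitin (gtop G) (\<lambda>q. t (fst q)) (t (fst q0)) F'"
          by (simp add: limitin_subtopology o_def)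
      qed
      show ?thesis
        unfolding tendsto_def
      proof (intro allI impI)
        fix W :: "complex set" assume W: "open W" "matrix_coeff G \<sigma>0 \<gamma>'' \<gamma>' \<in> W"
        define Q where "Q = {q \<in> ?E. fst q \<in> gsrc G ` U' \<and> fst q \<in> gsrc G ` U'' \<and>
          matrix_coeff G q (t'' (fst q)) (t' (fst q)) \<in> W}"
        have "openin (E_topology G X) Q"
          unfolding openin_E_topology
        proof (intro conjI ballI allI impI)
          show "Q \<subseteq> ?E" by (auto simp: Q_def)
          fix q0 F' assume q0: "q0 \<in> Q" and c: "E_converges G X (\<lambda>\<sigma>. \<sigma>) q0 F'"
          have a: "fst q0 \<in> gsrc G ` U'" "fst q0 \<in> gsrc G ` U''"
            "matrix_coeff G q0 (t'' (fst q0)) (t' (fst q0)) \<in> W" using q0 by (auto simp: Q_def)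
          note L' = lift[OF c U'(1,3) a(1) U'(4,5), simplified]
          note L'' = lift[OF c U''(1,3) a(2) U''(4,5), simplified]
          have "\<forall>\<^sub>F q in F'. t' (fst q) \<in> fib G (fst q) \<and> t'' (fst q) \<in> fib G (fst q)"
            using L'(2) L''(2) by (simp add: eventually_conj_iff)
          then have "((\<lambda>q. matrix_coeff G q (t'' (fst q)) (t' (fst q))) \<longlongrightarrow>
              matrix_coeff G q0 (t'' (fst q0)) (t' (fst q0))) F'"
            using c L'(1) L''(1) unfolding E_converges_def by blast
          then have "\<forall>\<^sub>F q in F'. matrix_coeff G q (t'' (fst q)) (t' (fst q)) \<in> W"
            using W(1) a(3) by (rule topological_tendstoD)
          moreover have "\<forall>\<^sub>F q in F'. q \<in> ?E" using c by (simp add: E_converges_def)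
          ultimately show "\<forall>\<^sub>F q in F'. q \<in> Q"
            using L'(3) L''(3) by (simp add: Q_def eventually_conj_iff)
        qed
        moreover have "\<sigma>0 \<in> Q"
          using s0 U'(2) U''(2) U'(5)[OF U'(2)] U''(5)[OF U''(2)] W(2) src' src''
          by (auto simp: Q_def image_iff intro: bexI[of _ \<gamma>'] bexI[of _ \<gamma>''])
        ultimately have "\<forall>\<^sub>F i in F. \<sigma> i \<in> Q" by (rule ev)
        moreover have "\<forall>\<^sub>F i in F. g' i \<in> U'" "\<forall>\<^sub>F i in F. g'' i \<in> U''"
          using l1 l2 U' U'' by (auto simp: limitin_def)
        ultimately show "\<forall>\<^sub>F i in F. matrix_coeff G (\<sigma> i) (g'' i) (g' i) \<in> W"
          using fb
        proof eventually_elim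
          case (elim i)
          have "t' (fst (\<sigma> i)) = g' i" "t'' (fst (\<sigma> i)) = g'' i"
            using elim U'(5)[of "g' i"] U''(5)[of "g'' i"] by (auto simp: fib_def)
          then show ?case using elim by (auto simp: Q_def)
        qed
      qed
    qed simp
  qed
qed

end

theory Submission
  imports Defs
begin

text \<open>Near an arrow \<open>\<gamma>'\<close> the vectors \<open>\<delta>\<^bsub>g'\<^esub>\<close> are the fibre restrictions of one bump function
  \<open>\<zeta>\<close> supported in a bisection.  Hence, if the \<open>T\<^sub>x\<close> are the slices of \<open>T\<close>, their matrix
  coefficients near \<open>(\<gamma>'', \<gamma>')\<close> are values of the continuous function \<open>T \<zeta>\<close>, and approximating \<open>T \<zeta>\<close>
  by elements of \<open>C\<^sub>c(G)\<close> gives quasi-locality.  Conversely, the limits of the matrix coefficients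
  form on every fibre a matrix with the same operator bound.  Applied to \<open>\<xi> \<in> C\<^sub>c(G)\<close> these matrices
  give a continuous function; quasi-locality with \<open>B\<close> the support of \<open>\<xi>\<close> bounds its tails over \<open>X\<close>,
  hence by density over all units, so that it lies in \<open>L\<^sup>2(G)\<close>.  The adjoint family provides the
  adjoint.  Over a Stone-Cech compactification, a matrix coefficient cut off by a bump function is a
  bounded continuous function on \<open>X\<close> and therefore extends.\<close>

section \<open>Square-summable functions\<close>

text \<open>The topology of \<open>E_bundle\<close> sees operators only through single matrix
  coefficients. So operators on fibres are handled as matrices, and their bounds are stated for
  finitely many entries at a time, a form that survives entrywise limits. Arrows of different fibres
  are compared through local sections of the source map, which carry a finite set of arrows
  injectively into the nearby fibres; in this way information over the dense set \<open>X\<close>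
  reaches every unit. Limits along nets are traded for one neighbourhood condition,
  \<open>coeff_limit\<close>. In the direction from the operator to the family, the obstacle is that
  adjointability is purely algebraic. That it yields a bounded operator on each fibre is a uniform
  boundedness argument, run with global elements of the module; \<open>finite_lift\<close> produces
  them from data on one fibre without increasing the norm. In the Stone-Cech case the target of the
  extended function has to live in the function type fixed by the definition, so a closed disc is
  copied into it.\<close>

abbreviation square_summable :: "'g set \<Rightarrow> ('g \<Rightarrow> complex) \<Rightarrow> bool" where
  "square_summable A f \<equiv> (\<lambda>t. (cmod (f t))\<^sup>2) summable_on A"

lemma l2_norm_nonneg [simp]: "0 \<le> l2_norm A f"
  by (simp add: l2_norm_def infsum_nonneg)

lemma l2_norm_cong:
  assumes "\<And>t. t \<in> A \<Longrightarrow> cmod (f t) = cmod (g t)"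
  shows "l2_norm A f = l2_norm A g"
  unfolding l2_norm_def using assms by (simp cong: infsum_cong)

lemma L2_set_le_l2_norm:
  assumes "square_summable A f" "finite F" "F \<subseteq> A"
  shows "L2_set (\<lambda>t. cmod (f t)) F \<le> l2_norm A f"
  unfolding L2_set_def l2_norm_def
  using assms by (intro real_sqrt_le_mono finite_sum_le_infsum) auto

text \<open>A sum of nonnegative terms is the supremum of its finite partial sums. Norm estimates
  for limits go through this form, since over a fixed finite set both sides pass to pointwise
  limits.\<close>

lemma l2_bound:
  assumes "\<And>F. finite F \<Longrightarrow> F \<subseteq> A \<Longrightarrow> L2_set (\<lambda>t. cmod (f t)) F \<le> C"
  shows "square_summable A f" "l2_norm A f \<le> C"
proof -
  have C: "0 \<le> C" using assms[of "{}"] by simp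
  have b: "(\<Sum>t\<in>F. (cmod (f t))\<^sup>2) \<le> C\<^sup>2" if "finite F" "F \<subseteq> A" for F
    using assms[OF that] C by (simp add: L2_set_def sqrt_le_D)
  show s: "square_summable A f"
    by (rule nonneg_bdd_above_summable_on) (auto intro!: bdd_aboveI2 b)
  show "l2_norm A f \<le> C"
    unfolding l2_norm_def using C s b
    by (intro real_le_lsqrt infsum_le_finite_sums) auto
qed

lemma square_summable_cmult:
  assumes "square_summable A f"
  shows "square_summable A (\<lambda>t. c * f t)"
  using summable_on_cmult_right[OF assms, of "(cmod c)\<^sup>2"] by (simp add: norm_mult power_mult_distrib)

lemma l2_norm_cmult: "l2_norm A (\<lambda>t. c * f t) = cmod c * l2_norm A f"
  unfolding l2_norm_def
  by (simp add: norm_mult power_mult_distrib infsum_cmult_right' real_sqrt_mult)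

lemma l2_add:
  assumes "square_summable A f" "square_summable A g"
  shows "square_summable A (\<lambda>t. f t + g t)"
    and "l2_norm A (\<lambda>t. f t + g t) \<le> l2_norm A f + l2_norm A g"
proof -
  have "L2_set (\<lambda>t. cmod (f t + g t)) F \<le> l2_norm A f + l2_norm A g"
    if F: "finite F" "F \<subseteq> A" for F
  proof -
    have "L2_set (\<lambda>t. cmod (f t + g t)) F \<le> L2_set (\<lambda>t. cmod (f t) + cmod (g t)) F"
      by (intro L2_set_mono) (auto simp: norm_triangle_ineq)
    also have "\<dots> \<le> L2_set (\<lambda>t. cmod (f t)) F + L2_set (\<lambda>t. cmod (g t)) F"
      by (rule L2_set_triangle_ineq)
    finally show ?thesis
      using L2_set_le_l2_norm[OF assms(1) F] L2_set_le_l2_norm[OF assms(2) F] by simp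
  qed
  from l2_bound[OF this]
  show "square_summable A (\<lambda>t. f t + g t)"
    "l2_norm A (\<lambda>t. f t + g t) \<le> l2_norm A f + l2_norm A g" by auto
qed

lemma l2_diff:
  assumes "square_summable A f" "square_summable A g"
  shows "square_summable A (\<lambda>t. f t - g t)"
    and "l2_norm A (\<lambda>t. f t - g t) \<le> l2_norm A f + l2_norm A g"
  using l2_add[of f A "\<lambda>t. - g t"] assms l2_norm_cong[of A g "\<lambda>t. - g t"] by auto

lemma l2_sum:
  assumes "finite I" "\<And>i. i \<in> I \<Longrightarrow> square_summable A (f i)"
  shows "square_summable A (\<lambda>t. \<Sum>i\<in>I. f i t)"
    and "l2_norm A (\<lambda>t. \<Sum>i\<in>I. f i t) \<le> (\<Sum>i\<in>I. l2_norm A (f i))"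
proof -
  have "square_summable A (\<lambda>t. \<Sum>i\<in>I. f i t) \<and>
     l2_norm A (\<lambda>t. \<Sum>i\<in>I. f i t) \<le> (\<Sum>i\<in>I. l2_norm A (f i))"
    using assms
  proof (induction I rule: finite_induct)
    case empty
    then show ?case by (simp add: l2_norm_def)
  next
    case (insert i I)
    then have *: "square_summable A (f i)" "square_summable A (\<lambda>t. \<Sum>i\<in>I. f i t)"
      "l2_norm A (\<lambda>t. \<Sum>i\<in>I. f i t) \<le> (\<Sum>i\<in>I. l2_norm A (f i))" by auto
    show ?case using l2_add[OF *(1,2)] *(3) insert.hyps by simp
  qed
  then show "square_summable A (\<lambda>t. \<Sum>i\<in>I. f i t)"
    "l2_norm A (\<lambda>t. \<Sum>i\<in>I. f i t) \<le> (\<Sum>i\<in>I. l2_norm A (f i))" by auto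
qed

lemma l2_dominated:
  assumes "square_summable A f" "\<And>t. t \<in> A \<Longrightarrow> cmod (g t) \<le> cmod (f t)"
  shows "square_summable A g" "l2_norm A g \<le> l2_norm A f"
proof -
  have "L2_set (\<lambda>t. cmod (g t)) F \<le> l2_norm A f" if F: "finite F" "F \<subseteq> A" for F
  proof -
    have "L2_set (\<lambda>t. cmod (g t)) F \<le> L2_set (\<lambda>t. cmod (f t)) F"
      using assms(2) F by (intro L2_set_mono) auto
    then show ?thesis using L2_set_le_l2_norm[OF assms(1) F] by simp
  qed
  from l2_bound[OF this] show "square_summable A g" "l2_norm A g \<le> l2_norm A f" by auto
qed

lemma cmod_le_l2_norm:
  assumes "square_summable A f" "t \<in> A"
  shows "cmod (f t) \<le> l2_norm A f"
  using L2_set_le_l2_norm[OF assms(1), of "{t}"] assms(2) by simp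

lemma square_summable_finite_support:
  assumes "finite F" "\<And>t. t \<in> A - F \<Longrightarrow> f t = 0"
  shows "square_summable A f" "l2_norm A f = L2_set (\<lambda>t. cmod (f t)) (A \<inter> F)"
proof -
  have "((\<lambda>t. (cmod (f t))\<^sup>2) has_sum (\<Sum>t\<in>A \<inter> F. (cmod (f t))\<^sup>2)) A"
    by (rule has_sum_finite_neutralI) (use assms in auto)
  then show "square_summable A f" "l2_norm A f = L2_set (\<lambda>t. cmod (f t)) (A \<inter> F)"
    unfolding l2_norm_def L2_set_def using has_sum_imp_summable infsumI by (blast, metis)
qed

lemma l2_inner_summable:
  assumes "square_summable A f" "square_summable A g"
  shows "(\<lambda>t. cnj (f t) * g t) summable_on A"
    and l2_Cauchy_Schwarz: "cmod (l2_inner A f g) \<le> l2_norm A f * l2_norm A g"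
proof -
  have b: "(\<Sum>t\<in>F. cmod (cnj (f t) * g t)) \<le> l2_norm A f * l2_norm A g"
    if F: "finite F" "F \<subseteq> A" for F
  proof -
    have "(\<Sum>t\<in>F. cmod (cnj (f t) * g t)) = (\<Sum>t\<in>F. \<bar>cmod (f t)\<bar> * \<bar>cmod (g t)\<bar>)"
      by (simp add: norm_mult)
    also have "\<dots> \<le> L2_set (\<lambda>t. cmod (f t)) F * L2_set (\<lambda>t. cmod (g t)) F"
      by (rule L2_set_mult_ineq)
    also have "\<dots> \<le> l2_norm A f * l2_norm A g"
      using L2_set_le_l2_norm[OF assms(1) F] L2_set_le_l2_norm[OF assms(2) F]
      by (intro mult_mono) auto
    finally show ?thesis .
  qed
  have s: "(\<lambda>t. cmod (cnj (f t) * g t)) summable_on A"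
    by (rule nonneg_bdd_above_summable_on) (auto intro!: bdd_aboveI2 b)
  then show "(\<lambda>t. cnj (f t) * g t) summable_on A"
    by (rule Infinite_Sum.abs_summable_summable)
  have "cmod (l2_inner A f g) \<le> (\<Sum>\<^sub>\<infinity>t\<in>A. cmod (cnj (f t) * g t))"
    unfolding l2_inner_def using s by (rule norm_infsum_bound)
  also have "\<dots> \<le> l2_norm A f * l2_norm A g"
    using s b by (rule infsum_le_finite_sums)
  finally show "cmod (l2_inner A f g) \<le> l2_norm A f * l2_norm A g" .
qed

lemma l2_inner_add_right:
  assumes "square_summable A f" "square_summable A g" "square_summable A h"
  shows "l2_inner A f (\<lambda>t. g t + h t) = l2_inner A f g + l2_inner A f h"
  unfolding l2_inner_def distrib_left
  using l2_inner_summable(1)[OF assms(1,2)] l2_inner_summable(1)[OF assms(1,3)]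
  by (rule infsum_add)

lemma l2_inner_cmult_right: "l2_inner A f (\<lambda>t. c * g t) = c * l2_inner A f g"
  unfolding l2_inner_def mult.left_commute[of _ c] by (rule infsum_cmult_right')

lemma l2_inner_diff_right:
  assumes "square_summable A f" "square_summable A g" "square_summable A h"
  shows "l2_inner A f (\<lambda>t. g t - h t) = l2_inner A f g - l2_inner A f h"
  using l2_inner_add_right[OF assms(1) l2_diff(1)[OF assms(2,3)] assms(3)] by simp

lemma l2_inner_commute: "l2_inner A g f = cnj (l2_inner A f g)"
  unfolding l2_inner_def by (simp flip: infsum_cnj add: mult.commute)

lemma l2_inner_cong:
  assumes "\<And>t. t \<in> A \<Longrightarrow> f t = f' t" "\<And>t. t \<in> A \<Longrightarrow> g t = g' t"
  shows "l2_inner A f g = l2_inner A f' g'"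
  unfolding l2_inner_def using assms by (simp cong: infsum_cong)

lemma l2_inner_finite_support:
  assumes "finite F" "F \<subseteq> A" "\<And>t. t \<in> A - F \<Longrightarrow> f t = 0"
  shows "l2_inner A f g = (\<Sum>t\<in>F. cnj (f t) * g t)"
  unfolding l2_inner_def
  by (rule infsumI, rule has_sum_finite_neutralI) (use assms in auto)

lemma l2_inner_delta [simp]:
  assumes "a \<in> A"
  shows "l2_inner A (delta a) g = g a"
  using l2_inner_finite_support[of "{a}" A "delta a" g] assms by (simp add: delta_def)

lemma delta_in_l2 [simp]: "a \<in> A \<Longrightarrow> delta a \<in> l2 A"
  using square_summable_finite_support(1)[of "{a}" A "delta a"]
  by (auto simp: l2_def delta_def indicator_def)

lemma l2D: "f \<in> l2 A \<Longrightarrow> square_summable A f"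
  by (simp add: l2_def)

lemma l2_outside: "f \<in> l2 A \<Longrightarrow> t \<notin> A \<Longrightarrow> f t = 0"
  by (simp add: l2_def)

lemma l2_addI: "f \<in> l2 A \<Longrightarrow> g \<in> l2 A \<Longrightarrow> (\<lambda>t. f t + g t) \<in> l2 A"
  using l2_add(1)[of f A g] by (simp add: l2_def)

lemma l2_cmultI: "f \<in> l2 A \<Longrightarrow> (\<lambda>t. c * f t) \<in> l2 A"
  using square_summable_cmult[of f A c] by (simp add: l2_def)

lemma chi_apply: "chi A f t = (if t \<in> A then f t else 0)"
  by (simp add: chi_def)

lemma chi_in_l2_iff: "chi A f \<in> l2 A \<longleftrightarrow> square_summable A f"
proof -
  have "square_summable A (chi A f) \<longleftrightarrow> square_summable A f"
    by (rule summable_on_cong) (simp add: chi_apply)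
  then show ?thesis by (auto simp: l2_def chi_apply)
qed

lemma l2_norm_chi [simp]: "l2_norm A (chi A f) = l2_norm A f"
  by (rule l2_norm_cong) (simp add: chi_apply)

lemma chi_in_l2: "f \<in> l2 A \<Longrightarrow> chi B f \<in> l2 A"
  using l2_dominated(1)[of f A "chi B f"] by (auto simp: l2_def chi_apply)

lemma l2_eqI:
  assumes "f \<in> l2 A" "g \<in> l2 A" "\<And>a. a \<in> A \<Longrightarrow> f a = g a"
  shows "f = g"
proof
  fix t show "f t = g t" using assms by (cases "t \<in> A") (auto simp: l2_outside)
qed

text \<open>The squared norm of the tail is the total sum minus the partial sum over
  \<open>F\<close>. Hence finitely supported functions are dense.\<close>

lemma l2_tail:
  assumes "square_summable A f"
  shows "((\<lambda>F. l2_norm A (\<lambda>t. f t - chi F f t)) \<longlongrightarrow> 0) (finite_subsets_at_top A)"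
proof -
  let ?q = "\<lambda>t. (cmod (f t))\<^sup>2"
  have "(sum ?q \<longlongrightarrow> infsum ?q A) (finite_subsets_at_top A)"
    using has_sum_infsum[OF assms] by (simp add: has_sum_def)
  then have "((\<lambda>F. sqrt (infsum ?q A - sum ?q F)) \<longlongrightarrow> sqrt (infsum ?q A - infsum ?q A))
      (finite_subsets_at_top A)"
    by (intro tendsto_intros)
  moreover have "\<forall>\<^sub>F F in finite_subsets_at_top A.
      sqrt (infsum ?q A - sum ?q F) = l2_norm A (\<lambda>t. f t - chi F f t)"
  proof (rule eventually_finite_subsets_at_top_weakI)
    fix F assume F: "finite F" "F \<subseteq> A"
    have "infsum ?q (A - F) = infsum ?q A - sum ?q F"
      using infsum_Diff[OF assms _ F(2)] F(1) by (simp add: infsum_finite)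
    moreover have "infsum ?q (A - F) = infsum (\<lambda>t. (cmod (f t - chi F f t))\<^sup>2) A"
      by (rule infsum_cong_neutral) (auto simp: chi_apply)
    ultimately show "sqrt (infsum ?q A - sum ?q F) = l2_norm A (\<lambda>t. f t - chi F f t)"
      by (simp add: l2_norm_def)
  qed
  ultimately show ?thesis by (simp add: filterlim_cong)
qed

lemma chi_eq_sum_delta:
  assumes "finite F"
  shows "chi F f = (\<lambda>t. \<Sum>b\<in>F. f b * delta b t)"
proof
  fix t
  have "(\<Sum>b\<in>F. f b * delta b t) = (\<Sum>b\<in>F. if b = t then f b else 0)"
    by (rule sum.cong) (auto simp: delta_def)
  then show "chi F f t = (\<Sum>b\<in>F. f b * delta b t)"
    using assms by (simp add: chi_apply sum.delta)
qed

section \<open>Bounded linear functionals on \<open>l2\<close> and their expansion in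
  coordinates\<close>

definition bounded_functional :: "'g set \<Rightarrow> (('g \<Rightarrow> complex) \<Rightarrow> complex) \<Rightarrow> bool" where
  "bounded_functional A \<phi> \<longleftrightarrow>
     (\<forall>f\<in>l2 A. \<forall>g\<in>l2 A. \<phi> (\<lambda>t. f t + g t) = \<phi> f + \<phi> g) \<and>
     (\<forall>c. \<forall>f\<in>l2 A. \<phi> (\<lambda>t. c * f t) = c * \<phi> f) \<and>
     (\<exists>C. \<forall>f\<in>l2 A. cmod (\<phi> f) \<le> C * l2_norm A f)"

lemma bounded_functionalD:
  assumes "bounded_functional A \<phi>" "f \<in> l2 A"
  shows "g \<in> l2 A \<Longrightarrow> \<phi> (\<lambda>t. f t + g t) = \<phi> f + \<phi> g" "\<phi> (\<lambda>t. c * f t) = c * \<phi> f"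
  using assms unfolding bounded_functional_def by blast+

lemma bounded_functional_finite:
  assumes \<phi>: "bounded_functional A \<phi>" and F: "finite F" "F \<subseteq> A"
  shows "\<phi> (\<lambda>t. \<Sum>b\<in>F. f b * delta b t) = (\<Sum>b\<in>F. f b * \<phi> (delta b))"
    and "(\<lambda>t. \<Sum>b\<in>F. f b * delta b t) \<in> l2 A"
proof -
  have "\<phi> (\<lambda>t. \<Sum>b\<in>F. f b * delta b t) = (\<Sum>b\<in>F. f b * \<phi> (delta b)) \<and>
      (\<lambda>t. \<Sum>b\<in>F. f b * delta b t) \<in> l2 A"
    using F
  proof (induction F rule: finite_induct)
    case empty
    have z: "(\<lambda>_. 0) \<in> l2 A" by (simp add: l2_def)
    from bounded_functionalD(2)[OF \<phi> z, of 0] z show ?case by simp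
  next
    case (insert b F)
    then have b: "b \<in> A" and IH: "\<phi> (\<lambda>t. \<Sum>b\<in>F. f b * delta b t) = (\<Sum>b\<in>F. f b * \<phi> (delta b))"
      "(\<lambda>t. \<Sum>b\<in>F. f b * delta b t) \<in> l2 A" by blast+
    have d: "(\<lambda>t. f b * delta b t) \<in> l2 A" by (rule l2_cmultI[OF delta_in_l2[OF b]])
    show ?case
      using l2_addI[OF d IH(2)] bounded_functionalD(1)[OF \<phi> d IH(2)] IH(1) insert.hyps
        bounded_functionalD(2)[OF \<phi> delta_in_l2[OF b]] by simp
  qed
  then show "\<phi> (\<lambda>t. \<Sum>b\<in>F. f b * delta b t) = (\<Sum>b\<in>F. f b * \<phi> (delta b))"
    "(\<lambda>t. \<Sum>b\<in>F. f b * delta b t) \<in> l2 A" by auto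
qed

text \<open>By linearity the partial sum over \<open>F\<close> is \<phi> applied to
  \<open>chi F f\<close>, so the error is \<phi> of the tail, at most \<open>C\<close> times the
  tail norm. The result serves twice: for the rows of an operator and for the pairings that define
  its adjoint.\<close>

lemma bounded_functional_has_sum:
  assumes \<phi>: "bounded_functional A \<phi>" and f: "f \<in> l2 A"
  shows "((\<lambda>b. \<phi> (delta b) * f b) has_sum \<phi> f) A"
proof -
  obtain C where C: "\<And>f. f \<in> l2 A \<Longrightarrow> cmod (\<phi> f) \<le> C * l2_norm A f"
    using \<phi> unfolding bounded_functional_def by blast
  have "((\<lambda>F. C * l2_norm A (\<lambda>t. f t - chi F f t)) \<longlongrightarrow> C * 0) (finite_subsets_at_top A)"
    by (intro tendsto_intros l2_tail l2D f)
  then have lim: "((\<lambda>F. C * l2_norm A (\<lambda>t. f t - chi F f t)) \<longlongrightarrow> 0) (finite_subsets_at_top A)"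
    by simp
  have "((\<lambda>F. (\<Sum>b\<in>F. \<phi> (delta b) * f b) - \<phi> f) \<longlongrightarrow> 0) (finite_subsets_at_top A)"
  proof (rule Lim_null_comparison[OF _ lim], rule eventually_finite_subsets_at_top_weakI)
    fix F assume F: "finite F" "F \<subseteq> A"
    have cl: "chi F f \<in> l2 A" "\<phi> (chi F f) = (\<Sum>b\<in>F. \<phi> (delta b) * f b)"
      using bounded_functional_finite[OF \<phi> F, of f] chi_eq_sum_delta[OF F(1), of f]
      by (simp_all add: mult.commute)
    have dl: "(\<lambda>t. f t - chi F f t) \<in> l2 A"
      using l2_diff(1)[OF l2D[OF f] l2D[OF cl(1)]] f cl(1) by (simp add: l2_def)
    have "\<phi> (\<lambda>t. (f t - chi F f t) + chi F f t) = \<phi> (\<lambda>t. f t - chi F f t) + \<phi> (chi F f)"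
      by (rule bounded_functionalD(1)[OF \<phi> dl cl(1)])
    then have "(\<Sum>b\<in>F. \<phi> (delta b) * f b) - \<phi> f = - \<phi> (\<lambda>t. f t - chi F f t)"
      using cl(2) by simp
    then show "cmod ((\<Sum>b\<in>F. \<phi> (delta b) * f b) - \<phi> f) \<le> C * l2_norm A (\<lambda>t. f t - chi F f t)"
      using C[OF dl] by simp
  qed
  then show ?thesis
    unfolding has_sum_def by (subst (asm) LIM_zero_iff)
qed

section \<open>Matrices of bounded operators\<close>

text \<open>Boundedness of the sesquilinear form on finitely supported vectors. Each instance
  involves finitely many entries, so the condition is preserved when the entries converge;
  summability of rows is a consequence.\<close>

definition matrix_bounded :: "'g set \<Rightarrow> ('g \<Rightarrow> 'g \<Rightarrow> complex) \<Rightarrow> real \<Rightarrow> bool" where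
  "matrix_bounded A c C \<longleftrightarrow> 0 \<le> C \<and>
     (\<forall>E F f g. finite E \<and> E \<subseteq> A \<and> finite F \<and> F \<subseteq> A \<longrightarrow>
        cmod (\<Sum>a\<in>E. \<Sum>b\<in>F. cnj (g a) * c a b * f b)
          \<le> C * L2_set (\<lambda>a. cmod (g a)) E * L2_set (\<lambda>b. cmod (f b)) F)"

text \<open>Values vanish off \<open>A\<close>, and the operator is undefined off
  \<open>l2 A\<close>: the extensionality that \<open>bounded_ops\<close> demands.\<close>

definition matop :: "'g set \<Rightarrow> ('g \<Rightarrow> 'g \<Rightarrow> complex) \<Rightarrow> 'g oper" where
  "matop A c = (\<lambda>f\<in>l2 A. \<lambda>a. if a \<in> A then \<Sum>\<^sub>\<infinity>b\<in>A. c a b * f b else 0)"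

lemma matrix_bounded_adjoint:
  assumes "matrix_bounded A c C"
  shows "matrix_bounded A (\<lambda>a b. cnj (c b a)) C"
  unfolding matrix_bounded_def
proof (intro conjI allI impI)
  show "0 \<le> C" using assms by (simp add: matrix_bounded_def)
  fix E F :: "'a set" and f g :: "'a \<Rightarrow> complex"
  assume *: "finite E \<and> E \<subseteq> A \<and> finite F \<and> F \<subseteq> A"
  have "cmod (\<Sum>a\<in>E. \<Sum>b\<in>F. cnj (g a) * cnj (c b a) * f b)
      = cmod (cnj (\<Sum>a\<in>E. \<Sum>b\<in>F. cnj (g a) * cnj (c b a) * f b))" by (metis complex_mod_cnj)
  also have "cnj (\<Sum>a\<in>E. \<Sum>b\<in>F. cnj (g a) * cnj (c b a) * f b)
      = (\<Sum>b\<in>F. \<Sum>a\<in>E. cnj (f b) * c b a * g a)"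
    by (subst sum.swap) (simp add: mult_ac)
  also have "cmod \<dots> \<le> C * L2_set (\<lambda>a. cmod (f a)) F * L2_set (\<lambda>b. cmod (g b)) E"
    using assms * unfolding matrix_bounded_def by blast
  finally show "cmod (\<Sum>a\<in>E. \<Sum>b\<in>F. cnj (g a) * cnj (c b a) * f b)
      \<le> C * L2_set (\<lambda>a. cmod (g a)) E * L2_set (\<lambda>b. cmod (f b)) F" by (simp add: mult_ac)
qed

text \<open>Testing the form with the unit vector at \<open>a\<close> and the conjugated row over
  \<open>F\<close> gives x * x \<le> C * x for the norm x of that piece of the row.\<close>

lemma matrix_bounded_row:
  assumes "matrix_bounded A c C" "a \<in> A"
  shows "square_summable A (c a)"
proof (rule l2_bound)
  fix F assume F: "finite F" "F \<subseteq> A"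
  let ?x = "L2_set (\<lambda>b. cmod (c a b)) F"
  have x2: "?x\<^sup>2 = (\<Sum>b\<in>F. (cmod (c a b))\<^sup>2)" by (simp add: L2_set_def sum_nonneg)
  have "(\<Sum>b\<in>F. c a b * cnj (c a b)) = complex_of_real (?x\<^sup>2)"
    unfolding x2 of_real_sum by (intro sum.cong refl) (metis complex_norm_square)
  then have "?x\<^sup>2 = cmod (\<Sum>b\<in>F. c a b * cnj (c a b))"
    by (simp only: norm_of_real abs_power2)
  also have "\<dots> \<le> C * ?x"
  proof -
    have "cmod (\<Sum>a\<in>{a}. \<Sum>b\<in>F. cnj 1 * c a b * cnj (c a b))
        \<le> C * L2_set (\<lambda>a. cmod 1) {a} * L2_set (\<lambda>b. cmod (cnj (c a b))) F"
      using assms F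
        matrix_bounded_def[THEN iffD1, OF assms(1), THEN conjunct2, rule_format,
          of "{a}" F "\<lambda>_. 1" "\<lambda>b. cnj (c a b)"] by simp
    then show ?thesis by simp
  qed
  finally have "?x * ?x \<le> C * ?x" by (simp add: power2_eq_square)
  moreover have "0 \<le> C" using assms by (simp add: matrix_bounded_def)
  ultimately show "?x \<le> C" using L2_set_nonneg[of "\<lambda>b. cmod (c a b)" F]
    by (metis mult_le_cancel_right order.trans not_less)
qed

lemma matop_apply_has_sum:
  assumes "matrix_bounded A c C" "a \<in> A" "f \<in> l2 A"
  shows "((\<lambda>b. c a b * f b) has_sum matop A c f a) A"
proof -
  have "square_summable A (\<lambda>b. cnj (c a b))"
    using matrix_bounded_row[OF assms(1,2)] by simp
  from l2_inner_summable(1)[OF this l2D[OF assms(3)]]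
  show ?thesis using assms by (simp add: matop_def has_sum_infsum)
qed

text \<open>The form is tested on the left with the image itself, cut down to a finite set
  \<open>E\<close>. Only the right vector is let grow to full support, which is a limit of finite
  sums; then x * x \<le> C * x * \<open>l2_norm A f\<close> is divided by x.\<close>

lemma matop_l2:
  assumes "matrix_bounded A c C" "f \<in> l2 A"
  shows "matop A c f \<in> l2 A" "l2_norm A (matop A c f) \<le> C * l2_norm A f"
proof -
  have C: "0 \<le> C" using assms by (simp add: matrix_bounded_def)
  have b: "L2_set (\<lambda>a. cmod (matop A c f a)) E \<le> C * l2_norm A f" if E: "finite E" "E \<subseteq> A" for E
  proof -
    let ?g = "matop A c f" and ?x = "L2_set (\<lambda>a. cmod (matop A c f a)) E"
    have "((\<lambda>F. \<Sum>b\<in>F. c a b * f b) \<longlongrightarrow> ?g a) (finite_subsets_at_top A)" if "a \<in> E" for a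
      using matop_apply_has_sum[OF assms(1) _ assms(2), of a] that E by (auto simp: has_sum_def)
    then have "((\<lambda>F. \<Sum>a\<in>E. cnj (?g a) * (\<Sum>b\<in>F. c a b * f b)) \<longlongrightarrow> (\<Sum>a\<in>E. cnj (?g a) * ?g a))
        (finite_subsets_at_top A)"
      by (intro tendsto_intros)
    then have "((\<lambda>F. cmod (\<Sum>a\<in>E. cnj (?g a) * (\<Sum>b\<in>F. c a b * f b))) \<longlongrightarrow>
        cmod (\<Sum>a\<in>E. cnj (?g a) * ?g a)) (finite_subsets_at_top A)"
      by (rule tendsto_norm)
    moreover have "\<forall>\<^sub>F F in finite_subsets_at_top A.
        cmod (\<Sum>a\<in>E. cnj (?g a) * (\<Sum>b\<in>F. c a b * f b)) \<le> C * ?x * l2_norm A f"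
    proof (rule eventually_finite_subsets_at_top_weakI)
      fix F assume F: "finite F" "F \<subseteq> A"
      have "cmod (\<Sum>a\<in>E. cnj (?g a) * (\<Sum>b\<in>F. c a b * f b))
          = cmod (\<Sum>a\<in>E. \<Sum>b\<in>F. cnj (?g a) * c a b * f b)"
        by (simp add: sum_distrib_left mult_ac)
      also have "\<dots> \<le> C * ?x * L2_set (\<lambda>b. cmod (f b)) F"
        using assms(1) E F unfolding matrix_bounded_def by blast
      also have "\<dots> \<le> C * ?x * l2_norm A f"
        using L2_set_le_l2_norm[OF l2D[OF assms(2)] F] C by (intro mult_left_mono) auto
      finally show "cmod (\<Sum>a\<in>E. cnj (?g a) * (\<Sum>b\<in>F. c a b * f b)) \<le> C * ?x * l2_norm A f" .
    qed
    ultimately have "cmod (\<Sum>a\<in>E. cnj (?g a) * ?g a) \<le> C * ?x * l2_norm A f"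
      by (rule tendsto_upperbound) simp
    moreover have "(\<Sum>a\<in>E. cnj (?g a) * ?g a) = complex_of_real (?x\<^sup>2)"
    proof -
      have "?x\<^sup>2 = (\<Sum>a\<in>E. (cmod (?g a))\<^sup>2)" by (simp add: L2_set_def sum_nonneg)
      then show ?thesis
        by (simp only: of_real_sum) (intro sum.cong refl, metis complex_norm_square mult.commute)
    qed
    ultimately have "?x\<^sup>2 \<le> C * ?x * l2_norm A f"
      by (simp only: norm_of_real abs_power2)
    then have "?x * ?x \<le> (C * l2_norm A f) * ?x"
      by (simp add: power2_eq_square mult_ac)
    moreover have "0 \<le> C * l2_norm A f" using C by simp
    ultimately show ?thesis using L2_set_nonneg[of "\<lambda>a. cmod (?g a)" E]
      by (metis mult_le_cancel_right order.trans not_less)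
  qed
  show "l2_norm A (matop A c f) \<le> C * l2_norm A f" using l2_bound(2)[OF b] .
  show "matop A c f \<in> l2 A"
    using l2_bound(1)[OF b] assms(2) by (auto simp: l2_def matop_def)
qed

lemma matop_bounded_ops:
  assumes c: "matrix_bounded A c C"
  shows "matop A c \<in> bounded_ops A"
proof -
  have "matop A c (\<lambda>t. f t + g t) = (\<lambda>t. matop A c f t + matop A c g t)"
    if f: "f \<in> l2 A" and g: "g \<in> l2 A" for f g
  proof (rule l2_eqI[of _ A])
    show "matop A c (\<lambda>t. f t + g t) \<in> l2 A" by (rule matop_l2(1)[OF c l2_addI[OF f g]])
    show "(\<lambda>t. matop A c f t + matop A c g t) \<in> l2 A"
      by (rule l2_addI[OF matop_l2(1)[OF c f] matop_l2(1)[OF c g]])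
    fix a assume a: "a \<in> A"
    have "((\<lambda>b. c a b * (f b + g b)) has_sum matop A c f a + matop A c g a) A"
      unfolding distrib_left
      by (rule has_sum_add[OF matop_apply_has_sum[OF c a f] matop_apply_has_sum[OF c a g]])
    then show "matop A c (\<lambda>t. f t + g t) a = matop A c f a + matop A c g a"
      by (rule has_sum_unique[OF matop_apply_has_sum[OF c a l2_addI[OF f g]]])
  qed
  moreover have "matop A c (\<lambda>t. k * f t) = (\<lambda>t. k * matop A c f t)" if f: "f \<in> l2 A" for k f
  proof (rule l2_eqI[of _ A])
    show "matop A c (\<lambda>t. k * f t) \<in> l2 A" by (rule matop_l2(1)[OF c l2_cmultI[OF f]])
    show "(\<lambda>t. k * matop A c f t) \<in> l2 A" by (rule l2_cmultI[OF matop_l2(1)[OF c f]])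
    fix a assume a: "a \<in> A"
    have "((\<lambda>b. c a b * (k * f b)) has_sum k * matop A c f a) A"
      unfolding mult.left_commute[of _ k]
      by (rule has_sum_cmult_right[OF matop_apply_has_sum[OF c a f]])
    then show "matop A c (\<lambda>t. k * f t) a = k * matop A c f a"
      by (rule has_sum_unique[OF matop_apply_has_sum[OF c a l2_cmultI[OF f]]])
  qed
  ultimately show ?thesis
    unfolding bounded_ops_def mem_Collect_eq
    using matop_l2[OF c] by (intro conjI PiE_I exI[of _ C]) (simp_all add: matop_def)
qed

lemma matop_delta:
  assumes "matrix_bounded A c C" "a \<in> A" "b \<in> A"
  shows "matop A c (delta b) a = c a b"
proof -
  have "((\<lambda>x. c a x * delta b x) has_sum c a b) A"
    using has_sum_finite_neutralI[of "{b}" A "\<lambda>x. c a x * delta b x"] assms(3)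
    by (simp add: delta_def)
  then show ?thesis
    using has_sum_unique[OF matop_apply_has_sum[OF assms(1,2) delta_in_l2[OF assms(3)]]] by simp
qed

lemma bounded_opsD:
  assumes "T \<in> bounded_ops A" "f \<in> l2 A"
  shows "T f \<in> l2 A" "g \<in> l2 A \<Longrightarrow> T (\<lambda>t. f t + g t) = (\<lambda>t. T f t + T g t)"
    "T (\<lambda>t. c * f t) = (\<lambda>t. c * T f t)"
proof -
  have *: "T \<in> l2 A \<rightarrow>\<^sub>E l2 A"
    "\<forall>f\<in>l2 A. \<forall>g\<in>l2 A. T (\<lambda>t. f t + g t) = (\<lambda>t. T f t + T g t)"
    "\<forall>c. \<forall>f\<in>l2 A. T (\<lambda>t. c * f t) = (\<lambda>t. c * T f t)"
    using assms(1) by (simp_all add: bounded_ops_def)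
  show "T f \<in> l2 A" by (rule PiE_mem[OF *(1) assms(2)])
  show "g \<in> l2 A \<Longrightarrow> T (\<lambda>t. f t + g t) = (\<lambda>t. T f t + T g t)"
    by (rule *(2)[rule_format, OF assms(2)])
  show "T (\<lambda>t. c * f t) = (\<lambda>t. c * T f t)"
    by (rule *(3)[rule_format, OF assms(2)])
qed

lemma bounded_ops_bound:
  assumes "T \<in> bounded_ops A"
  obtains C where "0 \<le> C" "\<And>f. f \<in> l2 A \<Longrightarrow> l2_norm A (T f) \<le> C * l2_norm A f"
proof -
  have "\<exists>C. \<forall>f\<in>l2 A. l2_norm A (T f) \<le> C * l2_norm A f"
    using assms by (simp add: bounded_ops_def)
  then obtain C where C: "\<And>f. f \<in> l2 A \<Longrightarrow> l2_norm A (T f) \<le> C * l2_norm A f" by blast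
  show thesis
  proof (rule that[of "max 0 C"])
    show "l2_norm A (T f) \<le> max 0 C * l2_norm A f" if "f \<in> l2 A" for f
      using C[OF that] mult_right_mono[of C "max 0 C" "l2_norm A f"] by simp
  qed simp
qed

lemma op_norm_bound:
  assumes T: "T \<in> bounded_ops A" and f: "f \<in> l2 A"
  shows "l2_norm A (T f) \<le> op_norm A T * l2_norm A f"
proof -
  obtain C where C: "0 \<le> C" "\<And>f. f \<in> l2 A \<Longrightarrow> l2_norm A (T f) \<le> C * l2_norm A f"
    using bounded_ops_bound[OF T] by metis
  \<comment> \<open>The supremum in \<open>op_norm\<close> is one of real numbers and bounds its
    members only when the set is bounded above.\<close>
  have bdd: "bdd_above ((\<lambda>f. l2_norm A (T f)) ` {f \<in> l2 A. l2_norm A f \<le> 1})"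
  proof (rule bdd_aboveI2)
    fix f assume "f \<in> {f \<in> l2 A. l2_norm A f \<le> 1}"
    then have "l2_norm A (T f) \<le> C * l2_norm A f" "C * l2_norm A f \<le> C * 1"
      using C mult_left_mono[of "l2_norm A f" 1 C] by auto
    then show "l2_norm A (T f) \<le> C" by simp
  qed
  show ?thesis
  proof (cases "l2_norm A f = 0")
    case True
    then show ?thesis using C(2)[OF f] by simp
  next
    case False
    let ?n = "l2_norm A f" and ?c = "complex_of_real (inverse (l2_norm A f))"
    have n: "?n > 0" using False l2_norm_nonneg[of A f] by linarith
    have u: "(\<lambda>t. ?c * f t) \<in> {f \<in> l2 A. l2_norm A f \<le> 1}"
      using l2_cmultI[OF f] n by (simp add: l2_norm_cmult del: of_real_inverse)
    have "l2_norm A (T (\<lambda>t. ?c * f t)) = l2_norm A (T f) / ?n"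
      using n unfolding bounded_opsD(3)[OF T f] l2_norm_cmult
      by (simp add: norm_inverse divide_inverse del: of_real_inverse)
    then have "l2_norm A (T f) / ?n \<le> op_norm A T"
      unfolding op_norm_def using cSUP_upper[OF u bdd] by simp
    then show ?thesis using n by (simp add: divide_le_eq)
  qed
qed

lemma bounded_functional_entry:
  assumes T: "T \<in> bounded_ops A" and a: "a \<in> A"
  shows "bounded_functional A (\<lambda>f. T f a)"
proof -
  obtain C where C: "0 \<le> C" "\<And>f. f \<in> l2 A \<Longrightarrow> l2_norm A (T f) \<le> C * l2_norm A f"
    using bounded_ops_bound[OF T] by metis
  have "cmod (T f a) \<le> C * l2_norm A f" if "f \<in> l2 A" for f
    using cmod_le_l2_norm[OF l2D[OF bounded_opsD(1)[OF T that]] a] C(2)[OF that] by simp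
  then show ?thesis
    unfolding bounded_functional_def using bounded_opsD(2,3)[OF T] by auto
qed

lemma bounded_functional_inner:
  assumes T: "T \<in> bounded_ops A" and g: "square_summable A g"
  shows "bounded_functional A (\<lambda>f. l2_inner A g (T f))"
proof -
  obtain C where C: "0 \<le> C" "\<And>f. f \<in> l2 A \<Longrightarrow> l2_norm A (T f) \<le> C * l2_norm A f"
    using bounded_ops_bound[OF T] by metis
  have s: "square_summable A (T f)" if "f \<in> l2 A" for f
    by (rule l2D[OF bounded_opsD(1)[OF T that]])
  have "cmod (l2_inner A g (T f)) \<le> (l2_norm A g * C) * l2_norm A f" if "f \<in> l2 A" for f
    using l2_Cauchy_Schwarz[OF g s[OF that]] mult_left_mono[OF C(2)[OF that], of "l2_norm A g"]
    by (simp add: mult_ac)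
  then show ?thesis
    unfolding bounded_functional_def
    using bounded_opsD(2,3)[OF T] l2_inner_add_right[OF g s s] l2_inner_cmult_right by auto
qed

lemma bounded_ops_has_sum:
  assumes "T \<in> bounded_ops A" "a \<in> A" "f \<in> l2 A"
  shows "((\<lambda>b. T (delta b) a * f b) has_sum T f a) A"
  using bounded_functional_has_sum[OF bounded_functional_entry[OF assms(1,2)] assms(3)] .

text \<open>The matrix determines the operator on \<open>l2 A\<close> by the coordinate expansion;
  off \<open>l2 A\<close> both operators are undefined.\<close>

lemma bounded_ops_eqI:
  assumes T: "T \<in> bounded_ops A" and S: "S \<in> bounded_ops A"
    and "\<And>a b. a \<in> A \<Longrightarrow> b \<in> A \<Longrightarrow> T (delta b) a = S (delta b) a"
  shows "T = S"
proof
  fix f show "T f = S f"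
  proof (cases "f \<in> l2 A")
    case f: True
    show ?thesis
    proof (rule l2_eqI[OF bounded_opsD(1)[OF T f] bounded_opsD(1)[OF S f]])
      fix a assume a: "a \<in> A"
      have "((\<lambda>b. T (delta b) a * f b) has_sum S f a) A"
        using bounded_ops_has_sum[OF S a f] assms(3)[OF a] by (simp cong: has_sum_cong)
      then show "T f a = S f a"
        by (rule has_sum_unique[OF bounded_ops_has_sum[OF T a f]])
    qed
  next
    case False
    have *: "T \<in> l2 A \<rightarrow>\<^sub>E l2 A" "S \<in> l2 A \<rightarrow>\<^sub>E l2 A"
      using T S by (simp_all add: bounded_ops_def)
    show ?thesis using PiE_arb[OF *(1) False] PiE_arb[OF *(2) False] by (rule trans[OF _ sym])
  qed
qed

lemma bounded_ops_finite_sum: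
  assumes T: "T \<in> bounded_ops A" and F: "finite F" "F \<subseteq> A"
  shows "T (\<lambda>t. \<Sum>b\<in>F. f b * delta b t) = (\<lambda>a. \<Sum>b\<in>F. f b * T (delta b) a)"
proof
  fix a
  show "T (\<lambda>t. \<Sum>b\<in>F. f b * delta b t) a = (\<Sum>b\<in>F. f b * T (delta b) a)"
  proof (cases "a \<in> A")
    case True
    show ?thesis by (rule bounded_functional_finite(1)[OF bounded_functional_entry[OF T True] F])
  next
    case False
    have "T (\<lambda>t. \<Sum>b\<in>F. f b * delta b t) a = 0"
    proof (rule l2_outside[OF bounded_opsD(1)[OF T] False])
      show "(\<lambda>t. \<Sum>b\<in>F. f b * delta b t) \<in> l2 A"
        using square_summable_finite_support(1)[of F A "chi F f"] F
        unfolding chi_eq_sum_delta[OF F(1), symmetric] l2_def by (auto simp: chi_apply)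
    qed
    moreover have "T (delta b) a = 0" if "b \<in> F" for b
      using that F by (intro l2_outside[OF bounded_opsD(1)[OF T delta_in_l2] False]) auto
    ultimately show ?thesis by simp
  qed
qed

text \<open>The finite double sum is the inner product of \<open>chi E g\<close> with the image of
  \<open>chi F f\<close>, and Cauchy-Schwarz applies.\<close>

lemma matrix_bounded_of_op:
  assumes T: "T \<in> bounded_ops A" and C: "0 \<le> C" "\<And>f. f \<in> l2 A \<Longrightarrow> l2_norm A (T f) \<le> C * l2_norm A f"
  shows "matrix_bounded A (\<lambda>a b. T (delta b) a) C"
  unfolding matrix_bounded_def
proof (intro conjI allI impI C(1))
  fix E F :: "'a set" and f g :: "'a \<Rightarrow> complex"
  assume *: "finite E \<and> E \<subseteq> A \<and> finite F \<and> F \<subseteq> A"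
  have cg: "chi E g \<in> l2 A" "l2_norm A (chi E g) = L2_set (\<lambda>a. cmod (g a)) E"
    and cf: "chi F f \<in> l2 A" "l2_norm A (chi F f) = L2_set (\<lambda>a. cmod (f a)) F"
  proof -
    have "chi H h \<in> l2 A \<and> l2_norm A (chi H h) = L2_set (\<lambda>a. cmod (h a)) H"
      if "finite H" "H \<subseteq> A" for H and h :: "'a \<Rightarrow> complex"
    proof -
      have z: "\<And>t. t \<in> A - H \<Longrightarrow> chi H h t = 0" by (simp add: chi_apply)
      have "L2_set (\<lambda>a. cmod (chi H h a)) (A \<inter> H) = L2_set (\<lambda>a. cmod (h a)) H"
        using that by (intro L2_set_cong) (auto simp: chi_apply)
      then show ?thesis
        using square_summable_finite_support[of H A "chi H h", OF that(1) z] that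
        by (auto simp: l2_def chi_apply)
    qed
    then show "chi E g \<in> l2 A" "l2_norm A (chi E g) = L2_set (\<lambda>a. cmod (g a)) E"
      "chi F f \<in> l2 A" "l2_norm A (chi F f) = L2_set (\<lambda>a. cmod (f a)) F" using * by auto
  qed
  have "(\<Sum>a\<in>E. \<Sum>b\<in>F. cnj (g a) * T (delta b) a * f b)
      = (\<Sum>a\<in>E. cnj (g a) * T (chi F f) a)"
    using bounded_ops_finite_sum[OF T, of F f] * chi_eq_sum_delta[of F f]
    by (simp add: sum_distrib_left mult_ac)
  also have "\<dots> = (\<Sum>a\<in>E. cnj (chi E g a) * T (chi F f) a)"
    by (simp add: chi_apply)
  also have "\<dots> = l2_inner A (chi E g) (T (chi F f))"
    using * by (intro l2_inner_finite_support[symmetric]) (auto simp: chi_apply)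
  finally have "cmod (\<Sum>a\<in>E. \<Sum>b\<in>F. cnj (g a) * T (delta b) a * f b)
      \<le> l2_norm A (chi E g) * l2_norm A (T (chi F f))"
    using l2_Cauchy_Schwarz[OF l2D[OF cg(1)] l2D[OF bounded_opsD(1)[OF T cf(1)]]] by simp
  also have "\<dots> \<le> l2_norm A (chi E g) * (C * l2_norm A (chi F f))"
    by (intro mult_left_mono C(2) cf) simp
  finally show "cmod (\<Sum>a\<in>E. \<Sum>b\<in>F. cnj (g a) * T (delta b) a * f b)
      \<le> C * L2_set (\<lambda>a. cmod (g a)) E * L2_set (\<lambda>b. cmod (f b)) F"
    by (simp add: cg cf mult_ac)
qed

lemma adjoint_unique:
  assumes "S \<in> bounded_ops A" "S' \<in> bounded_ops A"
    and "\<And>f g. f \<in> l2 A \<Longrightarrow> g \<in> l2 A \<Longrightarrow> l2_inner A f (S g) = l2_inner A f (S' g)"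
  shows "S = S'"
proof (rule bounded_ops_eqI[OF assms(1,2)])
  fix a b assume "a \<in> A" "b \<in> A"
  then show "S (delta b) a = S' (delta b) a"
    using assms(3)[of "delta a" "delta b"] by simp
qed

lemma op_adj_eqI:
  assumes "S \<in> bounded_ops A"
    and "\<And>f g. f \<in> l2 A \<Longrightarrow> g \<in> l2 A \<Longrightarrow> l2_inner A (T f) g = l2_inner A f (S g)"
  shows "op_adj A T = S"
  unfolding op_adj_def
proof (rule the_equality)
  show "S \<in> bounded_ops A \<and> (\<forall>f\<in>l2 A. \<forall>g\<in>l2 A. l2_inner A (T f) g = l2_inner A f (S g))"
    using assms by blast
  fix S' assume "S' \<in> bounded_ops A \<and> (\<forall>f\<in>l2 A. \<forall>g\<in>l2 A. l2_inner A (T f) g = l2_inner A f (S' g))"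
  then show "S' = S"
    using assms by (intro adjoint_unique[of S' A S]) auto
qed

text \<open>The adjoint is built as the operator of the conjugate transposed matrix, which satisfies
  the same finite bound. The adjoint relation comes from expanding the bounded functional that pairs
  \<open>g\<close> with \<open>T f\<close> along the coordinates of \<open>f\<close>. The constant
  \<open>C\<close> is kept, so a uniformly bounded family has a uniformly bounded adjoint
  family.\<close>

lemma op_adj:
  assumes T: "T \<in> bounded_ops A" and C: "0 \<le> C" "\<And>f. f \<in> l2 A \<Longrightarrow> l2_norm A (T f) \<le> C * l2_norm A f"
  shows "op_adj A T \<in> bounded_ops A"
    and "\<And>f g. f \<in> l2 A \<Longrightarrow> g \<in> l2 A \<Longrightarrow> l2_inner A (T f) g = l2_inner A f (op_adj A T g)"
    and "\<And>f. f \<in> l2 A \<Longrightarrow> l2_norm A (op_adj A T f) \<le> C * l2_norm A f"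
    and "\<And>a b. a \<in> A \<Longrightarrow> b \<in> A \<Longrightarrow> op_adj A T (delta b) a = cnj (T (delta a) b)"
proof -
  let ?c = "\<lambda>a b. cnj (T (delta a) b)"
  have m: "matrix_bounded A ?c C"
    using matrix_bounded_adjoint[OF matrix_bounded_of_op[OF T C]] by simp
  have adj: "l2_inner A (T f) g = l2_inner A f (matop A ?c g)" if f: "f \<in> l2 A" and g: "g \<in> l2 A" for f g
  proof -
    have "((\<lambda>b. l2_inner A g (T (delta b)) * f b) has_sum l2_inner A g (T f)) A"
      by (rule bounded_functional_has_sum[OF bounded_functional_inner[OF T l2D[OF g]] f])
    then have "((\<lambda>b. cnj (l2_inner A g (T (delta b)) * f b)) has_sum cnj (l2_inner A g (T f))) A"
      unfolding has_sum_cnj_iff .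
    moreover have "cnj (l2_inner A g (T (delta b)) * f b) = cnj (f b) * matop A ?c g b" if "b \<in> A" for b
      using that g l2_inner_commute[of A "T (delta b)" g] by (simp add: matop_def l2_inner_def)
    ultimately have "((\<lambda>b. cnj (f b) * matop A ?c g b) has_sum cnj (l2_inner A g (T f))) A"
      by (subst (asm) has_sum_cong) auto
    then have "((\<lambda>b. cnj (f b) * matop A ?c g b) has_sum l2_inner A (T f) g) A"
      unfolding l2_inner_commute[of A "T f" g, symmetric] .
    then show ?thesis unfolding l2_inner_def[of A f] by (simp add: infsumI)
  qed
  have eq: "op_adj A T = matop A ?c"
    by (rule op_adj_eqI[OF matop_bounded_ops[OF m] adj])
  show "op_adj A T \<in> bounded_ops A" unfolding eq by (rule matop_bounded_ops[OF m])
  show "\<And>f g. f \<in> l2 A \<Longrightarrow> g \<in> l2 A \<Longrightarrow> l2_inner A (T f) g = l2_inner A f (op_adj A T g)"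
    unfolding eq by (rule adj)
  show "\<And>f. f \<in> l2 A \<Longrightarrow> l2_norm A (op_adj A T f) \<le> C * l2_norm A f"
    unfolding eq by (rule matop_l2(2)[OF m])
  show "\<And>a b. a \<in> A \<Longrightarrow> b \<in> A \<Longrightarrow> op_adj A T (delta b) a = cnj (T (delta a) b)"
    unfolding eq by (simp add: matop_delta[OF m])
qed

section \<open>Local bisections and the module of square-summable sections\<close>

text \<open>Stated with the unpunctured filter \<open>nhdsin\<close>, so that eventual properties
  include the point itself and the limit rules for sums and products give continuity
  directly.\<close>

lemma continuous_map_euclidean_iff:
  "continuous_map S euclidean f \<longleftrightarrow> (\<forall>p\<in>topspace S. (f \<longlongrightarrow> f p) (nhdsin S p))"
proof
  assume c: "continuous_map S euclidean f"
  show "\<forall>p\<in>topspace S. (f \<longlongrightarrow> f p) (nhdsin S p)"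
  proof (intro ballI topological_tendstoI)
    fix p W assume "p \<in> topspace S" "open W" "f p \<in> W"
    then show "\<forall>\<^sub>F x in nhdsin S p. f x \<in> W"
      using openin_continuous_map_preimage[OF c, of W] unfolding eventually_nhdsin by auto
  qed
next
  assume "\<forall>p\<in>topspace S. (f \<longlongrightarrow> f p) (nhdsin S p)"
  then show "continuous_map S euclidean f"
    unfolding continuous_map_atin atin_def limitin_canonical_iff
    using tendsto_mono inf_le1 by metis
qed

lemma continuous_map_uniform_approx:
  fixes f :: "'a \<Rightarrow> complex"
  assumes "\<And>e. e > 0 \<Longrightarrow> \<exists>g. continuous_map S euclidean g \<and> (\<forall>p\<in>topspace S. cmod (f p - g p) \<le> e)"
  shows "continuous_map S euclidean f"
  unfolding continuous_map_euclidean_iff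
proof (intro ballI tendstoI)
  fix p and e :: real assume p: "p \<in> topspace S" and e: "0 < e"
  obtain g where g: "continuous_map S euclidean g" "\<And>p. p \<in> topspace S \<Longrightarrow> cmod (f p - g p) \<le> e / 4"
    using assms[of "e / 4"] e by auto
  have "\<forall>\<^sub>F x in nhdsin S p. dist (g x) (g p) < e / 4"
    using g(1) p e unfolding continuous_map_euclidean_iff by (intro tendstoD) auto
  moreover have "\<forall>\<^sub>F x in nhdsin S p. x \<in> topspace S"
    using p unfolding eventually_nhdsin by blast
  ultimately show "\<forall>\<^sub>F x in nhdsin S p. dist (f x) (f p) < e"
  proof eventually_elim
    case (elim x)
    have "f x - f p = (f x - g x) + (g x - g p) - (f p - g p)" by simp
    also have "cmod \<dots> \<le> cmod (f x - g x) + cmod (g x - g p) + cmod (f p - g p)"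
      by (meson norm_triangle_ineq norm_triangle_ineq4 add_right_mono order_trans)
    finally show ?case using g(2)[OF p] g(2)[of x] elim e by (simp add: dist_norm)
  qed
qed

section \<open>Source, range and products of compact sets in an etale groupoid\<close>

locale etale_groupoid =
  fixes G :: "'g tgroupoid"
  assumes etale: "lc_etale_groupoid G"
begin

abbreviation arrows :: "'g set" where
  "arrows \<equiv> topspace (gtop G)"

lemma algebraic: "algebraic_groupoid G"
  using etale by (simp add: lc_etale_groupoid_def topological_groupoid_def)

lemma Hausdorff: "Hausdorff_space (gtop G)"
  using etale by (simp add: lc_etale_groupoid_def)

lemma locally_compact: "locally_compact_space (gtop G)"
  using etale by (simp add: lc_etale_groupoid_def)

lemma completely_regular: "completely_regular_space (gtop G)"
  using locally_compact Hausdorff locally_compact_Hausdorff_imp_regular_space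
    locally_compact_regular_imp_completely_regular_space by blast

lemma src_units: "p \<in> arrows \<Longrightarrow> gsrc G p \<in> units G"
  by (simp add: units_def)

lemma units_subset: "units G \<subseteq> arrows"
  using algebraic by (auto simp: units_def algebraic_groupoid_def)

lemma topspace_unit_space: "topspace (unit_space G) = units G"
  using units_subset by (auto simp: unit_space_def)

lemma fibD: "p \<in> fib G x \<Longrightarrow> p \<in> arrows" "p \<in> fib G x \<Longrightarrow> gsrc G p = x"
  by (auto simp: fib_def)

lemma in_fib_src: "p \<in> arrows \<Longrightarrow> p \<in> fib G (gsrc G p)"
  by (simp add: fib_def)

text \<open>The source of \<open>p\<close> is the product of \<open>ginv G p\<close> and
  \<open>p\<close>, so the source map is composed of inversion and multiplication.\<close>

lemma src_continuous: "continuous_map (gtop G) (gtop G) (gsrc G)"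
proof -
  have "continuous_map (gtop G) (prod_topology (gtop G) (gtop G)) (\<lambda>p. (ginv G p, p))"
    using lc_etale_groupoidD(4)[OF etale] by (intro continuous_map_pairedI) auto
  then have "continuous_map (gtop G)
      (subtopology (prod_topology (gtop G) (gtop G)) (composable G)) (\<lambda>p. (ginv G p, p))"
    using algebraic by (intro continuous_map_into_subtopology)
      (auto simp: composable_def algebraic_groupoid_def)
  moreover have "continuous_map (subtopology (prod_topology (gtop G) (gtop G)) (composable G))
      (gtop G) (\<lambda>(\<alpha>, \<beta>). gmult G \<alpha> \<beta>)"
    using etale by (simp add: lc_etale_groupoid_def topological_groupoid_def)
  ultimately have "continuous_map (gtop G) (gtop G)
      ((\<lambda>(\<alpha>, \<beta>). gmult G \<alpha> \<beta>) \<circ> (\<lambda>p. (ginv G p, p)))"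
    by (rule continuous_map_compose)
  then show ?thesis
    by (rule continuous_map_eq) (use algebraic in \<open>auto simp: algebraic_groupoid_def\<close>)
qed

lemma rng_continuous: "continuous_map (gtop G) (gtop G) (grng G)"
proof -
  have "continuous_map (gtop G) (gtop G) (gsrc G \<circ> ginv G)"
    using lc_etale_groupoidD(4)[OF etale] src_continuous by (rule continuous_map_compose)
  then show ?thesis
    by (rule continuous_map_eq) (use algebraic in \<open>auto simp: algebraic_groupoid_def\<close>)
qed

text \<open>The set of composable pairs is closed, being the locus where two continuous maps into a
  Hausdorff space agree. So its intersection with \<open>K \<times> L\<close> is compact, and the
  product set is the image of that intersection under multiplication.\<close>

lemma compactin_set_mult:
  assumes "compactin (gtop G) K" "compactin (gtop G) L"
  shows "compactin (gtop G) (set_mult G K L)"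
proof -
  let ?P = "prod_topology (gtop G) (gtop G)"
  have c: "closedin ?P (composable G)"
  proof -
    have "continuous_map ?P (gtop G) (gsrc G \<circ> fst)" "continuous_map ?P (gtop G) (grng G \<circ> snd)"
      by (rule continuous_map_compose[OF continuous_map_fst src_continuous],
          rule continuous_map_compose[OF continuous_map_snd rng_continuous])
    from closedin_continuous_maps_eq[OF Hausdorff this]
    show ?thesis by (simp add: composable_def case_prod_unfold mem_Times_iff conj_assoc)
  qed
  have "compactin ?P (K \<times> L)" using assms by (simp add: compactin_Times)
  then have "compactin ?P ((K \<times> L) \<inter> composable G)"
    using c by (rule compact_Int_closedin)
  then have "compactin (subtopology ?P (composable G)) ((K \<times> L) \<inter> composable G)"
    by (simp add: compactin_subtopology)
  moreover have "continuous_map (subtopology ?P (composable G)) (gtop G) (\<lambda>(\<alpha>, \<beta>). gmult G \<alpha> \<beta>)"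
    using etale by (simp add: lc_etale_groupoid_def topological_groupoid_def)
  ultimately have "compactin (gtop G) ((\<lambda>(\<alpha>, \<beta>). gmult G \<alpha> \<beta>) ` ((K \<times> L) \<inter> composable G))"
    by (rule image_compactin)
  moreover have "(\<lambda>(\<alpha>, \<beta>). gmult G \<alpha> \<beta>) ` ((K \<times> L) \<inter> composable G) = set_mult G K L"
  proof -
    have "K \<subseteq> arrows" "L \<subseteq> arrows"
      using assms compactin_subset_topspace by blast+
    then have "(K \<times> L) \<inter> composable G = {(\<alpha>, \<beta>). \<alpha> \<in> K \<and> \<beta> \<in> L \<and> gsrc G \<alpha> = grng G \<beta>}"
      unfolding composable_def by blast
    then show ?thesis unfolding set_mult_def by auto
  qed
  ultimately show ?thesis by simp
qed

text \<open>Any \<alpha> in the fibre of \<open>p\<close> factors as (\<alpha> p^-1) p. The first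
  claim locates the quotient \<alpha> p^-1 in a product of compact sets; the second recovers
  \<alpha> as a product with an arrow of \<open>B\<close>.\<close>

lemma in_set_mult_inv:
  assumes "\<alpha> \<in> fib G x" "p \<in> fib G x" "\<alpha> \<in> L" "p \<in> K"
  shows "gmult G \<alpha> (ginv G p) \<in> set_mult G L (ginv G ` K)"
    and "p \<in> B \<Longrightarrow> gmult G \<alpha> (ginv G p) \<in> M \<Longrightarrow> \<alpha> \<in> set_mult G M B"
proof -
  note a = algebraic[unfolded algebraic_groupoid_def]
  have t: "\<alpha> \<in> arrows" "p \<in> arrows" "gsrc G \<alpha> = x" "gsrc G p = x"
    using assms fibD by auto
  have i: "ginv G p \<in> arrows" "grng G (ginv G p) = x" "gsrc G (ginv G p) = grng G p"
    "gmult G (ginv G p) p = x" "gmult G \<alpha> x = \<alpha>"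
    using a t by auto
  show "gmult G \<alpha> (ginv G p) \<in> set_mult G L (ginv G ` K)"
    using assms i t unfolding set_mult_def by blast
  assume B: "p \<in> B" and M: "gmult G \<alpha> (ginv G p) \<in> M"
  have c: "(\<alpha>, ginv G p) \<in> composable G" "(ginv G p, p) \<in> composable G"
    using t i by (auto simp: composable_def)
  have "gmult G (gmult G \<alpha> (ginv G p)) p = gmult G \<alpha> (gmult G (ginv G p) p)"
    using a c by blast
  then have "gmult G (gmult G \<alpha> (ginv G p)) p = \<alpha>" using i by simp
  moreover have "gsrc G (gmult G \<alpha> (ginv G p)) = grng G p"
    using a c(1) i by auto
  ultimately show "\<alpha> \<in> set_mult G M B"
    using B M unfolding set_mult_def by force
qed

section \<open>Open bisections, local sections of the source map, finiteness of fibres over compact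
  sets\<close>

definition bis :: "'g \<Rightarrow> 'g set" where
  "bis p = (SOME U. openin (gtop G) U \<and> p \<in> U \<and> openin (unit_space G) (gsrc G ` U) \<and>
     homeomorphic_map (subtopology (gtop G) U) (subtopology (unit_space G) (gsrc G ` U)) (gsrc G))"

text \<open>The local section of the source through \<open>p\<close>. Off the source image of
  \<open>bis p\<close> its values are arbitrary, so its properties are asserted only eventually near
  a unit.\<close>

definition sec :: "'g \<Rightarrow> 'g \<Rightarrow> 'g" where
  "sec p = inv_into (bis p) (gsrc G)"

lemma bis_props:
  assumes "p \<in> arrows"
  shows "openin (gtop G) (bis p)" "p \<in> bis p" "inj_on (gsrc G) (bis p)"
    and "openin (gtop G) V \<Longrightarrow> V \<subseteq> bis p \<Longrightarrow> openin (unit_space G) (gsrc G ` V)"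
proof -
  have "\<exists>U. openin (gtop G) U \<and> p \<in> U \<and> openin (unit_space G) (gsrc G ` U) \<and>
     homeomorphic_map (subtopology (gtop G) U) (subtopology (unit_space G) (gsrc G ` U)) (gsrc G)"
    using source_local_homeomorphism[OF etale] assms unfolding local_homeomorphism_def by blast
  from someI_ex[OF this]
  have b: "openin (gtop G) (bis p)" "p \<in> bis p" "openin (unit_space G) (gsrc G ` bis p)"
     "homeomorphic_map (subtopology (gtop G) (bis p))
        (subtopology (unit_space G) (gsrc G ` bis p)) (gsrc G)"
    unfolding bis_def by blast+
  show "openin (gtop G) (bis p)" "p \<in> bis p" using b by auto
  have t: "topspace (subtopology (gtop G) (bis p)) = bis p"
    using b(1) openin_subset by fastforce
  show "inj_on (gsrc G) (bis p)"
    using homeomorphic_imp_injective_map[OF b(4)] t by simp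
  assume V: "openin (gtop G) V" "V \<subseteq> bis p"
  then have "openin (subtopology (gtop G) (bis p)) V"
    by (simp add: openin_open_subtopology b(1))
  then have "openin (subtopology (unit_space G) (gsrc G ` bis p)) (gsrc G ` V)"
    using homeomorphic_imp_open_map[OF b(4)] by (simp add: open_map_def)
  then show "openin (unit_space G) (gsrc G ` V)"
    using b(3) openin_trans_full by blast
qed

lemma sec_src: "g \<in> bis p \<Longrightarrow> p \<in> arrows \<Longrightarrow> sec p (gsrc G g) = g"
  unfolding sec_def by (intro inv_into_f_f bis_props)

lemma bis_unique:
  "p \<in> arrows \<Longrightarrow> a \<in> bis p \<Longrightarrow> b \<in> bis p \<Longrightarrow> gsrc G a = gsrc G b \<Longrightarrow> a = b"
  using bis_props(3) by (auto dest: inj_onD)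

text \<open>The neighbourhoods of \<open>w\<close> traced on \<open>X\<close>, with \<open>w\<close>
  itself kept when it lies in \<open>X\<close>. The same filter thus serves at points of
  \<open>X\<close> and at the remaining units.\<close>

definition near :: "'g set \<Rightarrow> 'g \<Rightarrow> 'g filter" where
  "near X w = inf (nhdsin (gtop G) w) (principal X)"

lemma eventually_near:
  assumes "w \<in> units G"
  shows "eventually P (near X w) \<longleftrightarrow> (\<exists>W. openin (gtop G) W \<and> w \<in> W \<and> (\<forall>x\<in>W \<inter> X. P x))"
  using assms units_subset by (auto simp: near_def eventually_inf_principal eventually_nhdsin)

text \<open>Density in the language of filters; it makes limits along \<open>near X w\<close> unique
  and lets them inherit inequalities.\<close>

lemma near_nontrivial:
  assumes "unit_space G closure_of X = units G" "w \<in> units G"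
  shows "near X w \<noteq> bot"
proof
  assume "near X w = bot"
  then have "eventually (\<lambda>_. False) (near X w)" by simp
  then obtain W where W: "openin (gtop G) W" "w \<in> W" "W \<inter> X = {}"
    unfolding eventually_near[OF assms(2)] by blast
  have "openin (unit_space G) (W \<inter> units G)"
    using W(1) by (auto simp: unit_space_def openin_subtopology)
  then show False using W assms by (auto simp: in_closure_of[of w, unfolded assms(1)] set_eq_iff)
      (metis IntI assms(1) in_closure_of Int_iff)
qed

text \<open>The source is open on \<open>bis p\<close>, so the section through \<open>p\<close> is
  also a section through any other \<open>q\<close> of the same bisection. Continuity of a
  coefficient along one section at points away from its centre relies on this.\<close>

lemma eventually_sec_bis:
  assumes p: "p \<in> arrows" and X: "X \<subseteq> units G"
    and V: "openin (gtop G) V" "q \<in> V" and q: "q \<in> bis p"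
  shows "\<forall>\<^sub>F x in near X (gsrc G q). x \<in> X \<and> sec p x \<in> V \<and> sec p x \<in> bis p \<and> sec p x \<in> fib G x"
proof -
  note b = bis_props[OF p]
  have "openin (unit_space G) (gsrc G ` (V \<inter> bis p))"
    using b(4)[of "V \<inter> bis p"] V b(1) by auto
  then obtain W where W: "openin (gtop G) W" "gsrc G ` (V \<inter> bis p) = W \<inter> units G"
    by (auto simp: unit_space_def openin_subtopology)
  have "x \<in> X \<and> sec p x \<in> V \<and> sec p x \<in> bis p \<and> sec p x \<in> fib G x" if "x \<in> W \<inter> X" for x
  proof -
    have "x \<in> gsrc G ` (V \<inter> bis p)" using that W(2) X by blast
    then obtain g where g: "g \<in> V \<inter> bis p" "x = gsrc G g" by blast
    then have "sec p x = g" using sec_src p by simp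
    moreover have "g \<in> arrows" using g V openin_subset by blast
    ultimately show ?thesis using g that by (auto simp: fib_def)
  qed
  moreover have "gsrc G q \<in> W" using W(2) q V(2) by blast
  moreover have "q \<in> arrows" using V openin_subset by blast
  ultimately show ?thesis
    unfolding eventually_near[OF src_units[OF \<open>q \<in> arrows\<close>]] using W(1) by blast
qed

lemma eventually_sec:
  assumes p: "p \<in> arrows" and X: "X \<subseteq> units G" and V: "openin (gtop G) V" "p \<in> V"
  shows "\<forall>\<^sub>F x in near X (gsrc G p). x \<in> X \<and> sec p x \<in> V \<and> sec p x \<in> bis p \<and> sec p x \<in> fib G x"
  by (rule eventually_sec_bis[OF p X V bis_props(2)[OF p]])

lemma compact_bis_cover:
  assumes "compactin (gtop G) K"
  obtains C where "finite C" "C \<subseteq> arrows" "K \<subseteq> \<Union>(bis ` C)"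
proof -
  have K: "K \<subseteq> arrows" using assms compactin_subset_topspace by blast
  have "\<exists>\<F>. finite \<F> \<and> \<F> \<subseteq> bis ` K \<and> K \<subseteq> \<Union>\<F>"
    using K bis_props by (intro compactinD[OF assms]) auto
  then obtain C where "finite C" "C \<subseteq> K" "K \<subseteq> \<Union>(bis ` C)" by (metis finite_subset_image)
  then show thesis using that K by blast
qed

text \<open>A fibre meets each bisection at most once, so sending an arrow to a bisection that
  contains it is injective. The bound on the cardinality does not depend on \<open>x\<close>, which
  is what makes fibrewise estimates uniform.\<close>

lemma fib_bis_card:
  assumes "finite C" "C \<subseteq> arrows" "F \<subseteq> fib G x" "F \<subseteq> \<Union>(bis ` C)"
  shows "finite F" "card F \<le> card C"
proof -
  have "\<forall>p\<in>F. \<exists>c\<in>C. p \<in> bis c" using assms(4) by blast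
  then obtain c where c: "\<And>p. p \<in> F \<Longrightarrow> c p \<in> C \<and> p \<in> bis (c p)" by metis
  have inj: "inj_on c F"
  proof (rule inj_onI)
    fix a b assume ab: "a \<in> F" "b \<in> F" "c a = c b"
    then show "a = b"
      using c[OF ab(1)] c[OF ab(2)] assms(2,3) bis_unique[of "c a" a b] fibD(2) by (metis subsetD)
  qed
  moreover have "c ` F \<subseteq> C" using c by blast
  ultimately show "finite F" "card F \<le> card C"
    using assms(1) inj_on_finite card_inj_on_le by blast+
qed

lemma fib_compact_finite:
  assumes "compactin (gtop G) K"
  shows "finite (fib G x \<inter> K)"
proof -
  obtain C where C: "finite C" "C \<subseteq> arrows" "K \<subseteq> \<Union>(bis ` C)"
    using compact_bis_cover[OF assms] by blast
  show ?thesis by (rule fib_bis_card(1)[OF C(1,2)]) (use C(3) in auto)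
qed

section \<open>Compactly supported functions, bump functions and the module norm\<close>

lemma CcI:
  assumes "\<And>p. p \<notin> K \<Longrightarrow> \<xi> p = 0" "compactin (gtop G) K" "continuous_map (gtop G) euclidean \<xi>"
  shows "\<xi> \<in> Cc G"
proof -
  have "{p \<in> arrows. \<xi> p \<noteq> 0} \<subseteq> K" using assms(1) by blast
  then have "gtop G closure_of {p \<in> arrows. \<xi> p \<noteq> 0} \<subseteq> K"
    using compactin_imp_closedin[OF Hausdorff assms(2)] by (simp add: closure_of_minimal)
  then have "compactin (gtop G) (gtop G closure_of {p \<in> arrows. \<xi> p \<noteq> 0})"
    using closed_compactin[OF assms(2)] by simp
  then show ?thesis
    using assms compactin_subset_topspace[OF assms(2)] by (auto simp: Cc_def)
qed

lemma Cc_support: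
  assumes "\<xi> \<in> Cc G"
  shows "\<exists>K. compactin (gtop G) K \<and> (\<forall>p. p \<notin> K \<longrightarrow> \<xi> p = 0)"
proof (intro exI conjI allI impI)
  let ?K = "gtop G closure_of {p \<in> arrows. \<xi> p \<noteq> 0}"
  show "compactin (gtop G) ?K" using assms by (simp add: Cc_def)
  have "{p \<in> arrows. \<xi> p \<noteq> 0} \<subseteq> ?K" by (intro closure_of_subset) auto
  then show "\<xi> p = 0" if "p \<notin> ?K" for p
    using assms that by (auto simp: Cc_def)
qed

lemma Cc_continuous: "\<xi> \<in> Cc G \<Longrightarrow> continuous_map (gtop G) euclidean \<xi>"
  by (simp add: Cc_def)

lemma Cc_add:
  assumes "\<xi> \<in> Cc G" "\<eta> \<in> Cc G"
  shows "(\<lambda>p. \<xi> p + \<eta> p) \<in> Cc G"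
proof -
  obtain K where K: "compactin (gtop G) K" "\<And>p. p \<notin> K \<Longrightarrow> \<xi> p = 0" using Cc_support[OF assms(1)] by blast
  obtain L where L: "compactin (gtop G) L" "\<And>p. p \<notin> L \<Longrightarrow> \<eta> p = 0" using Cc_support[OF assms(2)] by blast
  show ?thesis
  proof (rule CcI[of "K \<union> L"])
    show "continuous_map (gtop G) euclidean (\<lambda>p. \<xi> p + \<eta> p)"
      using Cc_continuous[OF assms(1)] Cc_continuous[OF assms(2)]
      unfolding continuous_map_euclidean_iff by (auto intro: tendsto_add)
  qed (use K L compactin_Un in auto)
qed

lemma Cc_mult:
  assumes "\<xi> \<in> Cc G" "continuous_map (gtop G) euclidean f"
  shows "(\<lambda>p. f p * \<xi> p) \<in> Cc G"
proof -
  obtain K where K: "compactin (gtop G) K" "\<And>p. p \<notin> K \<Longrightarrow> \<xi> p = 0" using Cc_support[OF assms(1)] by blast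
  show ?thesis
  proof (rule CcI[of K])
    show "continuous_map (gtop G) euclidean (\<lambda>p. f p * \<xi> p)"
      using Cc_continuous[OF assms(1)] assms(2)
      unfolding continuous_map_euclidean_iff by (auto intro: tendsto_mult)
  qed (use K in auto)
qed

lemma Cc_cmult: "\<xi> \<in> Cc G \<Longrightarrow> (\<lambda>p. c * \<xi> p) \<in> Cc G"
  by (intro Cc_mult) auto

lemma Cc_zero: "(\<lambda>p. 0) \<in> Cc G"
  by (rule CcI[of "{}"]) auto

lemma Cc_sum: "finite I \<Longrightarrow> (\<And>i. i \<in> I \<Longrightarrow> \<xi> i \<in> Cc G) \<Longrightarrow> (\<lambda>p. \<Sum>i\<in>I. \<xi> i p) \<in> Cc G"
  by (induction I rule: finite_induct) (auto intro: Cc_zero Cc_add)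

lemma Cc_fib:
  assumes "\<xi> \<in> Cc G"
  shows "finite {p \<in> fib G x. \<xi> p \<noteq> 0}" "square_summable (fib G x) \<xi>"
proof -
  obtain K where K: "compactin (gtop G) K" "\<And>p. p \<notin> K \<Longrightarrow> \<xi> p = 0" using Cc_support[OF assms(1)] by blast
  show "finite {p \<in> fib G x. \<xi> p \<noteq> 0}"
    by (rule finite_subset[OF _ fib_compact_finite[OF K(1), of x]]) (use K(2) in auto)
  then show "square_summable (fib G x) \<xi>"
    by (rule square_summable_finite_support(1)) auto
qed

text \<open>Complete regularity separates the compact set \<open>L\<close> from the closed
  complement of \<open>W \<inter> U\<close>. The open set \<open>W\<close> is there to confine the
  support to the compact set \<open>M\<close>.\<close>

lemma bump_compact:
  assumes L: "compactin (gtop G) L" and U: "openin (gtop G) U" "L \<subseteq> U"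
  obtains z :: "'g \<Rightarrow> real" where "(\<lambda>p. complex_of_real (z p)) \<in> Cc G"
    "\<And>p. 0 \<le> z p" "\<And>p. z p \<le> 1" "\<And>p. p \<in> L \<Longrightarrow> z p = 1" "\<And>p. p \<notin> U \<Longrightarrow> z p = 0"
proof -
  obtain W M where W: "openin (gtop G) W" "compactin (gtop G) M" "closedin (gtop G) M" "L \<subseteq> W" "W \<subseteq> M"
    using locally_compact Hausdorff L locally_compact_space_compact_closed_compact by metis
  let ?S = "arrows - (W \<inter> U)"
  have "closedin (gtop G) ?S" "disjnt L ?S"
    using W U by (auto simp: disjnt_def)
  then obtain f where f: "continuous_map (gtop G) (top_of_set {0..1}) f" "f ` ?S \<subseteq> {0::real}" "f ` L \<subseteq> {1}"
    using Urysohn_completely_regular_compact_closed[OF _ completely_regular L, of 0 1 ?S] by auto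
  define z where "z p = (if p \<in> arrows then f p else 0)" for p
  have "continuous_map (gtop G) euclideanreal f" using f(1) continuous_map_into_fulltopology by blast
  then have c: "continuous_map (gtop G) euclidean z"
    by (rule continuous_map_eq) (simp add: z_def)
  have f01: "0 \<le> f p" "f p \<le> 1" if "p \<in> arrows" for p
    using f(1) that by (auto simp: continuous_map_in_subtopology Pi_iff)
  have z0: "z p = 0" if "p \<notin> W \<inter> U" for p
    using f(2) that by (auto simp: z_def)
  show thesis
  proof (rule that[of z])
    show "(\<lambda>p. complex_of_real (z p)) \<in> Cc G"
    proof (rule CcI[OF _ W(2)])
      show "continuous_map (gtop G) euclidean (\<lambda>p. complex_of_real (z p))"
        using c unfolding continuous_map_euclidean_iff by (auto intro: tendsto_of_real)
    qed (use z0 W in auto)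
    show "z p = 1" if "p \<in> L" for p
      using that f(3) compactin_subset_topspace[OF L] by (auto simp: z_def)
  qed (use f01 z0 in \<open>auto simp: z_def\<close>)
qed

text \<open>The value is one on a whole neighbourhood \<open>V\<close> of \<open>p\<close>; this
  lets a single function represent the point masses at all arrows near \<open>p\<close>.\<close>

lemma bump_point:
  assumes "openin (gtop G) U" "p \<in> U"
  obtains z :: "'g \<Rightarrow> real" and V where "(\<lambda>p. complex_of_real (z p)) \<in> Cc G"
    "\<And>p. 0 \<le> z p" "\<And>p. z p \<le> 1" "\<And>p. p \<notin> U \<Longrightarrow> z p = 0"
    "openin (gtop G) V" "p \<in> V" "V \<subseteq> U" "\<And>p. p \<in> V \<Longrightarrow> z p = 1"
proof -
  have "neighbourhood_base_of (compactin (gtop G)) (gtop G)"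
    using locally_compact Hausdorff locally_compact_space_neighbourhood_base by blast
  then obtain V L where V: "openin (gtop G) V" "compactin (gtop G) L" "p \<in> V" "V \<subseteq> L" "L \<subseteq> U"
    using assms unfolding neighbourhood_base_of by metis
  obtain z :: "'g \<Rightarrow> real" where "(\<lambda>p. complex_of_real (z p)) \<in> Cc G"
    "\<And>p. 0 \<le> z p" "\<And>p. z p \<le> 1" "\<And>p. p \<in> L \<Longrightarrow> z p = 1" "\<And>p. p \<notin> U \<Longrightarrow> z p = 0"
    using bump_compact[OF V(2) assms(1) V(5)] by metis
  then show thesis using that[of z V] V by blast
qed

text \<open>The module norm of \<xi> is at most \<open>e\<close>. Summability is part of the
  condition because \<open>l2_norm\<close> of a function that is not square-summable is 0.\<close>

definition fib_le :: "('g \<Rightarrow> complex) \<Rightarrow> real \<Rightarrow> bool" where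
  "fib_le \<xi> e \<longleftrightarrow> (\<forall>x\<in>units G. square_summable (fib G x) \<xi> \<and> l2_norm (fib G x) \<xi> \<le> e)"

lemma L2_iff: "\<xi> \<in> L2 G \<longleftrightarrow> \<xi> \<in> C0 G \<and> (\<forall>e>0. \<exists>\<eta>\<in>Cc G. fib_le (\<lambda>p. \<xi> p - \<eta> p) e)"
  by (simp add: L2_def fib_le_def chi_in_l2_iff)

lemma fib_le_pointwise: "fib_le \<xi> e \<Longrightarrow> p \<in> arrows \<Longrightarrow> cmod (\<xi> p) \<le> e"
  using cmod_le_l2_norm[of \<xi> "fib G (gsrc G p)" p] src_units[of p] in_fib_src[of p]
  unfolding fib_le_def by force

lemma Cc_subset_C0: "Cc G \<subseteq> C0 G"
proof
  fix \<xi> assume \<xi>: "\<xi> \<in> Cc G"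
  obtain K where K: "compactin (gtop G) K" "\<And>p. p \<notin> K \<Longrightarrow> \<xi> p = 0" using Cc_support[OF \<xi>] by blast
  then have "\<exists>K. compactin (gtop G) K \<and> (\<forall>p\<in>arrows - K. cmod (\<xi> p) < e)" if "e > 0" for e
    using that by (intro exI[of _ K]) auto
  then show "\<xi> \<in> C0 G" using \<xi> by (simp add: C0_def Cc_def)
qed

lemma Cc_subset_L2: "Cc G \<subseteq> L2 G"
proof
  fix \<xi> assume \<xi>: "\<xi> \<in> Cc G"
  have "fib_le (\<lambda>p. \<xi> p - \<xi> p) e" if "e > 0" for e
    using that by (simp add: fib_le_def l2_norm_def)
  then show "\<xi> \<in> L2 G" unfolding L2_iff using \<xi> Cc_subset_C0 by blast
qed

lemma L2_fib: "\<xi> \<in> L2 G \<Longrightarrow> x \<in> units G \<Longrightarrow> square_summable (fib G x) \<xi>"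
proof -
  assume \<xi>: "\<xi> \<in> L2 G" and x: "x \<in> units G"
  obtain \<eta> where \<eta>: "\<eta> \<in> Cc G" "fib_le (\<lambda>p. \<xi> p - \<eta> p) 1"
    using \<xi> zero_less_one unfolding L2_iff by blast
  then have "square_summable (fib G x) (\<lambda>p. (\<xi> p - \<eta> p) + \<eta> p)"
    using x Cc_fib(2)[OF \<eta>(1)] by (intro l2_add(1)) (auto simp: fib_le_def)
  then show ?thesis by simp
qed

lemma L2_chi: "\<xi> \<in> L2 G \<Longrightarrow> x \<in> units G \<Longrightarrow> chi (fib G x) \<xi> \<in> l2 (fib G x)"
  by (simp add: chi_in_l2_iff L2_fib)

lemma L2_outside: "\<xi> \<in> L2 G \<Longrightarrow> p \<notin> arrows \<Longrightarrow> \<xi> p = 0"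
  by (simp add: L2_def C0_def)

lemma L2_continuous: "\<xi> \<in> L2 G \<Longrightarrow> continuous_map (gtop G) euclidean \<xi>"
  by (simp add: L2_def C0_def)

lemma fib_le_diff_trans:
  assumes "fib_le (\<lambda>p. \<xi> p - \<eta> p) a" "fib_le (\<lambda>p. \<eta> p - \<zeta> p) b"
  shows "fib_le (\<lambda>p. \<xi> p - \<zeta> p) (a + b)"
  unfolding fib_le_def
proof
  fix x assume x: "x \<in> units G"
  then have "square_summable (fib G x) (\<lambda>p. (\<xi> p - \<eta> p) + (\<eta> p - \<zeta> p))"
    "l2_norm (fib G x) (\<lambda>p. (\<xi> p - \<eta> p) + (\<eta> p - \<zeta> p)) \<le> a + b"
    using l2_add[of "\<lambda>p. \<xi> p - \<eta> p" "fib G x" "\<lambda>p. \<eta> p - \<zeta> p"] assms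
    unfolding fib_le_def by fastforce+
  then show "square_summable (fib G x) (\<lambda>p. \<xi> p - \<zeta> p) \<and> l2_norm (fib G x) (\<lambda>p. \<xi> p - \<zeta> p) \<le> a + b"
    by simp
qed

text \<open>The norm on the fibre through \<open>p\<close> dominates the value at \<open>p\<close>,
  so approximation in the module norm is uniform. Continuity and vanishing at infinity are therefore
  inherited from the approximants in \<open>Cc G\<close>, and membership in \<open>C0 G\<close>
  comes out as a conclusion.\<close>

lemma L2_closed:
  assumes out: "\<And>p. p \<notin> arrows \<Longrightarrow> \<xi> p = 0"
    and app: "\<And>e. e > 0 \<Longrightarrow> \<exists>\<eta>\<in>L2 G. fib_le (\<lambda>p. \<xi> p - \<eta> p) e"
  shows "\<xi> \<in> L2 G"
  unfolding L2_iff
proof (intro conjI allI impI)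
  show Cc: "\<exists>\<eta>\<in>Cc G. fib_le (\<lambda>p. \<xi> p - \<eta> p) e" if "e > 0" for e
  proof -
    obtain \<eta> where \<eta>: "\<eta> \<in> L2 G" "fib_le (\<lambda>p. \<xi> p - \<eta> p) (e / 2)"
      using app \<open>e > 0\<close> half_gt_zero by blast
    obtain \<zeta> where \<zeta>: "\<zeta> \<in> Cc G" "fib_le (\<lambda>p. \<eta> p - \<zeta> p) (e / 2)"
      using \<eta>(1) \<open>e > 0\<close> half_gt_zero unfolding L2_iff by blast
    show ?thesis using fib_le_diff_trans[OF \<eta>(2) \<zeta>(2)] \<zeta>(1) by auto
  qed
  show "\<xi> \<in> C0 G"
    unfolding C0_def mem_Collect_eq
  proof (intro conjI allI impI out)
    show "continuous_map (gtop G) euclidean \<xi>"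
    proof (rule continuous_map_uniform_approx)
      fix e :: real assume "0 < e"
      from Cc[OF this] obtain \<eta> where \<eta>: "\<eta> \<in> Cc G" "fib_le (\<lambda>p. \<xi> p - \<eta> p) e" by blast
      show "\<exists>g. continuous_map (gtop G) euclidean g \<and> (\<forall>p\<in>arrows. cmod (\<xi> p - g p) \<le> e)"
        using Cc_continuous[OF \<eta>(1)] fib_le_pointwise[OF \<eta>(2)] by blast
    qed
    fix e :: real assume "0 < e"
    then obtain \<eta> where \<eta>: "\<eta> \<in> Cc G" "fib_le (\<lambda>p. \<xi> p - \<eta> p) (e / 2)"
      using Cc half_gt_zero by blast
    obtain K where K: "compactin (gtop G) K" "\<And>p. p \<notin> K \<Longrightarrow> \<eta> p = 0"
      using Cc_support[OF \<eta>(1)] by blast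
    have "cmod (\<xi> p) < e" if "p \<in> arrows - K" for p
      using fib_le_pointwise[OF \<eta>(2), of p] K(2)[of p] that \<open>0 < e\<close> by simp
    then show "\<exists>K. compactin (gtop G) K \<and> (\<forall>p\<in>arrows - K. cmod (\<xi> p) < e)"
      using K(1) by blast
  qed
qed

section \<open>Limits of matrix coefficients\<close>

text \<open>The net conditions behind \<open>E_converges\<close> and \<open>extendable\<close>,
  restated by neighbourhoods. Convergence of base points needs no clause of its own: the base point
  is the source of \<open>g'\<close>, and the source map is continuous.\<close>

definition coeff_limit :: "'g set \<Rightarrow> ('g \<Rightarrow> 'g oper) \<Rightarrow> 'g \<Rightarrow> 'g \<Rightarrow> complex \<Rightarrow> bool" where
  "coeff_limit X T \<gamma>' \<gamma>'' c \<longleftrightarrow> (\<forall>e>0. \<exists>U' U''.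
     openin (gtop G) U' \<and> \<gamma>' \<in> U' \<and> openin (gtop G) U'' \<and> \<gamma>'' \<in> U'' \<and>
     (\<forall>x\<in>X. \<forall>g'\<in>U' \<inter> fib G x. \<forall>g''\<in>U'' \<inter> fib G x. cmod (T x (delta g') g'' - c) < e))"

lemma coeff_limitE:
  assumes "coeff_limit X T \<gamma>' \<gamma>'' c" "0 < e"
  obtains U' U'' where "openin (gtop G) U'" "\<gamma>' \<in> U'" "openin (gtop G) U''" "\<gamma>'' \<in> U''"
    "\<forall>x\<in>X. \<forall>g'\<in>U' \<inter> fib G x. \<forall>g''\<in>U'' \<inter> fib G x.
      cmod (T x (delta g') g'' - c) < e"
  using assms(1)[unfolded coeff_limit_def, rule_format, OF assms(2)]
  by (elim exE conjE) (rule that, assumption+)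

lemma matrix_coeff_eq: "g'' \<in> fib G x \<Longrightarrow> matrix_coeff G (x, S) g'' g' = S (delta g') g''"
  by (simp add: matrix_coeff_def)

lemma coeff_limit_tendsto:
  assumes c: "coeff_limit X T \<gamma>' \<gamma>'' c"
    and l: "limitin (gtop G) g' \<gamma>' F" "limitin (gtop G) g'' \<gamma>'' F"
    and ev: "\<forall>\<^sub>F i in F. x i \<in> X \<and> g' i \<in> fib G (x i) \<and> g'' i \<in> fib G (x i)"
  shows "((\<lambda>i. T (x i) (delta (g' i)) (g'' i)) \<longlongrightarrow> c) F"
    and "((\<lambda>i. matrix_coeff G (x i, T (x i)) (g'' i) (g' i)) \<longlongrightarrow> c) F"
proof -
  show *: "((\<lambda>i. T (x i) (delta (g' i)) (g'' i)) \<longlongrightarrow> c) F"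
  proof (rule tendstoI)
    fix e :: real assume "0 < e"
    obtain U' U'' where U: "openin (gtop G) U'" "\<gamma>' \<in> U'"
      "openin (gtop G) U''" "\<gamma>'' \<in> U''"
      "\<forall>x\<in>X. \<forall>g'\<in>U' \<inter> fib G x. \<forall>g''\<in>U'' \<inter> fib G x.
        cmod (T x (delta g') g'' - c) < e"
      by (rule coeff_limitE[OF c \<open>0 < e\<close>]) (rule that)
    have "\<forall>\<^sub>F i in F. g' i \<in> U'" "\<forall>\<^sub>F i in F. g'' i \<in> U''"
      using l U by (simp_all add: limitin_def)
    then show "\<forall>\<^sub>F i in F. dist (T (x i) (delta (g' i)) (g'' i)) c < e"
      using ev
    proof eventually_elim
      case (elim i)
      then show ?case
        unfolding dist_norm by (intro U(5)[rule_format, of "x i"]) auto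
    qed
  qed
  have "\<forall>\<^sub>F i in F. T (x i) (delta (g' i)) (g'' i) = matrix_coeff G (x i, T (x i)) (g'' i) (g' i)"
    using ev by eventually_elim (simp add: matrix_coeff_eq)
  then show "((\<lambda>i. matrix_coeff G (x i, T (x i)) (g'' i) (g' i)) \<longlongrightarrow> c) F"
    using * by (simp add: filterlim_cong)
qed

text \<open>The universal test net: all pairs of arrows in a common fibre over \<open>X\<close>,
  filtered by closeness to the two given arrows. Convergence along this one filter already gives
  \<open>coeff_limit\<close>, and its index type is the one over which \<open>extendable\<close>
  quantifies.\<close>

definition pair_filter :: "'g set \<Rightarrow> 'g \<Rightarrow> 'g \<Rightarrow> ('g \<times> 'g) filter" where
  "pair_filter X \<gamma>' \<gamma>'' = inf (nhdsin (gtop G) \<gamma>' \<times>\<^sub>F nhdsin (gtop G) \<gamma>'')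
     (principal {(g', g''). \<exists>x\<in>X. g' \<in> fib G x \<and> g'' \<in> fib G x})"

lemma pair_filter_props:
  assumes "\<gamma>' \<in> fib G w" "\<gamma>'' \<in> fib G w"
  shows "limitin (gtop G) fst \<gamma>' (pair_filter X \<gamma>' \<gamma>'')"
    and "limitin (gtop G) snd \<gamma>'' (pair_filter X \<gamma>' \<gamma>'')"
    and "limitin (gtop G) (gsrc G \<circ> fst) w (pair_filter X \<gamma>' \<gamma>'')"
    and "\<forall>\<^sub>F p in pair_filter X \<gamma>' \<gamma>''. (gsrc G \<circ> fst) p \<in> X \<and>
      fst p \<in> fib G ((gsrc G \<circ> fst) p) \<and> snd p \<in> fib G ((gsrc G \<circ> fst) p)"
proof -
  have t: "\<gamma>' \<in> arrows" "\<gamma>'' \<in> arrows" "gsrc G \<gamma>' = w"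
    using assms fibD by auto
  have n: "eventually (\<lambda>g. g \<in> U) (nhdsin (gtop G) \<gamma>)" if "openin (gtop G) U" "\<gamma> \<in> U" for U \<gamma>
    using that unfolding eventually_nhdsin by blast
  have lf: "\<forall>\<^sub>F p in pair_filter X \<gamma>' \<gamma>''. fst p \<in> U" if "openin (gtop G) U" "\<gamma>' \<in> U" for U
  proof -
    have "\<forall>\<^sub>F p in nhdsin (gtop G) \<gamma>' \<times>\<^sub>F nhdsin (gtop G) \<gamma>''. fst p \<in> U"
      unfolding eventually_prod_filter
      by (rule exI[of _ "\<lambda>g. g \<in> U"], rule exI[of _ "\<lambda>_. True"]) (use n[OF that] in simp)
    then show ?thesis unfolding pair_filter_def by (rule filter_leD[OF inf_le1])
  qed
  have ls: "\<forall>\<^sub>F p in pair_filter X \<gamma>' \<gamma>''. snd p \<in> U" if "openin (gtop G) U" "\<gamma>'' \<in> U" for U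
  proof -
    have "\<forall>\<^sub>F p in nhdsin (gtop G) \<gamma>' \<times>\<^sub>F nhdsin (gtop G) \<gamma>''. snd p \<in> U"
      unfolding eventually_prod_filter
      by (rule exI[of _ "\<lambda>_. True"], rule exI[of _ "\<lambda>g. g \<in> U"]) (use n[OF that] in simp)
    then show ?thesis unfolding pair_filter_def by (rule filter_leD[OF inf_le1])
  qed
  show l: "limitin (gtop G) fst \<gamma>' (pair_filter X \<gamma>' \<gamma>'')"
    "limitin (gtop G) snd \<gamma>'' (pair_filter X \<gamma>' \<gamma>'')"
    using lf ls t by (auto simp: limitin_def)
  show "limitin (gtop G) (gsrc G \<circ> fst) w (pair_filter X \<gamma>' \<gamma>'')"
    using continuous_map_limit[OF src_continuous l(1)] t by simp
  show "\<forall>\<^sub>F p in pair_filter X \<gamma>' \<gamma>''. (gsrc G \<circ> fst) p \<in> X \<and>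
      fst p \<in> fib G ((gsrc G \<circ> fst) p) \<and> snd p \<in> fib G ((gsrc G \<circ> fst) p)"
    unfolding pair_filter_def by (auto simp: eventually_inf_principal fib_def intro!: always_eventually)
qed

lemma coeff_limitI:
  assumes f: "\<gamma>' \<in> fib G w" "\<gamma>'' \<in> fib G w"
    and lim: "((\<lambda>p. matrix_coeff G (gsrc G (fst p), T (gsrc G (fst p))) (snd p) (fst p)) \<longlongrightarrow> c)
      (pair_filter X \<gamma>' \<gamma>'')"
  shows "coeff_limit X T \<gamma>' \<gamma>'' c"
  unfolding coeff_limit_def
proof (intro allI impI)
  fix e :: real assume "0 < e"
  have t: "\<gamma>' \<in> arrows" "\<gamma>'' \<in> arrows"
    using f fibD by auto
  from lim \<open>0 < e\<close> have "\<forall>\<^sub>F p in pair_filter X \<gamma>' \<gamma>''.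
      dist (matrix_coeff G (gsrc G (fst p), T (gsrc G (fst p))) (snd p) (fst p)) c < e"
    by (rule tendstoD)
  then obtain P Q where PQ: "eventually P (nhdsin (gtop G) \<gamma>')" "eventually Q (nhdsin (gtop G) \<gamma>'')"
    and "\<forall>a. P a \<longrightarrow> (\<forall>b. Q b \<longrightarrow> (\<exists>x\<in>X. a \<in> fib G x \<and> b \<in> fib G x) \<longrightarrow>
      cmod (matrix_coeff G (gsrc G a, T (gsrc G a)) b a - c) < e)"
    unfolding pair_filter_def eventually_inf_principal eventually_prod_filter dist_norm by auto
  then have PQ3: "cmod (matrix_coeff G (gsrc G a, T (gsrc G a)) b a - c) < e"
    if "P a" "Q b" "x \<in> X" "a \<in> fib G x" "b \<in> fib G x" for a b x
    using that by blast
  obtain U' where U': "openin (gtop G) U'" "\<gamma>' \<in> U'" "\<And>a. a \<in> U' \<Longrightarrow> P a"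
    using PQ(1) t unfolding eventually_nhdsin by blast
  obtain U'' where U'': "openin (gtop G) U''" "\<gamma>'' \<in> U''" "\<And>a. a \<in> U'' \<Longrightarrow> Q a"
    using PQ(2) t unfolding eventually_nhdsin by blast
  have "cmod (T x (delta g') g'' - c) < e" if "x \<in> X" "g' \<in> U' \<inter> fib G x" "g'' \<in> U'' \<inter> fib G x" for x g' g''
    using PQ3[of g' g'' x] U'(3) U''(3) that fibD(2)[of g' x] by (simp add: matrix_coeff_eq)
  then show "\<exists>U' U''. openin (gtop G) U' \<and> \<gamma>' \<in> U' \<and> openin (gtop G) U'' \<and> \<gamma>'' \<in> U'' \<and>
     (\<forall>x\<in>X. \<forall>g'\<in>U' \<inter> fib G x. \<forall>g''\<in>U'' \<inter> fib G x. cmod (T x (delta g') g'' - c) < e)"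
    using U' U'' by blast
qed

lemma extendable_iff:
  "extendable G X T \<longleftrightarrow>
     (\<forall>w\<in>units G - X. \<forall>\<gamma>'\<in>fib G w. \<forall>\<gamma>''\<in>fib G w. \<exists>c. coeff_limit X T \<gamma>' \<gamma>'' c)"
proof
  assume e: "extendable G X T"
  show "\<forall>w\<in>units G - X. \<forall>\<gamma>'\<in>fib G w. \<forall>\<gamma>''\<in>fib G w. \<exists>c. coeff_limit X T \<gamma>' \<gamma>'' c"
  proof (intro ballI)
    fix w \<gamma>' \<gamma>'' assume w: "w \<in> units G - X" and f: "\<gamma>' \<in> fib G w" "\<gamma>'' \<in> fib G w"
    obtain c where c: "\<forall>(F :: ('g \<times> 'g) filter) x g' g''.
          (\<forall>\<^sub>F i in F. x i \<in> X \<and> g' i \<in> fib G (x i) \<and> g'' i \<in> fib G (x i)) \<and>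
          limitin (gtop G) x w F \<and> limitin (gtop G) g' \<gamma>' F \<and> limitin (gtop G) g'' \<gamma>'' F \<longrightarrow>
          ((\<lambda>i. matrix_coeff G (x i, T (x i)) (g'' i) (g' i)) \<longlongrightarrow> c) F"
      using e[unfolded extendable_def, THEN bspec, OF w, THEN bspec, OF f(1), THEN bspec, OF f(2)]
      by (elim exE) (rule that)
    note p = pair_filter_props[OF f, of X]
    have "((\<lambda>p. matrix_coeff G ((gsrc G \<circ> fst) p, T ((gsrc G \<circ> fst) p)) (snd p) (fst p)) \<longlongrightarrow> c)
        (pair_filter X \<gamma>' \<gamma>'')"
      by (rule c[rule_format]) (intro conjI p)
    then have "coeff_limit X T \<gamma>' \<gamma>'' c" by (intro coeff_limitI[OF f]) simp
    then show "\<exists>c. coeff_limit X T \<gamma>' \<gamma>'' c" ..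
  qed
next
  assume c: "\<forall>w\<in>units G - X. \<forall>\<gamma>'\<in>fib G w. \<forall>\<gamma>''\<in>fib G w. \<exists>c. coeff_limit X T \<gamma>' \<gamma>'' c"
  show "extendable G X T"
    unfolding extendable_def
  proof (intro ballI)
    fix w \<gamma>' \<gamma>'' assume w: "w \<in> units G - X" and f: "\<gamma>' \<in> fib G w" "\<gamma>'' \<in> fib G w"
    from c[THEN bspec, OF w, THEN bspec, OF f(1), THEN bspec, OF f(2)]
    obtain c where "coeff_limit X T \<gamma>' \<gamma>'' c" ..
    then show "\<exists>c. \<forall>(F :: ('g \<times> 'g) filter) x g' g''.
          (\<forall>\<^sub>F i in F. x i \<in> X \<and> g' i \<in> fib G (x i) \<and> g'' i \<in> fib G (x i)) \<and>
          limitin (gtop G) x w F \<and> limitin (gtop G) g' \<gamma>' F \<and> limitin (gtop G) g'' \<gamma>'' F \<longrightarrow>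
          ((\<lambda>i. matrix_coeff G (x i, T (x i)) (g'' i) (g' i)) \<longlongrightarrow> c) F"
      by (intro exI[of _ c] allI impI coeff_limit_tendsto(2)) auto
  qed
qed

text \<open>From left to right, the section is composed with the source of the pairs in
  \<open>pair_filter\<close>, which converges to \<open>w\<close> inside \<open>X\<close>. From
  right to left, continuity is convergence along the punctured filter at \<open>w\<close>, where
  \<open>coeff_limit\<close> can be applied once the limit arrows are known to lie over
  \<open>w\<close>.\<close>

lemma continuous_section_iff:
  assumes X: "X \<subseteq> units G" and T: "\<And>x. x \<in> X \<Longrightarrow> T x \<in> bounded_ops (fib G x)"
  shows "continuous_section G X T \<longleftrightarrow>
     (\<forall>w\<in>X. \<forall>\<gamma>'\<in>fib G w. \<forall>\<gamma>''\<in>fib G w. coeff_limit X T \<gamma>' \<gamma>'' (T w (delta \<gamma>') \<gamma>''))"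
proof
  assume c: "continuous_section G X T"
  show "\<forall>w\<in>X. \<forall>\<gamma>'\<in>fib G w. \<forall>\<gamma>''\<in>fib G w. coeff_limit X T \<gamma>' \<gamma>'' (T w (delta \<gamma>') \<gamma>'')"
  proof (intro ballI)
    fix w \<gamma>' \<gamma>'' assume w: "w \<in> X" and f: "\<gamma>' \<in> fib G w" "\<gamma>'' \<in> fib G w"
    let ?F = "pair_filter X \<gamma>' \<gamma>''" and ?x = "gsrc G \<circ> fst"
    note p = pair_filter_props[OF f, of X]
    have "\<forall>\<^sub>F p in ?F. ?x p \<in> X" using p(4) by eventually_elim blast
    then have "limitin (subtopology (gtop G) X) ?x w ?F"
      using p(3) w by (simp add: limitin_subtopology)
    from continuous_map_limit[OF c[unfolded continuous_section_def] this]
    have "E_converges G X (\<lambda>p. (?x p, T (?x p))) (w, T w) ?F"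
      unfolding limitin_E_topology[OF etale X] by (simp add: o_def)
    moreover have "\<forall>\<^sub>F p in ?F. fst p \<in> fib G (?x p) \<and> snd p \<in> fib G (?x p)"
      using p(4) by eventually_elim blast
    ultimately have "((\<lambda>p. matrix_coeff G (?x p, T (?x p)) (snd p) (fst p)) \<longlongrightarrow>
        matrix_coeff G (w, T w) \<gamma>'' \<gamma>') ?F"
      using p(1,2) by (simp add: E_converges_def)
    then show "coeff_limit X T \<gamma>' \<gamma>'' (T w (delta \<gamma>') \<gamma>'')"
      unfolding matrix_coeff_eq[OF f(2)] by (intro coeff_limitI[OF f]) simp
  qed
next
  assume c: "\<forall>w\<in>X. \<forall>\<gamma>'\<in>fib G w. \<forall>\<gamma>''\<in>fib G w. coeff_limit X T \<gamma>' \<gamma>'' (T w (delta \<gamma>') \<gamma>'')"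
  show "continuous_section G X T"
    unfolding continuous_section_def continuous_map_atin limitin_E_topology[OF etale X]
  proof
    fix w assume "w \<in> topspace (subtopology (gtop G) X)"
    then have w: "w \<in> X" "w \<in> arrows" by auto
    let ?F = "atin (subtopology (gtop G) X) w"
    have evX: "\<forall>\<^sub>F x in ?F. x \<in> X"
      unfolding eventually_atin using w by (auto intro!: exI[of _ "topspace (subtopology (gtop G) X)"])
    have lx: "limitin (gtop G) (\<lambda>x. x) w ?F"
    proof -
      have "continuous_map (subtopology (gtop G) X) (gtop G) (\<lambda>x. x)"
        by (rule continuous_map_from_subtopology) simp
      then show ?thesis unfolding continuous_map_atin using w by simp
    qed
    show "E_converges G X (\<lambda>x. (x, T x)) (w, T w) ?F"
      unfolding E_converges_def fst_conv
    proof (intro conjI allI impI lx)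
      show "(w, T w) \<in> E_bundle G X" using w T by (simp add: E_bundle_def)
      show "\<forall>\<^sub>F x in ?F. (x, T x) \<in> E_bundle G X"
        using evX by eventually_elim (simp add: E_bundle_def T)
      fix g' g'' \<gamma>' \<gamma>''
      assume "limitin (gtop G) g' \<gamma>' ?F \<and> limitin (gtop G) g'' \<gamma>'' ?F \<and>
        (\<forall>\<^sub>F x in ?F. g' x \<in> fib G x \<and> g'' x \<in> fib G x)"
      then have l: "limitin (gtop G) g' \<gamma>' ?F" "limitin (gtop G) g'' \<gamma>'' ?F"
        and fb: "\<forall>\<^sub>F x in ?F. g' x \<in> fib G x \<and> g'' x \<in> fib G x" by auto
      show "((\<lambda>x. matrix_coeff G (x, T x) (g'' x) (g' x)) \<longlongrightarrow> matrix_coeff G (w, T w) \<gamma>'' \<gamma>') ?F"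
      proof (cases "?F = bot")
        case False
        \<comment> \<open>Uniqueness of limits in a Hausdorff space forces the limit arrow to lie
          over \<open>w\<close>. This takes a nontrivial filter; at an isolated point of
          \<open>X\<close> the punctured filter is trivial and every limit statement holds.\<close>
        have src: "\<gamma> \<in> fib G w" if "limitin (gtop G) g \<gamma> ?F" "\<forall>\<^sub>F x in ?F. g x \<in> fib G x" for g \<gamma>
        proof -
          have "limitin (gtop G) (gsrc G \<circ> g) (gsrc G \<gamma>) ?F"
            using src_continuous that(1) by (rule continuous_map_limit)
          moreover have "\<forall>\<^sub>F x in ?F. (gsrc G \<circ> g) x = x"
            using that(2) by eventually_elim (simp add: fib_def)
          ultimately have "limitin (gtop G) (\<lambda>x. x) (gsrc G \<gamma>) ?F"
            by (rule limitin_transform_eventually[rotated])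
          then have "gsrc G \<gamma> = w"
            using lx Hausdorff False limitin_Hausdorff_unique by metis
          then show ?thesis using limitin_topspace[OF that(1)] by (simp add: fib_def)
        qed
        have f: "\<gamma>' \<in> fib G w" "\<gamma>'' \<in> fib G w"
          by (rule src[OF l(1)], use fb in eventually_elim, blast)
            (rule src[OF l(2)], use fb in eventually_elim, blast)
        have "\<forall>\<^sub>F x in ?F. x \<in> X \<and> g' x \<in> fib G x \<and> g'' x \<in> fib G x"
          using evX fb by eventually_elim auto
        from coeff_limit_tendsto(2)[OF c[rule_format, OF w(1) f] l this] show ?thesis
          by (simp add: matrix_coeff_eq[OF f(2)])
      qed simp
    qed
  qed
qed

section \<open>Lifts from a fibre\<close>

text \<open>The bump lives in a bisection, which contains no arrow of the fibre of \<open>g\<close>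
  other than \<open>g\<close>, and it equals one on \<open>V\<close>.\<close>

lemma peak:
  assumes "\<gamma> \<in> arrows"
  obtains \<zeta> V where "\<zeta> \<in> Cc G" "openin (gtop G) V" "\<gamma> \<in> V"
    "\<And>g x. g \<in> V \<Longrightarrow> g \<in> fib G x \<Longrightarrow> chi (fib G x) \<zeta> = delta g"
proof -
  note b = bis_props[OF assms]
  obtain z :: "'g \<Rightarrow> real" and V where z: "(\<lambda>\<gamma>. complex_of_real (z \<gamma>)) \<in> Cc G"
    "\<And>g. g \<notin> bis \<gamma> \<Longrightarrow> z g = 0"
    "openin (gtop G) V" "\<gamma> \<in> V" "V \<subseteq> bis \<gamma>" "\<And>g. g \<in> V \<Longrightarrow> z g = 1"
    using bump_point[OF b(1,2)] by metis
  show thesis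
  proof (rule that[OF z(1,3,4)])
    fix g x assume g: "g \<in> V" "g \<in> fib G x"
    show "chi (fib G x) (\<lambda>\<gamma>. complex_of_real (z \<gamma>)) = delta g"
    proof
      fix a
      have "a = g" if "a \<in> fib G x" "a \<in> bis \<gamma>"
        using bis_unique[OF assms that(2), of g] g z(5) that(1) fibD(2) by auto
      then show "chi (fib G x) (\<lambda>\<gamma>. complex_of_real (z \<gamma>)) a = delta g a"
        using z(2)[of a] z(6)[OF g(1)] g(2) by (cases "a \<in> bis \<gamma>") (auto simp: chi_apply delta_def indicator_def)
    qed
  qed
qed

lemma inner_peak:
  assumes "chi (fib G x) \<zeta> = delta a" "a \<in> fib G x"
  shows "l2_inner (fib G x) \<zeta> h = h a"
proof -
  have "l2_inner (fib G x) \<zeta> h = l2_inner (fib G x) (chi (fib G x) \<zeta>) h"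
    by (rule l2_inner_cong) (simp_all add: chi_apply)
  then show ?thesis using assms by simp
qed

lemma disjoint_neighbourhoods:
  assumes F: "finite F" "F \<subseteq> arrows"
  obtains U where "\<And>a. a \<in> F \<Longrightarrow> openin (gtop G) (U a) \<and> a \<in> U a \<and> U a \<subseteq> bis a"
    "\<And>a b. a \<in> F \<Longrightarrow> b \<in> F \<Longrightarrow> a \<noteq> b \<Longrightarrow> U a \<inter> U b = {}"
proof -
  have "\<forall>a b. \<exists>P Q. a \<in> F \<and> b \<in> F \<and> a \<noteq> b \<longrightarrow> openin (gtop G) P \<and> openin (gtop G) Q \<and>
      a \<in> P \<and> b \<in> Q \<and> P \<inter> Q = {}"
    using Hausdorff F(2) unfolding Hausdorff_space_def disjnt_def by (meson subsetD)
  then obtain P Q where PQ: "\<And>a b. a \<in> F \<Longrightarrow> b \<in> F \<Longrightarrow> a \<noteq> b \<Longrightarrow>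
      openin (gtop G) (P a b) \<and> openin (gtop G) (Q a b) \<and> a \<in> P a b \<and> b \<in> Q a b \<and> P a b \<inter> Q a b = {}"
    by metis
  \<comment> \<open>Each pair is separated once in each order. Taking both \<open>P a b\<close> and
    \<open>Q b a\<close> for every \<open>b\<close> puts \<open>U a\<close> inside
    \<open>P a b\<close> and \<open>U b\<close> inside \<open>Q a b\<close>, which are
    disjoint.\<close>
  define U where "U a = \<Inter>(insert (bis a) ((\<lambda>b. P a b \<inter> Q b a) ` (F - {a})))" for a
  have "openin (gtop G) (U a) \<and> a \<in> U a \<and> U a \<subseteq> bis a" if a: "a \<in> F" for a
  proof -
    have "a \<in> arrows" using F a by blast
    note b = bis_props[OF this]
    have "openin (gtop G) (U a)"
      unfolding U_def using F(1) PQ a b(1) by (intro openin_Inter) auto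
    then show ?thesis using b(2) PQ a by (auto simp: U_def)
  qed
  moreover have "U a \<inter> U b = {}" if "a \<in> F" "b \<in> F" "a \<noteq> b" for a b
  proof -
    have "U a \<subseteq> P a b" "U b \<subseteq> Q a b" using that by (auto simp: U_def)
    then show ?thesis using PQ[OF that] by blast
  qed
  ultimately show thesis by (rule that)
qed

text \<open>The lift is a sum of bumps in disjoint bisections, one around each arrow of
  \<open>F\<close>. Any fibre meets each bisection at most once, and the bumps are at most one, so
  the values on any other fibre inject into those on \<open>F\<close> and shrink: the norm on the
  fibre of \<open>x\<close> bounds the module norm. Operator bounds on one fibre can thus be tested
  by global elements.\<close>

lemma finite_lift:
  assumes F: "finite F" "F \<subseteq> fib G x"
  obtains \<xi> where "\<xi> \<in> Cc G" "\<And>a. a \<in> F \<Longrightarrow> \<xi> a = f a" "\<And>a. a \<in> fib G x - F \<Longrightarrow> \<xi> a = 0"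
    "fib_le \<xi> (L2_set (\<lambda>a. cmod (f a)) F)"
proof -
  have Ft: "F \<subseteq> arrows" using F fibD(1) by blast
  obtain U where U: "\<And>a. a \<in> F \<Longrightarrow> openin (gtop G) (U a) \<and> a \<in> U a \<and> U a \<subseteq> bis a"
    "\<And>a b. a \<in> F \<Longrightarrow> b \<in> F \<Longrightarrow> a \<noteq> b \<Longrightarrow> U a \<inter> U b = {}"
    using disjoint_neighbourhoods[OF F(1) Ft] by metis
  have "\<exists>z :: 'g \<Rightarrow> real. (\<lambda>\<gamma>. complex_of_real (z \<gamma>)) \<in> Cc G \<and> (\<forall>g. 0 \<le> z g) \<and> (\<forall>g. z g \<le> 1) \<and>
      (\<forall>g. g \<notin> U a \<longrightarrow> z g = 0) \<and> z a = 1" if a: "a \<in> F" for a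
  proof -
    obtain z :: "'g \<Rightarrow> real" and V where "(\<lambda>\<gamma>. complex_of_real (z \<gamma>)) \<in> Cc G"
      "\<And>\<gamma>. 0 \<le> z \<gamma>" "\<And>\<gamma>. z \<gamma> \<le> 1" "\<And>\<gamma>. \<gamma> \<notin> U a \<Longrightarrow> z \<gamma> = 0"
      "openin (gtop G) V" "a \<in> V" "V \<subseteq> U a" "\<And>\<gamma>. \<gamma> \<in> V \<Longrightarrow> z \<gamma> = 1"
      using bump_point[of "U a" a] U(1)[OF a] by metis
    then show ?thesis by blast
  qed
  then obtain z :: "'g \<Rightarrow> 'g \<Rightarrow> real" where z:
    "\<And>a. a \<in> F \<Longrightarrow> (\<lambda>\<gamma>. complex_of_real (z a \<gamma>)) \<in> Cc G \<and> (\<forall>g. 0 \<le> z a g) \<and> (\<forall>g. z a g \<le> 1) \<and>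
      (\<forall>g. g \<notin> U a \<longrightarrow> z a g = 0) \<and> z a a = 1" by metis
  define \<xi> where "\<xi> g = (\<Sum>a\<in>F. f a * complex_of_real (z a g))" for g
  have at: "\<xi> g = f a * complex_of_real (z a g)" if "a \<in> F" "g \<in> U a" for a g
  proof -
    have "f b * complex_of_real (z b g) = 0" if "b \<in> F - {a}" for b
      using U(2)[of a b] z[of b] that \<open>a \<in> F\<close> \<open>g \<in> U a\<close> by auto
    then have "(\<Sum>b\<in>F - {a}. f b * complex_of_real (z b g)) = 0" by (intro sum.neutral) blast
    then show ?thesis unfolding \<xi>_def using F(1) \<open>a \<in> F\<close> by (simp add: sum.remove)
  qed
  have off: "\<xi> g = 0" if "g \<notin> \<Union>(U ` F)" for g
    unfolding \<xi>_def using z that by (intro sum.neutral) auto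
  have Uuniq: "g = h" if "a \<in> F" "g \<in> U a" "h \<in> U a" "g \<in> fib G y" "h \<in> fib G y" for a g h y
    using bis_unique[of a g h] U(1)[OF that(1)] that Ft fibD(2)[of g y] fibD(2)[of h y] by auto
  show thesis
  proof (rule that[of \<xi>])
    show "\<xi> \<in> Cc G" unfolding \<xi>_def using F(1) z by (intro Cc_sum Cc_cmult) auto
    show "\<xi> a = f a" if "a \<in> F" for a
      using at[OF that] U(1)[OF that] z[OF that] by simp
    show "\<xi> g = 0" if g: "g \<in> fib G x - F" for g
    proof (rule off)
      show "g \<notin> \<Union>(U ` F)"
      proof
        assume "g \<in> \<Union>(U ` F)"
        then obtain a where a: "a \<in> F" "g \<in> U a" by blast
        then have "g = a" using Uuniq[OF a, of a x] U(1)[OF a(1)] g F(2) by blast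
        then show False using a g by blast
      qed
    qed
    show "fib_le \<xi> (L2_set (\<lambda>a. cmod (f a)) F)"
      unfolding fib_le_def
    proof
      fix y assume "y \<in> units G"
      have "L2_set (\<lambda>g. cmod (\<xi> g)) E \<le> L2_set (\<lambda>a. cmod (f a)) F" if E: "finite E" "E \<subseteq> fib G y" for E
      proof -
        let ?H = "{g \<in> E. g \<in> \<Union>(U ` F)}"
        have "\<forall>g\<in>?H. \<exists>a\<in>F. g \<in> U a" by blast
        then obtain k where k: "\<And>g. g \<in> ?H \<Longrightarrow> k g \<in> F \<and> g \<in> U (k g)" by metis
        have inj: "inj_on k ?H"
        proof (rule inj_onI)
          fix g h assume gh: "g \<in> ?H" "h \<in> ?H" "k g = k h"
          have "h \<in> U (k g)" using k[OF gh(2)] gh(3) by simp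
          then show "g = h" using Uuniq[of "k g" g h y] k[OF gh(1)] gh(1,2) E(2) by blast
        qed
        have "(\<Sum>g\<in>E. (cmod (\<xi> g))\<^sup>2) = (\<Sum>g\<in>?H. (cmod (\<xi> g))\<^sup>2)"
          using off E(1) by (intro sum.mono_neutral_right) auto
        also have "\<dots> \<le> (\<Sum>g\<in>?H. (cmod (f (k g)))\<^sup>2)"
        proof (rule sum_mono)
          fix g assume g: "g \<in> ?H"
          have "cmod (\<xi> g) = cmod (f (k g)) * z (k g) g"
            using at[of "k g" g] k[OF g] z[of "k g"] by (simp add: norm_mult)
          also have "\<dots> \<le> cmod (f (k g)) * 1"
            using k[OF g] z[of "k g"] by (intro mult_left_mono) auto
          finally show "(cmod (\<xi> g))\<^sup>2 \<le> (cmod (f (k g)))\<^sup>2" by (simp add: power_mono)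
        qed
        also have "\<dots> = (\<Sum>a\<in>k ` ?H. (cmod (f a))\<^sup>2)"
          by (simp only: sum.reindex[OF inj] o_def)
        also have "\<dots> \<le> (\<Sum>a\<in>F. (cmod (f a))\<^sup>2)"
          using F(1) k by (intro sum_mono2) auto
        finally show ?thesis by (simp add: L2_set_def)
      qed
      from l2_bound[OF this]
      show "square_summable (fib G y) \<xi> \<and> l2_norm (fib G y) \<xi> \<le> L2_set (\<lambda>a. cmod (f a)) F" by blast
    qed
  qed
qed

text \<open>Pointwise limits exist because the module norm dominates values, and the bounds pass to
  the limit over finite sets. The explicit rate \<open>e n\<close> is kept since the uniform
  boundedness argument depends on it.\<close>

lemma L2_complete:
  assumes \<eta>: "\<And>n. \<eta> n \<in> L2 G" and le: "\<And>m n. n \<le> m \<Longrightarrow> fib_le (\<lambda>\<gamma>. \<eta> m \<gamma> - \<eta> n \<gamma>) (e n)"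
    and e: "e \<longlonglongrightarrow> 0"
  shows "\<exists>\<xi>\<in>L2 G. \<forall>n. fib_le (\<lambda>\<gamma>. \<xi> \<gamma> - \<eta> n \<gamma>) (e n)"
proof -
  have conv: "convergent (\<lambda>n. \<eta> n \<gamma>)" for \<gamma>
  proof (cases "\<gamma> \<in> arrows")
    case True
    have "Cauchy (\<lambda>n. \<eta> n \<gamma>)"
    proof (rule CauchyI')
      fix d :: real assume "0 < d"
      then obtain N where N: "\<And>n. n \<ge> N \<Longrightarrow> norm (e n - 0) < d"
        using LIMSEQ_D[OF e] by blast
      have "dist (\<eta> m \<gamma>) (\<eta> n \<gamma>) < d" if "N \<le> m" "m < n" for m n
        using fib_le_pointwise[OF le[of m n] True] N[of m] that
        by (simp add: dist_norm norm_minus_commute)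
      then show "\<exists>M. \<forall>m\<ge>M. \<forall>n>m. dist (\<eta> m \<gamma>) (\<eta> n \<gamma>) < d" by blast
    qed
    then show ?thesis by (simp add: Cauchy_convergent_iff)
  next
    case False
    then show ?thesis using L2_outside[OF \<eta>] by (simp add: convergent_const)
  qed
  define \<xi> where "\<xi> \<gamma> = lim (\<lambda>n. \<eta> n \<gamma>)" for \<gamma>
  have lim: "(\<lambda>n. \<eta> n \<gamma>) \<longlonglongrightarrow> \<xi> \<gamma>" for \<gamma>
    using conv unfolding \<xi>_def convergent_LIMSEQ_iff .
  have fl: "fib_le (\<lambda>\<gamma>. \<xi> \<gamma> - \<eta> n \<gamma>) (e n)" for n
    unfolding fib_le_def
  proof
    fix x assume x: "x \<in> units G"
    have "L2_set (\<lambda>\<gamma>. cmod (\<xi> \<gamma> - \<eta> n \<gamma>)) E \<le> e n" if E: "finite E" "E \<subseteq> fib G x" for E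
    proof (rule tendsto_upperbound)
      show "(\<lambda>m. L2_set (\<lambda>\<gamma>. cmod (\<eta> m \<gamma> - \<eta> n \<gamma>)) E) \<longlonglongrightarrow> L2_set (\<lambda>\<gamma>. cmod (\<xi> \<gamma> - \<eta> n \<gamma>)) E"
        unfolding L2_set_def by (intro tendsto_intros lim)
      show "\<forall>\<^sub>F m in sequentially. L2_set (\<lambda>\<gamma>. cmod (\<eta> m \<gamma> - \<eta> n \<gamma>)) E \<le> e n"
      proof (rule eventually_sequentiallyI)
        fix m assume "n \<le> m"
        from le[OF this] x have "square_summable (fib G x) (\<lambda>\<gamma>. \<eta> m \<gamma> - \<eta> n \<gamma>)"
          "l2_norm (fib G x) (\<lambda>\<gamma>. \<eta> m \<gamma> - \<eta> n \<gamma>) \<le> e n" unfolding fib_le_def by auto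
        then show "L2_set (\<lambda>\<gamma>. cmod (\<eta> m \<gamma> - \<eta> n \<gamma>)) E \<le> e n"
          using L2_set_le_l2_norm[OF _ E] by fastforce
      qed
    qed simp
    from l2_bound[OF this]
    show "square_summable (fib G x) (\<lambda>\<gamma>. \<xi> \<gamma> - \<eta> n \<gamma>) \<and> l2_norm (fib G x) (\<lambda>\<gamma>. \<xi> \<gamma> - \<eta> n \<gamma>) \<le> e n"
      by blast
  qed
  moreover have "\<xi> \<in> L2 G"
  proof (rule L2_closed)
    show "\<xi> \<gamma> = 0" if "\<gamma> \<notin> arrows" for \<gamma>
      using lim[of \<gamma>] L2_outside[OF \<eta> that] by (simp add: LIMSEQ_const_iff)
    fix d :: real assume "0 < d"
    then obtain N where N: "norm (e N - 0) < d" using LIMSEQ_D[OF e] by blast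
    then have "fib_le (\<lambda>\<gamma>. \<xi> \<gamma> - \<eta> N \<gamma>) d"
      using fl[of N] unfolding fib_le_def real_norm_def by force
    then show "\<exists>\<eta>\<in>L2 G. fib_le (\<lambda>\<gamma>. \<xi> \<gamma> - \<eta> \<gamma>) d" using \<eta> by blast
  qed
  ultimately show ?thesis by (intro bexI[of _ \<xi>]) auto
qed

section \<open>Slices of adjointable operators\<close>

text \<open>A symmetric form of adjointability that leaves out extensionality, so that each result
  on \<open>T\<close> can be reused for its adjoint by exchanging the two operators.\<close>

definition adj_pair :: "'g oper \<Rightarrow> 'g oper \<Rightarrow> bool" where
  "adj_pair T S \<longleftrightarrow> (\<forall>\<xi>\<in>L2 G. T \<xi> \<in> L2 G) \<and> (\<forall>\<xi>\<in>L2 G. S \<xi> \<in> L2 G) \<and>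
     (\<forall>\<xi>\<in>L2 G. \<forall>\<eta>\<in>L2 G. \<forall>x\<in>units G. l2_inner (fib G x) (T \<xi>) \<eta> = l2_inner (fib G x) \<xi> (S \<eta>))"

lemma adj_pairD:
  assumes "adj_pair T S" "\<xi> \<in> L2 G"
  shows "T \<xi> \<in> L2 G" "S \<xi> \<in> L2 G"
    "\<eta> \<in> L2 G \<Longrightarrow> x \<in> units G \<Longrightarrow> l2_inner (fib G x) (T \<xi>) \<eta> = l2_inner (fib G x) \<xi> (S \<eta>)"
  using assms by (simp_all add: adj_pair_def)

lemma adj_pair_sym:
  assumes "adj_pair T S"
  shows "adj_pair S T"
  unfolding adj_pair_def
proof (intro conjI ballI adj_pairD[OF assms])
  fix \<xi> \<eta> x assume "\<xi> \<in> L2 G" "\<eta> \<in> L2 G" "x \<in> units G"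
  then show "l2_inner (fib G x) (S \<xi>) \<eta> = l2_inner (fib G x) \<xi> (T \<eta>)"
    using adj_pairD(3)[OF assms, of \<eta> \<xi> x] l2_inner_commute[of "fib G x" "S \<xi>" \<eta>]
      l2_inner_commute[of "fib G x" \<xi> "T \<eta>"] by simp
qed

text \<open>A finite piece of \<zeta> carries more than 3/4 of the norm; normalised, it lifts to a
  global element of norm at most one. Any factor between 1/2 and 1 would serve: it has to beat the
  remainder 1/2 that arises in the uniform boundedness argument.\<close>

lemma norming_lift:
  assumes \<zeta>: "square_summable (fib G x) \<zeta>" and pos: "0 < l2_norm (fib G x) \<zeta>"
  obtains u where "u \<in> Cc G" "fib_le u 1"
    "3 / 4 * l2_norm (fib G x) \<zeta> \<le> cmod (l2_inner (fib G x) \<zeta> u)"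
proof -
  let ?A = "fib G x"
  have "\<exists>F. finite F \<and> F \<subseteq> ?A \<and> 3 / 4 * l2_norm ?A \<zeta> < L2_set (\<lambda>a. cmod (\<zeta> a)) F"
  proof (rule ccontr)
    assume "\<nexists>F. finite F \<and> F \<subseteq> ?A \<and> 3 / 4 * l2_norm ?A \<zeta> < L2_set (\<lambda>a. cmod (\<zeta> a)) F"
    then have "l2_norm ?A \<zeta> \<le> 3 / 4 * l2_norm ?A \<zeta>"
      by (intro l2_bound(2)) (meson not_less)
    then show False using pos by simp
  qed
  then obtain F where F: "finite F" "F \<subseteq> ?A" and big: "3 / 4 * l2_norm ?A \<zeta> < L2_set (\<lambda>a. cmod (\<zeta> a)) F"
    by blast
  define l where "l = L2_set (\<lambda>a. cmod (\<zeta> a)) F"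
  have l: "0 < l" using big pos by (simp add: l_def)
  obtain u where u: "u \<in> Cc G" "\<And>a. a \<in> F \<Longrightarrow> u a = \<zeta> a / complex_of_real l"
    "\<And>a. a \<in> ?A - F \<Longrightarrow> u a = 0"
    "fib_le u (L2_set (\<lambda>a. cmod (\<zeta> a / complex_of_real l)) F)"
    using finite_lift[OF F, of "\<lambda>a. \<zeta> a / complex_of_real l"] by metis
  have "L2_set (\<lambda>a. cmod (\<zeta> a / complex_of_real l)) F = L2_set (\<lambda>a. cmod (\<zeta> a)) F * (1 / l)"
    using l by (subst L2_set_left_distrib) (simp_all add: norm_divide)
  then have u1: "fib_le u 1" using u(4) l by (simp add: l_def[symmetric])
  have "cnj (l2_inner ?A \<zeta> u) = (\<Sum>a\<in>F. cnj (u a) * \<zeta> a)"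
    unfolding l2_inner_commute[of ?A u \<zeta>, symmetric]
    by (rule l2_inner_finite_support) (use F u(3) in auto)
  also have "\<dots> = (\<Sum>a\<in>F. complex_of_real ((cmod (\<zeta> a))\<^sup>2 / l))"
  proof (rule sum.cong[OF refl])
    fix a assume "a \<in> F"
    have "cnj (u a) * \<zeta> a = (\<zeta> a * cnj (\<zeta> a)) / complex_of_real l"
      using u(2)[OF \<open>a \<in> F\<close>] by simp
    also have "\<dots> = complex_of_real ((cmod (\<zeta> a))\<^sup>2 / l)"
      by (metis complex_norm_square of_real_divide)
    finally show "cnj (u a) * \<zeta> a = complex_of_real ((cmod (\<zeta> a))\<^sup>2 / l)" .
  qed
  also have "\<dots> = complex_of_real ((\<Sum>a\<in>F. (cmod (\<zeta> a))\<^sup>2) / l)"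
    by (simp only: of_real_sum sum_divide_distrib)
  also have "(\<Sum>a\<in>F. (cmod (\<zeta> a))\<^sup>2) = l * l"
    by (simp add: l_def L2_set_def sum_nonneg)
  finally have "cnj (l2_inner ?A \<zeta> u) = complex_of_real l" using l by simp
  then have "cmod (l2_inner ?A \<zeta> u) = l" by (metis complex_mod_cnj norm_of_real abs_of_pos l)
  then have "3 / 4 * l2_norm ?A \<zeta> \<le> cmod (l2_inner ?A \<zeta> u)" using big by (simp add: l_def)
  with u(1) u1 show thesis by (rule that)
qed

text \<open>Sokal's version of the gliding hump argument for the uniform boundedness principle, applied to
  the functionals \<open>\<eta> \<mapsto> \<langle>T \<xi>, \<eta>\<rangle>(x) = \<langle>\<xi>, S \<eta>\<rangle>(x)\<close>.\<close>

lemma fibre_bounded: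
  assumes TS: "adj_pair T S" and x: "x \<in> units G"
  obtains C where "0 \<le> C" "\<And>\<xi>. \<xi> \<in> L2 G \<Longrightarrow> l2_norm (fib G x) (T \<xi>) \<le> C * l2_norm (fib G x) \<xi>"
proof (rule ccontr)
  let ?A = "fib G x"
  assume no: "\<not> thesis"
  \<comment> \<open>The growth 4^n is chosen to outrun the step lengths \<open>d n\<close>, which
    are 3^-n: in the end (4/3)^n would have to stay bounded.\<close>
  have "\<exists>\<xi>\<in>L2 G. l2_norm ?A (T \<xi>) > 4 ^ n * l2_norm ?A \<xi>" for n :: nat
  proof (rule ccontr)
    assume "\<not> (\<exists>\<xi>\<in>L2 G. l2_norm ?A (T \<xi>) > 4 ^ n * l2_norm ?A \<xi>)"
    then have "l2_norm ?A (T \<xi>) \<le> 4 ^ n * l2_norm ?A \<xi>" if "\<xi> \<in> L2 G" for \<xi>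
      using that not_less by blast
    then have thesis by (intro that[of "4 ^ n"]) auto
    then show False using no by blast
  qed
  then obtain \<xi> where \<xi>: "\<And>n. \<xi> n \<in> L2 G" "\<And>n. l2_norm ?A (T (\<xi> n)) > 4 ^ n * l2_norm ?A (\<xi> n)"
    by metis
  define a where "a n = l2_norm ?A (T (\<xi> n))" for n
  have apos: "0 < a n" for n
  proof -
    have "0 \<le> 4 ^ n * l2_norm ?A (\<xi> n)" by simp
    then show ?thesis using \<xi>(2)[of n] unfolding a_def by linarith
  qed
  have Ts: "square_summable ?A (T (\<xi> n))" for n
    by (rule L2_fib[OF adj_pairD(1)[OF TS \<xi>(1)] x])
  have "\<exists>u. u \<in> Cc G \<and> fib_le u 1 \<and> 3 / 4 * a n \<le> cmod (l2_inner ?A (T (\<xi> n)) u)" for n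
    using norming_lift[OF Ts] apos unfolding a_def by metis
  then obtain u where u: "\<And>n. u n \<in> Cc G" "\<And>n. fib_le (u n) 1"
    "\<And>n. 3 / 4 * a n \<le> cmod (l2_inner ?A (T (\<xi> n)) (u n))" by metis
  define \<phi> where "\<phi> n \<eta> = l2_inner ?A (T (\<xi> n)) \<eta>" for n \<eta>
  define d :: "nat \<Rightarrow> real" where "d n = (1 / 3) ^ n" for n
  have d: "0 < d n" for n by (simp add: d_def)
  define nxt where "nxt n \<eta> s = (\<lambda>\<gamma>. \<eta> \<gamma> + complex_of_real (s * d n) * u n \<gamma>)" for n \<eta> s
  \<comment> \<open>At stage \<open>n\<close> the sign is chosen to make the \<open>n\<close>-th
    functional large at the new point. Its values for the two signs differ by 2 * \<open>d n\<close>
    times its value at \<open>u n\<close>, so at least one of them has modulus 3/4 *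
    \<open>d n\<close> * \<open>a n\<close> or more.\<close>
  define \<eta> where "\<eta> = rec_nat (\<lambda>\<gamma>. 0) (\<lambda>n \<eta>. if 3 / 4 * d n * a n \<le> cmod (\<phi> n (nxt n \<eta> 1))
     then nxt n \<eta> 1 else nxt n \<eta> (- 1))"
  have \<eta>0: "\<eta> 0 = (\<lambda>\<gamma>. 0)" and \<eta>Suc: "\<eta> (Suc n) = (if 3 / 4 * d n * a n \<le> cmod (\<phi> n (nxt n (\<eta> n) 1))
     then nxt n (\<eta> n) 1 else nxt n (\<eta> n) (- 1))" for n
    by (simp_all add: \<eta>_def)
  obtain s where s: "\<And>n. \<eta> (Suc n) = nxt n (\<eta> n) (s n)" "\<And>n. \<bar>s n\<bar> = 1"
  proof -
    have "\<exists>t. \<eta> (Suc n) = nxt n (\<eta> n) t \<and> \<bar>t\<bar> = 1" for n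
      by (cases "3 / 4 * d n * a n \<le> cmod (\<phi> n (nxt n (\<eta> n) 1))")
        (auto simp: \<eta>Suc intro: exI[of _ 1] exI[of _ "- 1"])
    then show thesis using that by metis
  qed
  have nxtCc: "nxt n \<eta>' t \<in> Cc G" if "\<eta>' \<in> Cc G" for n \<eta>' t
    unfolding nxt_def by (rule Cc_add[OF that Cc_cmult[OF u(1)]])
  have Cc: "\<eta> n \<in> Cc G" for n
    by (induction n) (simp_all add: \<eta>0 Cc_zero s(1) nxtCc)
  have L: "\<eta> n \<in> L2 G" for n using Cc Cc_subset_L2 by blast
  have \<phi>nxt: "\<phi> n (nxt n (\<eta> n) t) = \<phi> n (\<eta> n) + complex_of_real (t * d n) * \<phi> n (u n)" for n t
    unfolding \<phi>_def nxt_def l2_inner_cmult_right[symmetric]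
    by (rule l2_inner_add_right[OF Ts Cc_fib(2)[OF Cc] square_summable_cmult[OF Cc_fib(2)[OF u(1)]]])
  have \<phi>big: "3 / 4 * d n * a n \<le> cmod (\<phi> n (\<eta> (Suc n)))" for n
  proof (cases "3 / 4 * d n * a n \<le> cmod (\<phi> n (nxt n (\<eta> n) 1))")
    case True
    then show ?thesis by (simp add: \<eta>Suc)
  next
    case False
    have "complex_of_real (2 * d n) * \<phi> n (u n) = \<phi> n (nxt n (\<eta> n) 1) - \<phi> n (nxt n (\<eta> n) (- 1))"
      unfolding \<phi>nxt by (simp add: algebra_simps)
    then have "2 * d n * cmod (\<phi> n (u n)) \<le> cmod (\<phi> n (nxt n (\<eta> n) 1)) + cmod (\<phi> n (nxt n (\<eta> n) (- 1)))"
      using norm_triangle_ineq4[of "\<phi> n (nxt n (\<eta> n) 1)" "\<phi> n (nxt n (\<eta> n) (- 1))"] d[of n]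
      by (metis abs_of_pos mult_pos_pos norm_mult norm_of_real zero_less_numeral)
    moreover have "2 * d n * (3 / 4 * a n) \<le> 2 * d n * cmod (\<phi> n (u n))"
      using u(3)[of n] d[of n] unfolding \<phi>_def by (intro mult_left_mono) auto
    ultimately show ?thesis using False by (simp add: \<eta>Suc algebra_simps)
  qed
  have step: "fib_le (\<lambda>\<gamma>. \<eta> (Suc n) \<gamma> - \<eta> n \<gamma>) (d n)" for n
    unfolding fib_le_def
  proof
    fix y assume "y \<in> units G"
    then have un: "square_summable (fib G y) (u n)" "l2_norm (fib G y) (u n) \<le> 1"
      using u(2)[of n] by (auto simp: fib_le_def)
    define c where "c = complex_of_real (s n * d n)"
    have c: "cmod c = d n"
      using s(2)[of n] d[of n] by (simp only: c_def norm_of_real abs_mult abs_of_pos mult_1)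
    have eq: "(\<lambda>\<gamma>. \<eta> (Suc n) \<gamma> - \<eta> n \<gamma>) = (\<lambda>\<gamma>. c * u n \<gamma>)"
      by (simp add: s(1) nxt_def c_def)
    show "square_summable (fib G y) (\<lambda>\<gamma>. \<eta> (Suc n) \<gamma> - \<eta> n \<gamma>) \<and>
        l2_norm (fib G y) (\<lambda>\<gamma>. \<eta> (Suc n) \<gamma> - \<eta> n \<gamma>) \<le> d n"
      using square_summable_cmult[OF un(1), of c] mult_left_mono[OF un(2), of "d n"] d[of n]
      unfolding fun_cong[OF eq] l2_norm_cmult c by simp
  qed
  \<comment> \<open>Partial sums of the geometric series of the \<open>d n\<close>, whose sum from
    \<open>n\<close> on is 3/2 * \<open>d n\<close>.\<close>
  have tele: "fib_le (\<lambda>\<gamma>. \<eta> (n + k) \<gamma> - \<eta> n \<gamma>) (3 / 2 * (d n - d (n + k)))" for n k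
  proof (induction k)
    case 0
    then show ?case by (simp add: fib_le_def l2_norm_def)
  next
    case (Suc k)
    have eq: "d (n + k) + 3 / 2 * (d n - d (n + k)) = 3 / 2 * (d n - d (n + Suc k))"
      by (simp add: d_def field_simps)
    then show ?case using fib_le_diff_trans[OF step[of "n + k"] Suc] by (simp only: eq add_Suc_right)
  qed
  have cau: "fib_le (\<lambda>\<gamma>. \<eta> m \<gamma> - \<eta> n \<gamma>) (3 / 2 * d n)" if "n \<le> m" for m n
  proof -
    have "3 / 2 * (d n - d m) \<le> 3 / 2 * d n" using d[of m] by simp
    moreover have "fib_le (\<lambda>\<gamma>. \<eta> m \<gamma> - \<eta> n \<gamma>) (3 / 2 * (d n - d m))"
      using tele[of n "m - n"] that by simp
    ultimately show ?thesis by (meson fib_le_def order_trans)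
  qed
  have "d \<longlonglongrightarrow> 0" unfolding d_def by (rule LIMSEQ_power_zero) simp
  then have "(\<lambda>n. 3 / 2 * d n) \<longlonglongrightarrow> 0" by (rule tendsto_mult_right_zero)
  from L2_complete[OF L cau this]
  obtain \<eta>' where \<eta>'L: "\<eta>' \<in> L2 G" and "\<forall>n. fib_le (\<lambda>\<gamma>. \<eta>' \<gamma> - \<eta> n \<gamma>) (3 / 2 * d n)" ..
  then have \<eta>': "\<eta>' \<in> L2 G" "\<And>n. fib_le (\<lambda>\<gamma>. \<eta>' \<gamma> - \<eta> n \<gamma>) (3 / 2 * d n)" by simp_all
  define M where "M = l2_norm ?A (S \<eta>')"
  have "(4 / 3) ^ n \<le> 4 * M" for n
  proof -
    let ?e = "\<lambda>\<gamma>. \<eta>' \<gamma> - \<eta> (Suc n) \<gamma>"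
    \<comment> \<open>The remainder after stage \<open>n\<close> is at most 3/2 *
      \<open>d (Suc n)\<close>, that is, \<open>d n / 2\<close>. It cannot cancel the 3/4 gained at
      that stage.\<close>
    have es: "square_summable ?A ?e" "l2_norm ?A ?e \<le> d n / 2"
      using \<eta>'(2)[of "Suc n"] x unfolding fib_le_def by (auto simp: d_def)
    have "\<phi> n (\<lambda>\<gamma>. \<eta>' \<gamma> - \<eta> (Suc n) \<gamma>) = \<phi> n \<eta>' - \<phi> n (\<eta> (Suc n))"
      unfolding \<phi>_def by (rule l2_inner_diff_right[OF Ts L2_fib[OF \<eta>'(1) x] Cc_fib(2)[OF Cc]])
    then have "cmod (\<phi> n (\<eta> (Suc n))) \<le> cmod (\<phi> n \<eta>') + cmod (\<phi> n ?e)"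
      using norm_triangle_ineq4[of "\<phi> n \<eta>'" "\<phi> n ?e"] by simp
    moreover have "cmod (\<phi> n ?e) \<le> a n * (d n / 2)"
    proof -
      have "cmod (\<phi> n ?e) \<le> a n * l2_norm ?A ?e"
        unfolding \<phi>_def a_def by (rule l2_Cauchy_Schwarz[OF Ts es(1)])
      also have "\<dots> \<le> a n * (d n / 2)"
        using es(2) apos[of n] by (intro mult_left_mono) auto
      finally show ?thesis .
    qed
    \<comment> \<open>Here the adjoint enters: it rewrites the functional as a pairing of
      \<open>\<xi> n\<close> with the fixed vector \<open>S \<eta>'\<close>, and
      \<open>\<xi> n\<close> is smaller than \<open>T (\<xi> n)\<close> by the factor 4^n.\<close>
    moreover have "cmod (\<phi> n \<eta>') \<le> a n / 4 ^ n * M"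
    proof -
      have "cmod (\<phi> n \<eta>') \<le> l2_norm ?A (\<xi> n) * M"
        unfolding \<phi>_def M_def adj_pairD(3)[OF TS \<xi>(1) \<eta>'(1) x]
        by (rule l2_Cauchy_Schwarz[OF L2_fib[OF \<xi>(1) x] L2_fib[OF adj_pairD(2)[OF TS \<eta>'(1)] x]])
      also have "\<dots> \<le> a n / 4 ^ n * M"
        using \<xi>(2)[of n] unfolding a_def
        by (intro mult_right_mono) (simp_all add: M_def field_simps)
      finally show ?thesis .
    qed
    ultimately have "3 / 4 * d n * a n \<le> a n / 4 ^ n * M + a n * (d n / 2)"
      using \<phi>big[of n] by linarith
    then have "a n * (d n / 4) \<le> a n * (M / 4 ^ n)" by (simp add: algebra_simps)
    then have "d n / 4 \<le> M / 4 ^ n" using apos[of n] by (simp only: mult_le_cancel_left_pos)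
    then show ?thesis by (simp add: d_def field_simps)
  qed
  moreover have "\<exists>n. 4 * M < (4 / 3) ^ n" by (rule real_arch_pow) simp
  ultimately show False using not_less by blast
qed

text \<open>The matrix has as columns the images of peak functions. To bound it, the left vector is
  lifted to a global \<eta> of the same norm; the weighted column sums are then the conjugated
  values of \<open>S \<eta>\<close>, controlled by the fibre bound for \<open>S\<close>. The
  resulting operator agrees with \<open>T\<close> on all of \<open>L2 G\<close>, because evaluation
  at \<open>a\<close> is pairing with a peak, and moving \<open>T\<close> across turns the row at
  \<open>a\<close> into the conjugate of the image of that peak under \<open>S\<close>.\<close>

lemma slice_exists:
  assumes TS: "adj_pair T S" and x: "x \<in> units G"
  obtains R where "R \<in> bounded_ops (fib G x)"
    "\<And>\<xi>. \<xi> \<in> L2 G \<Longrightarrow> R (chi (fib G x) \<xi>) = chi (fib G x) (T \<xi>)"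
proof -
  let ?A = "fib G x"
  obtain C where C: "0 \<le> C" "\<And>\<xi>. \<xi> \<in> L2 G \<Longrightarrow> l2_norm ?A (S \<xi>) \<le> C * l2_norm ?A \<xi>"
    using fibre_bounded[OF adj_pair_sym[OF TS] x] by metis
  have "\<exists>\<zeta>. \<zeta> \<in> Cc G \<and> chi ?A \<zeta> = delta b" if b: "b \<in> ?A" for b
    using peak[of b] b fibD(1)[OF b] by metis
  then obtain \<zeta> where \<zeta>: "\<And>b. b \<in> ?A \<Longrightarrow> \<zeta> b \<in> Cc G" "\<And>b. b \<in> ?A \<Longrightarrow> chi ?A (\<zeta> b) = delta b"
    by metis
  have \<zeta>L: "\<zeta> b \<in> L2 G" if "b \<in> ?A" for b using \<zeta>(1)[OF that] Cc_subset_L2 by blast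
  have inner: "l2_inner ?A (\<zeta> b) \<xi> = \<xi> b" if b: "b \<in> ?A" for b \<xi>
    by (rule inner_peak[OF \<zeta>(2)[OF b] b])
  define c where "c a b = T (\<zeta> b) a" for a b
  have cS: "cnj (c a b) = S (\<zeta> a) b" if "a \<in> ?A" "b \<in> ?A" for a b
  proof -
    have "S (\<zeta> a) b = l2_inner ?A (T (\<zeta> b)) (\<zeta> a)"
      using adj_pairD(3)[OF TS \<zeta>L[OF that(2)] \<zeta>L[OF that(1)] x] inner[OF that(2)] by simp
    also have "\<dots> = cnj (c a b)"
      unfolding l2_inner_commute[of ?A "T (\<zeta> b)" "\<zeta> a"] inner[OF that(1)] c_def ..
    finally show ?thesis by simp
  qed
  have mb: "matrix_bounded ?A c C"
    unfolding matrix_bounded_def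
  proof (intro conjI allI impI C(1))
    fix E F :: "'g set" and f g :: "'g \<Rightarrow> complex"
    assume *: "finite E \<and> E \<subseteq> ?A \<and> finite F \<and> F \<subseteq> ?A"
    obtain \<eta> where \<eta>: "\<eta> \<in> Cc G" "\<And>a. a \<in> E \<Longrightarrow> \<eta> a = g a" "\<And>a. a \<in> ?A - E \<Longrightarrow> \<eta> a = 0"
      "fib_le \<eta> (L2_set (\<lambda>a. cmod (g a)) E)"
      using finite_lift[of E x g] * by metis
    have \<eta>L: "\<eta> \<in> L2 G" using \<eta>(1) Cc_subset_L2 by blast
    have col: "(\<Sum>a\<in>E. cnj (g a) * c a b) = cnj (S \<eta> b)" if "b \<in> ?A" for b
    proof -
      have "S \<eta> b = l2_inner ?A (T (\<zeta> b)) \<eta>"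
        using adj_pairD(3)[OF TS \<zeta>L[OF that] \<eta>L x] inner[OF that] by simp
      then have "cnj (S \<eta> b) = l2_inner ?A \<eta> (T (\<zeta> b))"
        using l2_inner_commute[of ?A \<eta> "T (\<zeta> b)"] by simp
      also have "\<dots> = (\<Sum>a\<in>E. cnj (\<eta> a) * T (\<zeta> b) a)"
        by (rule l2_inner_finite_support) (use * \<eta>(3) in auto)
      also have "\<dots> = (\<Sum>a\<in>E. cnj (g a) * c a b)"
        using \<eta>(2) by (intro sum.cong) (simp_all add: c_def)
      finally show ?thesis by simp
    qed
    have "(\<Sum>a\<in>E. \<Sum>b\<in>F. cnj (g a) * c a b * f b) = (\<Sum>b\<in>F. (\<Sum>a\<in>E. cnj (g a) * c a b) * f b)"
      by (subst sum.swap) (simp add: sum_distrib_right)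
    also have "\<dots> = (\<Sum>b\<in>F. cnj (S \<eta> b) * f b)"
      using * by (intro sum.cong refl) (auto simp: col)
    also have "cmod \<dots> \<le> (\<Sum>b\<in>F. \<bar>cmod (S \<eta> b)\<bar> * \<bar>cmod (f b)\<bar>)"
      by (rule order_trans[OF norm_sum]) (simp add: norm_mult)
    also have "\<dots> \<le> L2_set (\<lambda>b. cmod (S \<eta> b)) F * L2_set (\<lambda>b. cmod (f b)) F"
      by (rule L2_set_mult_ineq)
    also have "\<dots> \<le> C * L2_set (\<lambda>a. cmod (g a)) E * L2_set (\<lambda>b. cmod (f b)) F"
    proof (rule mult_right_mono)
      have "L2_set (\<lambda>b. cmod (S \<eta> b)) F \<le> l2_norm ?A (S \<eta>)"
        using * L2_set_le_l2_norm[OF L2_fib[OF adj_pairD(2)[OF TS \<eta>L] x]] by blast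
      also have "\<dots> \<le> C * l2_norm ?A \<eta>" by (rule C(2)[OF \<eta>L])
      also have "\<dots> \<le> C * L2_set (\<lambda>a. cmod (g a)) E"
        using \<eta>(4) x C(1) unfolding fib_le_def by (intro mult_left_mono) auto
      finally show "L2_set (\<lambda>b. cmod (S \<eta> b)) F \<le> C * L2_set (\<lambda>a. cmod (g a)) E" .
    qed simp
    finally show "cmod (\<Sum>a\<in>E. \<Sum>b\<in>F. cnj (g a) * c a b * f b)
      \<le> C * L2_set (\<lambda>a. cmod (g a)) E * L2_set (\<lambda>b. cmod (f b)) F" .
  qed
  show thesis
  proof (rule that[OF matop_bounded_ops[OF mb]])
    fix \<xi> assume \<xi>: "\<xi> \<in> L2 G"
    show "matop ?A c (chi ?A \<xi>) = chi ?A (T \<xi>)"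
    proof (rule l2_eqI[OF matop_l2(1)[OF mb L2_chi[OF \<xi> x]] L2_chi[OF adj_pairD(1)[OF TS \<xi>] x]])
      fix a assume a: "a \<in> ?A"
      have "T \<xi> a = l2_inner ?A (\<zeta> a) (T \<xi>)" by (simp add: inner a)
      also have "\<dots> = cnj (l2_inner ?A (T \<xi>) (\<zeta> a))" by (rule l2_inner_commute)
      also have "\<dots> = cnj (l2_inner ?A \<xi> (S (\<zeta> a)))"
        using adj_pairD(3)[OF TS \<xi> \<zeta>L[OF a] x] by simp
      also have "\<dots> = l2_inner ?A (S (\<zeta> a)) \<xi>" by (rule l2_inner_commute[symmetric])
      also have "\<dots> = (\<Sum>\<^sub>\<infinity>b\<in>?A. c a b * chi ?A \<xi> b)"
        unfolding l2_inner_def by (intro infsum_cong) (simp add: cS[OF a, symmetric] chi_apply)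
      finally show "matop ?A c (chi ?A \<xi>) a = chi ?A (T \<xi>) a"
        using a L2_chi[OF \<xi> x] by (simp add: matop_def chi_apply)
    qed
  qed
qed

text \<open>Every point mass of the fibre is the restriction of a peak function, so the
  compatibility with \<open>T\<close> fixes the whole matrix of \<open>R\<close>.\<close>

lemma slice_eqI:
  assumes x: "x \<in> units G" and R: "R \<in> bounded_ops (fib G x)"
    and RT: "\<And>\<xi>. \<xi> \<in> L2 G \<Longrightarrow> R (chi (fib G x) \<xi>) = chi (fib G x) (T \<xi>)"
  shows "slice G x T = R"
  unfolding slice_def
proof (rule the_equality)
  show "R \<in> bounded_ops (fib G x) \<and> (\<forall>\<xi>\<in>L2 G. R (chi (fib G x) \<xi>) = chi (fib G x) (T \<xi>))"
    using R RT by blast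
  fix R' assume R': "R' \<in> bounded_ops (fib G x) \<and> (\<forall>\<xi>\<in>L2 G. R' (chi (fib G x) \<xi>) = chi (fib G x) (T \<xi>))"
  show "R' = R"
  proof (rule bounded_ops_eqI[OF _ R])
    fix a b assume b: "b \<in> fib G x"
    obtain \<zeta> where \<zeta>: "\<zeta> \<in> Cc G" "chi (fib G x) \<zeta> = delta b"
      using peak[of b] b fibD(1)[OF b] by metis
    have "\<zeta> \<in> L2 G" using \<zeta>(1) Cc_subset_L2 by blast
    then show "R' (delta b) a = R (delta b) a"
      using R' RT \<zeta>(2) by metis
  qed (use R' in blast)
qed

lemma slice:
  assumes TS: "adj_pair T S" and x: "x \<in> units G"
  shows "slice G x T \<in> bounded_ops (fib G x)"
    and "\<And>\<xi>. \<xi> \<in> L2 G \<Longrightarrow> slice G x T (chi (fib G x) \<xi>) = chi (fib G x) (T \<xi>)"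
    and "op_adj (fib G x) (slice G x T) = slice G x S"
proof -
  have *: "slice G x T \<in> bounded_ops (fib G x) \<and>
    (\<forall>\<xi>\<in>L2 G. slice G x T (chi (fib G x) \<xi>) = chi (fib G x) (T \<xi>))" if TS: "adj_pair T S" for T S
  proof -
    obtain R where R: "R \<in> bounded_ops (fib G x)"
      "\<And>\<xi>. \<xi> \<in> L2 G \<Longrightarrow> R (chi (fib G x) \<xi>) = chi (fib G x) (T \<xi>)"
      using slice_exists[OF TS x] by metis
    show ?thesis using slice_eqI[OF x R] R by simp
  qed
  note T = *[OF TS, THEN conjunct1] and S = *[OF adj_pair_sym[OF TS], THEN conjunct1]
  show "slice G x T \<in> bounded_ops (fib G x)" by (rule T)
  show "\<And>\<xi>. \<xi> \<in> L2 G \<Longrightarrow> slice G x T (chi (fib G x) \<xi>) = chi (fib G x) (T \<xi>)"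
    using *[OF TS] by simp
  obtain C where C: "0 \<le> C" "\<And>f. f \<in> l2 (fib G x) \<Longrightarrow> l2_norm (fib G x) (slice G x T f) \<le> C * l2_norm (fib G x) f"
    using bounded_ops_bound[OF T] by metis
  show "op_adj (fib G x) (slice G x T) = slice G x S"
  proof (rule bounded_ops_eqI[OF op_adj(1)[OF T C] S])
    fix a b assume a: "a \<in> fib G x" and b: "b \<in> fib G x"
    obtain \<zeta> where \<zeta>: "\<zeta> \<in> Cc G" "chi (fib G x) \<zeta> = delta a"
      using peak[of a] a fibD(1)[OF a] by metis
    obtain \<zeta>' where \<zeta>': "\<zeta>' \<in> Cc G" "chi (fib G x) \<zeta>' = delta b"
      using peak[of b] b fibD(1)[OF b] by metis
    have L: "\<zeta> \<in> L2 G" "\<zeta>' \<in> L2 G" using \<zeta>(1) \<zeta>'(1) Cc_subset_L2 by auto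
    have "slice G x T (delta a) = chi (fib G x) (T \<zeta>)" "slice G x S (delta b) = chi (fib G x) (S \<zeta>')"
      using *[OF TS] *[OF adj_pair_sym[OF TS]] L \<zeta>(2) \<zeta>'(2) by metis+
    then have e: "slice G x T (delta a) b = T \<zeta> b" "slice G x S (delta b) a = S \<zeta>' a"
      using a b by (simp_all add: chi_apply)
    have "S \<zeta>' a = l2_inner (fib G x) (T \<zeta>) \<zeta>'"
      using adj_pairD(3)[OF TS L x] inner_peak[OF \<zeta>(2) a] by simp
    also have "\<dots> = cnj (T \<zeta> b)"
      unfolding l2_inner_commute[of "fib G x" "T \<zeta>" \<zeta>'] inner_peak[OF \<zeta>'(2) b] ..
    finally show "op_adj (fib G x) (slice G x T) (delta b) a = slice G x S (delta b) a"
      using op_adj(4)[OF T C a b] e by simp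
  qed
qed

lemma slice_coeff_limit:
  assumes TS: "adj_pair T S" and X: "X \<subseteq> units G" and w: "w \<in> units G"
    and f: "\<gamma>' \<in> fib G w" "\<gamma>'' \<in> fib G w"
  shows "coeff_limit X (\<lambda>x. slice G x T) \<gamma>' \<gamma>'' (slice G w T (delta \<gamma>') \<gamma>'')"
proof -
  obtain \<zeta> V where \<zeta>: "\<zeta> \<in> Cc G" "openin (gtop G) V" "\<gamma>' \<in> V"
    "\<And>g x. g \<in> V \<Longrightarrow> g \<in> fib G x \<Longrightarrow> chi (fib G x) \<zeta> = delta g"
    using peak[OF fibD(1)[OF f(1)]] by metis
  have L: "\<zeta> \<in> L2 G" using \<zeta>(1) Cc_subset_L2 by blast
  have val: "slice G x T (delta g') g'' = T \<zeta> g''"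
    if "x \<in> units G" "g' \<in> V" "g' \<in> fib G x" "g'' \<in> fib G x" for x g' g''
  proof -
    have "slice G x T (delta g') = chi (fib G x) (T \<zeta>)"
      using slice(2)[OF TS that(1) L] \<zeta>(4)[OF that(2,3)] by simp
    then show ?thesis using that(4) by (simp add: chi_apply)
  qed
  show ?thesis
    unfolding coeff_limit_def val[OF w \<zeta>(3) f]
  proof (intro allI impI)
    fix e :: real assume "0 < e"
    have "(T \<zeta> \<longlongrightarrow> T \<zeta> \<gamma>'') (nhdsin (gtop G) \<gamma>'')"
      using L2_continuous[OF adj_pairD(1)[OF TS L]] fibD(1)[OF f(2)]
      unfolding continuous_map_euclidean_iff by blast
    from tendstoD[OF this \<open>0 < e\<close>] obtain U where U: "openin (gtop G) U" "\<gamma>'' \<in> U"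
      "\<And>g. g \<in> U \<Longrightarrow> cmod (T \<zeta> g - T \<zeta> \<gamma>'') < e"
      using fibD(1)[OF f(2)] unfolding eventually_nhdsin dist_norm by blast
    have "cmod (slice G x T (delta g') g'' - T \<zeta> \<gamma>'') < e"
      if "x \<in> X" "g' \<in> V \<inter> fib G x" "g'' \<in> U \<inter> fib G x" for x g' g''
      using val[of x g' g''] U(3)[of g''] that X by auto
    then show "\<exists>U' U''. openin (gtop G) U' \<and> \<gamma>' \<in> U' \<and> openin (gtop G) U'' \<and> \<gamma>'' \<in> U'' \<and>
      (\<forall>x\<in>X. \<forall>g'\<in>U' \<inter> fib G x. \<forall>g''\<in>U'' \<inter> fib G x.
         cmod (slice G x T (delta g') g'' - T \<zeta> \<gamma>'') < e)"
      using \<zeta>(2,3) U(1,2) by (intro exI[of _ V] exI[of _ U]) simp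
  qed
qed

lemma Cc_bounded:
  assumes "\<xi> \<in> Cc G"
  obtains M where "0 \<le> M" "\<And>\<gamma>. cmod (\<xi> \<gamma>) \<le> M"
proof -
  obtain K where K: "compactin (gtop G) K" "\<And>\<gamma>. \<gamma> \<notin> K \<Longrightarrow> \<xi> \<gamma> = 0"
    using Cc_support[OF assms] by blast
  have "compact (\<xi> ` K)"
    using image_compactin[OF K(1) Cc_continuous[OF assms]] by simp
  then have "bounded (\<xi> ` K)" by (rule compact_imp_bounded)
  then obtain M where "\<forall>w\<in>\<xi> ` K. cmod w \<le> M" unfolding bounded_iff ..
  then have M: "cmod (\<xi> \<gamma>) \<le> M" if "\<gamma> \<in> K" for \<gamma> using that by simp
  show thesis
  proof (rule that[of "max 0 M"])
    show "cmod (\<xi> \<gamma>) \<le> max 0 M" for \<gamma>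
      using M[of \<gamma>] K(2)[of \<gamma>] by (cases "\<gamma> \<in> K") auto
  qed simp
qed

text \<open>By compactness finitely many peaks represent the point masses at all arrows of the
  support of \<xi>. The image of each peak is within \<delta> of a function vanishing outside a
  compact set, and this function contributes nothing on \<open>A\<close>. What remains is at most
  \<open>card C\<close> errors per fibre, uniformly in \<open>x\<close>.\<close>

lemma slice_quasi_local:
  assumes TS: "adj_pair T S" and X: "X \<subseteq> units G"
  shows "vectorwise_uniformly_quasi_local G X (\<lambda>x. slice G x T)"
  unfolding vectorwise_uniformly_quasi_local_def
proof (intro allI impI ballI)
  fix e :: real and \<xi> assume e: "0 < e" and \<xi>: "\<xi> \<in> Cc G"
  obtain H where H: "compactin (gtop G) H" "\<And>\<gamma>. \<gamma> \<notin> H \<Longrightarrow> \<xi> \<gamma> = 0"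
    using Cc_support[OF \<xi>] by blast
  obtain M where M: "0 \<le> M" "\<And>\<gamma>. cmod (\<xi> \<gamma>) \<le> M" using Cc_bounded[OF \<xi>] by metis
  obtain C where C: "finite C" "C \<subseteq> arrows" "H \<subseteq> \<Union>(bis ` C)"
    using compact_bis_cover[OF H(1)] by metis
  \<comment> \<open>At most \<open>card C\<close> support points of \<xi> lie in a fibre, each
    weighted by at most \<open>M\<close>; with this \<delta> their errors add up to less than
    \<open>e\<close>. The summand 1 keeps the denominator positive when \<open>card C * M\<close> is
    0.\<close>
  define \<delta> where "\<delta> = e / (1 + card C * M)"
  have den: "0 < 1 + card C * M" using M(1) by (simp add: add_pos_nonneg)
  have \<delta>: "0 < \<delta>" "card C * (M * \<delta>) < e"
  proof -
    show "0 < \<delta>" using e den by (simp add: \<delta>_def)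
    then have "card C * (M * \<delta>) < (1 + card C * M) * \<delta>" by (simp add: algebra_simps)
    also have "\<dots> = e" using den by (simp add: \<delta>_def)
    finally show "card C * (M * \<delta>) < e" .
  qed
  define good where "good h \<zeta> V \<eta> L \<longleftrightarrow> \<zeta> \<in> Cc G \<and> openin (gtop G) V \<and> h \<in> V \<and>
      (\<forall>g x. g \<in> V \<longrightarrow> g \<in> fib G x \<longrightarrow> chi (fib G x) \<zeta> = delta g) \<and>
      fib_le (\<lambda>\<gamma>. T \<zeta> \<gamma> - \<eta> \<gamma>) \<delta> \<and> compactin (gtop G) L \<and> (\<forall>\<gamma>. \<gamma> \<notin> L \<longrightarrow> \<eta> \<gamma> = 0)"
    for h \<zeta> V \<eta> L
  have "\<exists>\<zeta> V \<eta> L. good h \<zeta> V \<eta> L" if h: "h \<in> H" for h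
  proof -
    have "h \<in> arrows" using h compactin_subset_topspace[OF H(1)] by blast
    then obtain \<zeta> V where \<zeta>: "\<zeta> \<in> Cc G" "openin (gtop G) V" "h \<in> V"
      "\<And>g x. g \<in> V \<Longrightarrow> g \<in> fib G x \<Longrightarrow> chi (fib G x) \<zeta> = delta g"
      using peak by metis
    have "T \<zeta> \<in> L2 G" using adj_pairD(1)[OF TS] \<zeta>(1) Cc_subset_L2 by blast
    then obtain \<eta> where \<eta>: "\<eta> \<in> Cc G" "fib_le (\<lambda>\<gamma>. T \<zeta> \<gamma> - \<eta> \<gamma>) \<delta>"
      using \<delta>(1) unfolding L2_iff by blast
    obtain L where L: "compactin (gtop G) L" "\<forall>\<gamma>. \<gamma> \<notin> L \<longrightarrow> \<eta> \<gamma> = 0"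
      using Cc_support[OF \<eta>(1)] by blast
    show ?thesis
      unfolding good_def
      by (intro exI[of _ \<zeta>] exI[of _ V] exI[of _ \<eta>] exI[of _ L] conjI \<zeta>(1,2,3) \<eta>(2) L allI impI)
        (rule \<zeta>(4))
  qed
  then obtain \<zeta> V \<eta> L where "\<And>h. h \<in> H \<Longrightarrow> good h (\<zeta> h) (V h) (\<eta> h) (L h)" by metis
  note z = this[unfolded good_def]
  have "\<exists>\<F>. finite \<F> \<and> \<F> \<subseteq> V ` H \<and> H \<subseteq> \<Union>\<F>"
    using z by (intro compactinD[OF H(1)]) auto
  then obtain D where D: "finite D" "D \<subseteq> H" "H \<subseteq> \<Union>(V ` D)" by (metis finite_subset_image)
  \<comment> \<open>If \<open>a\<close> in \<open>L d\<close> and \<open>b\<close> in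
    \<open>B \<inter> H\<close> share a fibre, then a b^-1 lies in \<open>K\<close> and a = (a b^-1)
    b lies in the product of \<open>K\<close> and \<open>B\<close>. So an \<open>A\<close> disjoint
    from that product avoids \<open>L d\<close>.\<close>
  define K where "K = (\<Union>d\<in>D. set_mult G (L d) (ginv G ` H))"
  have Kc: "compactin (gtop G) K"
    unfolding K_def
  proof (rule compactin_Union)
    fix N assume "N \<in> (\<lambda>d. set_mult G (L d) (ginv G ` H)) ` D"
    then obtain d where d: "d \<in> D" "N = set_mult G (L d) (ginv G ` H)" by blast
    have "compactin (gtop G) (L d)" using z d D by blast
    then show "compactin (gtop G) N"
      unfolding d(2)
      by (rule compactin_set_mult) (rule image_compactin[OF H(1) lc_etale_groupoidD(4)[OF etale]])
  qed (use D in simp)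
  have "l2_norm (fib G x) (chi A (slice G x T (chi B (chi (fib G x) \<xi>)))) < e"
    if x: "x \<in> X" and AB: "A \<subseteq> fib G x" "B \<subseteq> fib G x" "A \<inter> set_mult G K B = {}" for x A B
  proof -
    have xu: "x \<in> units G" using x X by blast
    let ?R = "slice G x T" and ?P = "fib G x"
    note R = slice(1)[OF TS xu]
    define F where "F = B \<inter> H"
    have F: "finite F" "F \<subseteq> ?P" "card F \<le> card C"
      using fib_bis_card[OF C(1,2), of F x] AB(2) C(3) by (auto simp: F_def)
    have "chi B (chi ?P \<xi>) = chi F \<xi>"
      using AB(2) H(2) by (auto simp: chi_apply F_def fun_eq_iff)
    also have "\<dots> = (\<lambda>\<gamma>. \<Sum>b\<in>F. \<xi> b * delta b \<gamma>)" by (rule chi_eq_sum_delta[OF F(1)])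
    finally have RF: "?R (chi B (chi ?P \<xi>)) = (\<lambda>a. \<Sum>b\<in>F. \<xi> b * ?R (delta b) a)"
      using bounded_ops_finite_sum[OF R F(1,2)] by simp
    have one: "square_summable ?P (chi A (?R (delta b))) \<and> l2_norm ?P (chi A (?R (delta b))) \<le> \<delta>"
      if b: "b \<in> F" for b
    proof -
      have bH: "b \<in> H" "b \<in> ?P" "b \<in> B" using b F by (auto simp: F_def)
      then obtain d where d: "d \<in> D" "b \<in> V d" using D(3) by blast
      then have dH: "d \<in> H" using D by blast
      note zd = z[OF dH]
      have "chi ?P (\<zeta> d) = delta b" using zd d(2) bH(2) by blast
      moreover have "\<zeta> d \<in> L2 G" using zd Cc_subset_L2 by blast
      ultimately have Rd: "?R (delta b) = chi ?P (T (\<zeta> d))" using slice(2)[OF TS xu] by metis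
      have fl: "square_summable ?P (\<lambda>\<gamma>. T (\<zeta> d) \<gamma> - \<eta> d \<gamma>)" "l2_norm ?P (\<lambda>\<gamma>. T (\<zeta> d) \<gamma> - \<eta> d \<gamma>) \<le> \<delta>"
        using zd xu unfolding fib_le_def by auto
      have "cmod (chi A (?R (delta b)) a) \<le> cmod (T (\<zeta> d) a - \<eta> d a)" if a: "a \<in> ?P" for a
      proof (cases "a \<in> A")
        case True
        have "a \<notin> L d"
        proof
          assume "a \<in> L d"
          then have "gmult G a (ginv G b) \<in> K"
            using in_set_mult_inv(1)[OF a bH(2) _ bH(1)] d(1) unfolding K_def by blast
          then have "a \<in> set_mult G K B"
            using in_set_mult_inv(2)[OF a bH(2) \<open>a \<in> L d\<close> bH(1) bH(3)] by blast
          then show False using True AB(3) by blast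
        qed
        then have "\<eta> d a = 0" using zd by blast
        then show ?thesis using True a by (simp add: Rd chi_apply)
      qed (simp add: chi_apply)
      from l2_dominated[OF fl(1) this] fl(2) show ?thesis by auto
    qed
    have "chi A (?R (chi B (chi ?P \<xi>))) = (\<lambda>a. \<Sum>b\<in>F. \<xi> b * chi A (?R (delta b)) a)"
      unfolding RF by (auto simp: chi_apply fun_eq_iff)
    then have "l2_norm ?P (chi A (?R (chi B (chi ?P \<xi>)))) \<le>
        (\<Sum>b\<in>F. l2_norm ?P (\<lambda>a. \<xi> b * chi A (?R (delta b)) a))"
      using one by (simp only:) (intro l2_sum(2) F square_summable_cmult, blast)
    also have "\<dots> \<le> (\<Sum>b\<in>F. M * \<delta>)"
      unfolding l2_norm_cmult using one M by (intro sum_mono mult_mono) auto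
    also have "\<dots> = card F * (M * \<delta>)" by simp
    also have "\<dots> \<le> card C * (M * \<delta>)"
      using F(3) M(1) \<delta>(1) by (intro mult_right_mono) auto
    also have "\<dots> < e" by (rule \<delta>(2))
    finally show ?thesis .
  qed
  then show "\<exists>K. compactin (gtop G) K \<and> (\<forall>x\<in>X. \<forall>A B. A \<subseteq> fib G x \<and> B \<subseteq> fib G x \<and>
      A \<inter> set_mult G K B = {} \<longrightarrow>
      l2_norm (fib G x) (chi A (slice G x T (chi B (chi (fib G x) \<xi>)))) < e)"
    using Kc by (intro exI[of _ K]) simp
qed

section \<open>Stone-Cech compactifications\<close>

text \<open>The coefficient along the sections through \<open>b\<close> and \<open>a\<close> makes
  sense only over \<open>W\<close>. Multiplying by the cut-off \<open>z\<close> extends it by zero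
  to a bounded continuous function on \<open>X\<close>; since \<open>z\<close> is one near
  \<open>w\<close>, the value at \<open>w\<close> of its extension is the limit of the
  coefficient.\<close>

lemma Stone_Cech_coeff_limit:
  assumes SC: "is_Stone_Cech_compactification (unit_space G) X" and X: "X \<subseteq> units G"
    and T: "\<And>x. x \<in> X \<Longrightarrow> T x \<in> bounded_ops (fib G x)"
    and C: "0 \<le> C" "\<And>x f. x \<in> X \<Longrightarrow> f \<in> l2 (fib G x) \<Longrightarrow>
      l2_norm (fib G x) (T x f) \<le> C * l2_norm (fib G x) f"
    and cX: "\<And>x \<gamma>' \<gamma>''. x \<in> X \<Longrightarrow> \<gamma>' \<in> fib G x \<Longrightarrow> \<gamma>'' \<in> fib G x \<Longrightarrow>
      coeff_limit X T \<gamma>' \<gamma>'' (T x (delta \<gamma>') \<gamma>'')"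
    and w: "w \<in> units G" and b: "b \<in> fib G w" and a: "a \<in> fib G w"
  shows "\<exists>c. coeff_limit X T b a c"
proof -
  have bt: "b \<in> arrows" "gsrc G b = w" and at: "a \<in> arrows" "gsrc G a = w"
    using a b fibD by auto
  have "\<forall>\<^sub>F x in near (units G) w. (sec a x \<in> bis a \<and> sec a x \<in> fib G x) \<and> sec b x \<in> bis b \<and> sec b x \<in> fib G x"
    using eventually_sec[OF at(1) subset_refl openin_topspace at(1)]
      eventually_sec[OF bt(1) subset_refl openin_topspace bt(1)]
    unfolding at(2) bt(2) by eventually_elim blast
  then obtain W where W: "openin (gtop G) W" "w \<in> W"
    "\<forall>x\<in>W \<inter> units G. (sec a x \<in> bis a \<and> sec a x \<in> fib G x) \<and> sec b x \<in> bis b \<and> sec b x \<in> fib G x"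
    unfolding eventually_near[OF w] by blast
  obtain z :: "'g \<Rightarrow> real" and V where z: "(\<lambda>\<gamma>. complex_of_real (z \<gamma>)) \<in> Cc G"
    "\<And>\<gamma>. 0 \<le> z \<gamma>" "\<And>\<gamma>. z \<gamma> \<le> 1" "\<And>\<gamma>. \<gamma> \<notin> W \<Longrightarrow> z \<gamma> = 0"
    "openin (gtop G) V" "w \<in> V" "V \<subseteq> W" "\<And>\<gamma>. \<gamma> \<in> V \<Longrightarrow> z \<gamma> = 1"
    using bump_point[OF W(1,2)] by metis
  define m where "m x = T x (delta (sec b x)) (sec a x)" for x
  define f where "f x = complex_of_real (z x) * m x" for x
  have m: "cmod (m x) \<le> C" if x: "x \<in> W \<inter> X" for x
  proof -
    have s: "sec a x \<in> fib G x" "sec b x \<in> fib G x" using W(3) x X by auto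
    have xX: "x \<in> X" using x by blast
    have n: "l2_norm (fib G x) (delta (sec b x)) = 1"
    proof -
      have "l2_norm (fib G x) (delta (sec b x)) = L2_set (\<lambda>\<gamma>. cmod (delta (sec b x) \<gamma>)) (fib G x \<inter> {sec b x})"
        by (rule square_summable_finite_support(2)) (auto simp: delta_def)
      moreover have "fib G x \<inter> {sec b x} = {sec b x}" using s by blast
      ultimately show ?thesis by (simp add: delta_def)
    qed
    have "cmod (m x) \<le> l2_norm (fib G x) (T x (delta (sec b x)))"
      unfolding m_def
      by (rule cmod_le_l2_norm[OF l2D[OF bounded_opsD(1)[OF T[OF xX] delta_in_l2[OF s(2)]]] s(1)])
    also have "\<dots> \<le> C" using C(2)[OF xX delta_in_l2[OF s(2)]] n by simp
    finally show ?thesis .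
  qed
  \<comment> \<open>The factor \<open>z x\<close> in this bound gives continuity at the points
    outside \<open>W\<close>: there \<open>z\<close> vanishes and squeezes \<open>f\<close> to
    0.\<close>
  have fle: "cmod (f x) \<le> C * z x" if "x \<in> X" for x
  proof (cases "x \<in> W")
    case True
    have "cmod (f x) = z x * cmod (m x)" using z(2)[of x] by (simp add: f_def norm_mult)
    also have "\<dots> \<le> z x * C" using m True that z(2) by (intro mult_left_mono) auto
    finally show ?thesis by (simp add: mult.commute)
  next
    case False
    then show ?thesis using z(4) by (simp add: f_def)
  qed
  have fC: "cmod (f x) \<le> C" if "x \<in> X" for x
    using fle[OF that] mult_left_mono[OF z(3)[of x] C(1)] by simp
  have near_lim: "(f \<longlongrightarrow> f x) (near X x)" if x: "x \<in> X" for x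
  proof -
    have xu: "x \<in> units G" and xt: "x \<in> arrows" using x X units_subset by auto
    have "((\<lambda>\<gamma>. complex_of_real (z \<gamma>)) \<longlongrightarrow> complex_of_real (z x)) (nhdsin (gtop G) x)"
      using Cc_continuous[OF z(1)] xt unfolding continuous_map_euclidean_iff by blast
    then have zl: "((\<lambda>\<gamma>. complex_of_real (z \<gamma>)) \<longlongrightarrow> complex_of_real (z x)) (near X x)"
      unfolding near_def by (rule tendsto_mono[OF inf_le1])
    have inX: "\<forall>\<^sub>F y in near X x. y \<in> X" unfolding near_def by (simp add: eventually_inf_principal)
    show ?thesis
    proof (cases "x \<in> W")
      case True
      have s: "sec a x \<in> bis a" "sec a x \<in> fib G x" "sec b x \<in> bis b" "sec b x \<in> fib G x"
        using W(3) True xu by auto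
      have ev: "\<forall>\<^sub>F y in near X x. y \<in> X \<and> sec c y \<in> U \<and> sec c y \<in> bis c \<and> sec c y \<in> fib G y"
        if "c \<in> arrows" "sec c x \<in> bis c" "sec c x \<in> fib G x" "openin (gtop G) U" "sec c x \<in> U" for c U
        using eventually_sec_bis[OF that(1) X that(4,5,2)] fibD(2)[OF that(3)] by simp
      have lim: "limitin (gtop G) (sec c) (sec c x) (near X x)"
        if c: "c \<in> arrows" "sec c x \<in> bis c" "sec c x \<in> fib G x" for c
        unfolding limitin_def
      proof (intro conjI allI impI)
        fix U assume "openin (gtop G) U \<and> sec c x \<in> U"
        then have "\<forall>\<^sub>F y in near X x. y \<in> X \<and> sec c y \<in> U \<and> sec c y \<in> bis c \<and> sec c y \<in> fib G y"
          using ev[OF c] by blast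
        then show "\<forall>\<^sub>F y in near X x. sec c y \<in> U" by eventually_elim blast
      qed (rule fibD(1)[OF c(3)])
      have "(m \<longlongrightarrow> m x) (near X x)"
        unfolding m_def
      proof (rule coeff_limit_tendsto(1)[OF cX[OF x s(4,2)] lim[OF bt(1) s(3,4)] lim[OF at(1) s(1,2)]])
        show "\<forall>\<^sub>F y in near X x. y \<in> X \<and> sec b y \<in> fib G y \<and> sec a y \<in> fib G y"
          using ev[OF bt(1) s(3,4) openin_topspace fibD(1)[OF s(4)]]
            ev[OF at(1) s(1,2) openin_topspace fibD(1)[OF s(2)]]
          by eventually_elim blast
      qed
      then show ?thesis unfolding f_def by (intro tendsto_mult zl)
    next
      case False
      then have z0: "z x = 0" by (rule z(4))
      have "((\<lambda>y. C * cmod (complex_of_real (z y))) \<longlongrightarrow> C * cmod (complex_of_real (z x))) (near X x)"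
        by (intro tendsto_intros zl)
      then have "((\<lambda>y. C * cmod (complex_of_real (z y))) \<longlongrightarrow> 0) (near X x)" by (simp add: z0)
      moreover have "\<forall>\<^sub>F y in near X x. cmod (f y) \<le> C * cmod (complex_of_real (z y))"
        using inX by eventually_elim (use fle z(2) in simp)
      ultimately have "(f \<longlongrightarrow> 0) (near X x)" by (rule Lim_null_comparison[rotated])
      then show ?thesis by (simp add: f_def z0)
    qed
  qed
  let ?S = "subtopology (unit_space G) X"
  have f_cont: "continuous_map ?S euclidean f"
    unfolding continuous_map_atin limitin_canonical_iff
  proof
    fix x assume "x \<in> topspace ?S"
    then have x: "x \<in> X" by simp
    have "atin ?S x \<le> near X x"
    proof (rule filter_leI)
      fix P assume "eventually P (near X x)"
      then obtain U where U: "openin (gtop G) U" "x \<in> U" "\<forall>y\<in>U \<inter> X. P y"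
        using eventually_near[of x P X] x X by blast
      have "openin ?S (U \<inter> X)"
        unfolding unit_space_def subtopology_subtopology using U(1) X
        by (auto simp: openin_subtopology Int_absorb1)
      then show "eventually P (atin ?S x)"
        unfolding eventually_atin using U x by blast
    qed
    then show "(f \<longlongrightarrow> f x) (atin ?S x)" by (rule tendsto_mono[OF _ near_lim[OF x]])
  qed
  \<comment> \<open>The extension property is available for spaces over the type
    \<open>('g \<Rightarrow> real) \<Rightarrow> real\<close>, so the plane is copied there: the
    real part is stored at the constant function 0, the imaginary part at all other arguments.
    \<open>proj\<close> reads them off at the constants 0 and 1.\<close>
  define emb :: "complex \<Rightarrow> ('g \<Rightarrow> real) \<Rightarrow> real" where
    "emb v = (\<lambda>u. if u = (\<lambda>_. 0) then Re v else Im v)" for v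
  define proj :: "(('g \<Rightarrow> real) \<Rightarrow> real) \<Rightarrow> complex" where
    "proj k = Complex (k (\<lambda>_. 0)) (k (\<lambda>_. 1))" for k
  have ne: "(\<lambda>_::'g. 1::real) \<noteq> (\<lambda>_. 0)" by (metis zero_neq_one)
  have pe: "proj (emb v) = v" for v using ne by (simp add: proj_def emb_def)
  let ?B = "top_of_set (cball (0::complex) C)"
  \<comment> \<open>Topologised so that \<open>proj\<close> is a homeomorphism from the copy onto
    the closed disc of radius \<open>C\<close>.\<close>
  define K where "K = pullback_topology (range emb) proj ?B"
  have tK: "topspace K = emb ` cball 0 C"
    unfolding K_def topspace_pullback_topology using pe by (auto simp: image_iff)
  have "continuous_map ?B K emb"
    unfolding K_def by (rule continuous_map_pullback') (auto simp: pe o_def)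
  then have "compactin K (emb ` cball 0 C)"
    by (rule image_compactin[rotated]) (simp add: compactin_subtopology)
  then have "compact_space K" by (simp add: compact_space_def tK)
  have proj_cont: "continuous_map K ?B proj"
    unfolding K_def using continuous_map_pullback[of ?B ?B id "range emb" proj] by simp
  have "Hausdorff_space K"
  proof (rule Hausdorff_space_injective_preimage[OF _ proj_cont])
    show "Hausdorff_space ?B" by (simp add: Hausdorff_space_subtopology)
    show "inj_on proj (topspace K)" unfolding tK by (auto simp: pe intro!: inj_onI)
  qed
  have "continuous_map ?S K (\<lambda>x. emb (f x))"
  proof -
    have "continuous_map ?S ?B f"
      using f_cont fC by (auto simp: continuous_map_in_subtopology)
    then have "continuous_map ?S K (emb \<circ> f)"
      unfolding K_def by (intro continuous_map_pullback') (auto simp: pe o_def)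
    then show ?thesis by (simp add: o_def)
  qed
  with \<open>compact_space K\<close> \<open>Hausdorff_space K\<close>
  have "\<exists>h. continuous_map (unit_space G) K h \<and> (\<forall>x\<in>X. h x = emb (f x))"
    using SC unfolding is_Stone_Cech_compactification_def by blast
  then obtain h where h: "continuous_map (unit_space G) K h" "\<forall>x\<in>X. h x = emb (f x)" by blast
  define \<phi> where "\<phi> = proj \<circ> h"
  have "continuous_map (unit_space G) ?B \<phi>"
    unfolding \<phi>_def by (rule continuous_map_compose[OF h(1) proj_cont])
  then have \<phi>: "continuous_map (unit_space G) euclidean \<phi>" by (rule continuous_map_into_fulltopology)
  have \<phi>f: "\<phi> x = f x" if "x \<in> X" for x using h(2) that by (simp add: \<phi>_def pe)
  have "coeff_limit X T b a (\<phi> w)"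
    unfolding coeff_limit_def
  proof (intro allI impI)
    fix e :: real assume "0 < e"
    have "openin (unit_space G) {x \<in> topspace (unit_space G). \<phi> x \<in> ball (\<phi> w) e}"
      by (rule openin_continuous_map_preimage[OF \<phi>]) simp
    then obtain Q where Q: "openin (gtop G) Q" "{x \<in> units G. \<phi> x \<in> ball (\<phi> w) e} = Q \<inter> units G"
      unfolding topspace_unit_space by (auto simp: unit_space_def openin_subtopology)
    \<comment> \<open>Restricting the source of \<open>g'\<close> also controls \<open>g''\<close>,
      which lies in the same fibre. Over \<open>V\<close> the cut-off is one, so there
      \<open>f\<close> is the coefficient itself.\<close>
    define U where "U = bis b \<inter> {g \<in> arrows. gsrc G g \<in> Q \<inter> V}"
    have "openin (gtop G) U"
      unfolding U_def
      by (intro openin_Int bis_props(1)[OF bt(1)] openin_continuous_map_preimage[OF src_continuous] Q(1) z(5))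
    moreover have "w \<in> {x \<in> units G. \<phi> x \<in> ball (\<phi> w) e}" using w \<open>0 < e\<close> by simp
    then have "w \<in> Q" unfolding Q(2) by blast
    then have "b \<in> U" using bis_props(2)[OF bt(1)] bt z(6) by (simp add: U_def)
    moreover have "cmod (T x (delta g') g'' - \<phi> w) < e"
      if x: "x \<in> X" and g: "g' \<in> U \<inter> fib G x" "g'' \<in> bis a \<inter> fib G x" for x g' g''
    proof -
      have sx: "gsrc G g' = x" "gsrc G g'' = x" using g fibD by auto
      have g': "g' = sec b x" "g'' = sec a x"
        using sec_src[of g' b] sec_src[of g'' a] g sx bt(1) at(1) by (auto simp: U_def)
      have xOV: "x \<in> Q \<inter> V" using g sx by (auto simp: U_def)
      then have "f x = m x" using z(8) by (simp add: f_def)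
      then have "T x (delta g') g'' = \<phi> x" using \<phi>f[OF x] by (simp add: m_def g')
      moreover have "x \<in> {x \<in> units G. \<phi> x \<in> ball (\<phi> w) e}" unfolding Q(2) using xOV x X by blast
      ultimately show ?thesis by (simp add: dist_norm norm_minus_commute)
    qed
    ultimately show "\<exists>U' U''. openin (gtop G) U' \<and> b \<in> U' \<and> openin (gtop G) U'' \<and> a \<in> U'' \<and>
        (\<forall>x\<in>X. \<forall>g'\<in>U' \<inter> fib G x. \<forall>g''\<in>U'' \<inter> fib G x. cmod (T x (delta g') g'' - \<phi> w) < e)"
      using bis_props(1,2)[OF at(1)] by - (rule exI[of _ U], rule exI[of _ "bis a"], simp)
  qed
  then show ?thesis by blast
qed

end

section \<open>Extension of a family of fibre operators\<close>

text \<open>Abstracts from the origin of the limits at units outside \<open>X\<close>, so that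
  extendability and the Stone-Cech property lead to the same situation. The data are stable under
  adjoints with the same \<open>C\<close>, which makes the lemmas available for the adjoint family
  too.\<close>

locale coefficient_family = etale_groupoid +
  fixes X :: "'a set" and T :: "'a \<Rightarrow> 'a oper" and C :: real
  assumes X: "X \<subseteq> units G" and dense: "unit_space G closure_of X = units G"
    and T: "\<And>x. x \<in> X \<Longrightarrow> T x \<in> bounded_ops (fib G x)"
    and C: "0 \<le> C" "\<And>x f. x \<in> X \<Longrightarrow> f \<in> l2 (fib G x) \<Longrightarrow>
      l2_norm (fib G x) (T x f) \<le> C * l2_norm (fib G x) f"
    and coeff_X: "\<And>x p' p''. x \<in> X \<Longrightarrow> p' \<in> fib G x \<Longrightarrow> p'' \<in> fib G x \<Longrightarrow>
      coeff_limit X T p' p'' (T x (delta p') p'')"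
    and coeff_ex: "\<And>w p' p''. w \<in> units G \<Longrightarrow> p' \<in> fib G w \<Longrightarrow> p'' \<in> fib G w \<Longrightarrow>
      \<exists>c. coeff_limit X T p' p'' c"
begin

text \<open>Arguments come in matrix order, row \<open>a\<close> before column \<open>b\<close>,
  whereas \<open>coeff_limit\<close> takes the column arrow first.\<close>

definition coef :: "'a \<Rightarrow> 'a \<Rightarrow> complex" where
  "coef a b = (SOME c. coeff_limit X T b a c)"

lemma fib_units: "a \<in> fib G w \<Longrightarrow> w \<in> units G"
  using src_units by (auto simp: fib_def)

lemma coeff_limit_coef: "b \<in> fib G w \<Longrightarrow> a \<in> fib G w \<Longrightarrow> coeff_limit X T b a (coef a b)"
  unfolding coef_def by (rule someI_ex[OF coeff_ex[OF fib_units]])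

lemma near_X: "w \<in> units G \<Longrightarrow> near X w \<noteq> bot"
  by (rule near_nontrivial[OF dense])

lemma eventually_sec_fib:
  assumes "a \<in> fib G w" "openin (gtop G) V" "a \<in> V"
  shows "\<forall>\<^sub>F x in near X w. x \<in> X \<and> sec a x \<in> V \<and> sec a x \<in> fib G x"
  using eventually_sec[OF fibD(1)[OF assms(1)] X assms(2,3)] fibD(2)[OF assms(1)]
  by (auto elim: eventually_mono)

lemma sec_limit:
  assumes "a \<in> fib G w"
  shows "limitin (gtop G) (sec a) a (near X w)"
  unfolding limitin_def
proof (intro conjI allI impI)
  fix V assume "openin (gtop G) V \<and> a \<in> V"
  then have "\<forall>\<^sub>F x in near X w. x \<in> X \<and> sec a x \<in> V \<and> sec a x \<in> fib G x"
    using eventually_sec_fib[OF assms] by blast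
  then show "\<forall>\<^sub>F x in near X w. sec a x \<in> V" by eventually_elim blast
qed (rule fibD(1)[OF assms])

lemma eventually_in_fib:
  assumes "a \<in> fib G w"
  shows "\<forall>\<^sub>F x in near X w. x \<in> X \<and> sec a x \<in> fib G x"
  using eventually_sec_fib[OF assms openin_topspace fibD(1)[OF assms]] by eventually_elim blast

text \<open>Moving both arrows along their local sections turns the limit in two variables into one
  along the single filter \<open>near X w\<close>, so finitely many coefficients can be treated
  together.\<close>

lemma coeff_limit_sec:
  assumes "coeff_limit X T b a c" "a \<in> fib G w" "b \<in> fib G w"
  shows "((\<lambda>x. T x (delta (sec b x)) (sec a x)) \<longlongrightarrow> c) (near X w)"
proof (rule coeff_limit_tendsto(1)[OF assms(1) sec_limit[OF assms(3)] sec_limit[OF assms(2)]])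
  show "\<forall>\<^sub>F x in near X w. x \<in> X \<and> sec b x \<in> fib G x \<and> sec a x \<in> fib G x"
    using eventually_in_fib[OF assms(2)] eventually_in_fib[OF assms(3)] by eventually_elim blast
qed

lemma coef_eqI:
  assumes "coeff_limit X T b a c" "a \<in> fib G w" "b \<in> fib G w"
  shows "coef a b = c"
  using tendsto_unique[OF near_X[OF fib_units[OF assms(2)]]
    coeff_limit_sec[OF coeff_limit_coef[OF assms(3,2)] assms(2,3)] coeff_limit_sec[OF assms]] .

lemma coef_X: "x \<in> X \<Longrightarrow> a \<in> fib G x \<Longrightarrow> b \<in> fib G x \<Longrightarrow> coef a b = T x (delta b) a"
  using coef_eqI[OF coeff_X] .

lemma sec_distinct:
  assumes "a \<in> fib G w" "b \<in> fib G w" "a \<noteq> b"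
  shows "\<forall>\<^sub>F x in near X w. sec a x \<noteq> sec b x"
proof -
  have "a \<in> arrows" "b \<in> arrows" using assms fibD(1) by auto
  then obtain U V where UV: "openin (gtop G) U" "openin (gtop G) V" "a \<in> U" "b \<in> V" "disjnt U V"
    using Hausdorff assms(3) unfolding Hausdorff_space_def by meson
  show ?thesis
    using eventually_sec_fib[OF assms(1) UV(1,3)] eventually_sec_fib[OF assms(2) UV(2,4)]
    by eventually_elim (use UV(5) in \<open>auto simp: disjnt_iff\<close>)
qed

text \<open>Distinct arrows have disjoint neighbourhoods, so their sections stay distinct near
  \<open>w\<close>. A finite submatrix over \<open>w\<close> is therefore a limit of submatrices of
  the same size over \<open>X\<close>.\<close>

lemma eventually_sec_inj:
  assumes F: "finite F" "F \<subseteq> fib G w"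
  shows "\<forall>\<^sub>F x in near X w. inj_on (\<lambda>a. sec a x) F \<and> (\<lambda>a. sec a x) ` F \<subseteq> fib G x"
proof -
  have 1: "\<forall>\<^sub>F x in near X w. \<forall>a\<in>F. \<forall>b\<in>F. a \<noteq> b \<longrightarrow> sec a x \<noteq> sec b x"
    using F sec_distinct
    by (intro eventually_ball_finite[OF F(1)] ballI) (auto simp: eventually_conj_iff subset_iff)
  have 2: "\<forall>\<^sub>F x in near X w. \<forall>a\<in>F. sec a x \<in> fib G x"
  proof (intro eventually_ball_finite[OF F(1)] ballI)
    fix a assume "a \<in> F"
    then have "a \<in> fib G w" using F by blast
    from eventually_in_fib[OF this] show "\<forall>\<^sub>F x in near X w. sec a x \<in> fib G x"
      by eventually_elim blast
  qed
  from 1 2 show ?thesis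
    by eventually_elim (auto intro!: inj_onI)
qed

lemma eventually_mem_X:
  assumes "w \<in> units G"
  shows "\<forall>\<^sub>F x in near X w. x \<in> X"
  unfolding near_def by (simp add: eventually_inf_principal)

lemma coef_bounded:
  assumes w: "w \<in> units G"
  shows "matrix_bounded (fib G w) coef C"
  unfolding matrix_bounded_def
proof (intro conjI allI impI C(1))
  fix E F :: "'a set" and f g :: "'a \<Rightarrow> complex"
  assume *: "finite E \<and> E \<subseteq> fib G w \<and> finite F \<and> F \<subseteq> fib G w"
  let ?b = "C * L2_set (\<lambda>a. cmod (g a)) E * L2_set (\<lambda>b. cmod (f b)) F"
  let ?s = "\<lambda>x. \<Sum>a\<in>E. \<Sum>b\<in>F. cnj (g a) * T x (delta (sec b x)) (sec a x) * f b"
  have "((\<lambda>x. T x (delta (sec b x)) (sec a x)) \<longlongrightarrow> coef a b) (near X w)" if "a \<in> E" "b \<in> F" for a b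
  proof -
    have ab: "a \<in> fib G w" "b \<in> fib G w" using that * by auto
    show ?thesis by (rule coeff_limit_sec[OF coeff_limit_coef[OF ab(2,1)] ab])
  qed
  then have "(?s \<longlongrightarrow> (\<Sum>a\<in>E. \<Sum>b\<in>F. cnj (g a) * coef a b * f b)) (near X w)"
    by (intro tendsto_intros) auto
  then have lim: "((\<lambda>x. cmod (?s x)) \<longlongrightarrow> cmod (\<Sum>a\<in>E. \<Sum>b\<in>F. cnj (g a) * coef a b * f b)) (near X w)"
    by (rule tendsto_norm)
  have "\<forall>\<^sub>F x in near X w. cmod (?s x) \<le> ?b"
    using eventually_sec_inj[of E w, OF conjunct1[OF *] conjunct1[OF conjunct2[OF *]]]
      eventually_sec_inj[of F w, OF conjunct1[OF conjunct2[OF conjunct2[OF *]]]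
        conjunct2[OF conjunct2[OF conjunct2[OF *]]]] eventually_mem_X[OF w]
  proof eventually_elim
    case (elim x)
    have iE: "inj_on (\<lambda>a. sec a x) E" "(\<lambda>a. sec a x) ` E \<subseteq> fib G x"
      and iF: "inj_on (\<lambda>a. sec a x) F" "(\<lambda>a. sec a x) ` F \<subseteq> fib G x" and x: "x \<in> X"
      using elim by auto
    let ?E = "(\<lambda>a. sec a x) ` E" and ?F = "(\<lambda>a. sec a x) ` F"
    \<comment> \<open>The test vectors are carried along by the sections; injectivity preserves
      their norms, so the bound for \<open>T x\<close> is the one claimed over
      \<open>w\<close>.\<close>
    define g' where "g' = g \<circ> inv_into E (\<lambda>a. sec a x)"
    define f' where "f' = f \<circ> inv_into F (\<lambda>a. sec a x)"
    have g': "g' (sec a x) = g a" if "a \<in> E" for a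
      using inv_into_f_f[OF iE(1) that] by (simp add: g'_def)
    have f': "f' (sec a x) = f a" if "a \<in> F" for a
      using inv_into_f_f[OF iF(1) that] by (simp add: f'_def)
    have "?s x = (\<Sum>a\<in>?E. \<Sum>b\<in>?F. cnj (g' a) * T x (delta b) a * f' b)"
      unfolding sum.reindex[OF iE(1)] sum.reindex[OF iF(1)] o_def
      by (intro sum.cong refl) (simp add: g' f')
    moreover have "cmod (\<Sum>a\<in>?E. \<Sum>b\<in>?F. cnj (g' a) * T x (delta b) a * f' b)
        \<le> C * L2_set (\<lambda>a. cmod (g' a)) ?E * L2_set (\<lambda>b. cmod (f' b)) ?F"
      using matrix_bounded_of_op[OF T[OF x] C(1) C(2)[OF x]] iE(2) iF(2) *
      unfolding matrix_bounded_def by blast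
    moreover have "L2_set (\<lambda>a. cmod (g' a)) ?E = L2_set (\<lambda>a. cmod (g a)) E"
      unfolding L2_set_def sum.reindex[OF iE(1)] o_def by (simp add: g')
    moreover have "L2_set (\<lambda>a. cmod (f' a)) ?F = L2_set (\<lambda>a. cmod (f a)) F"
      unfolding L2_set_def sum.reindex[OF iF(1)] o_def by (simp add: f')
    ultimately show ?case by (simp only:)
  qed
  then show "cmod (\<Sum>a\<in>E. \<Sum>b\<in>F. cnj (g a) * coef a b * f b) \<le> ?b"
    by (rule tendsto_upperbound[OF lim]) (rule near_X[OF w])
qed

definition fib_op :: "'a \<Rightarrow> 'a oper" where
  "fib_op w = matop (fib G w) coef"

lemma fib_op_bounded: "w \<in> units G \<Longrightarrow> fib_op w \<in> bounded_ops (fib G w)"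
  unfolding fib_op_def by (rule matop_bounded_ops[OF coef_bounded])

lemma fib_op_le:
  "w \<in> units G \<Longrightarrow> f \<in> l2 (fib G w) \<Longrightarrow> l2_norm (fib G w) (fib_op w f) \<le> C * l2_norm (fib G w) f"
  unfolding fib_op_def by (rule matop_l2(2)[OF coef_bounded])

lemma fib_op_delta:
  "a \<in> fib G w \<Longrightarrow> b \<in> fib G w \<Longrightarrow> fib_op w (delta b) a = coef a b"
  unfolding fib_op_def by (rule matop_delta[OF coef_bounded[OF fib_units]])

lemma fib_op_X:
  assumes x: "x \<in> X"
  shows "fib_op x = T x"
proof (rule bounded_ops_eqI[OF fib_op_bounded T[OF x]])
  fix a b assume "a \<in> fib G x" "b \<in> fib G x"
  then show "fib_op x (delta b) a = T x (delta b) a"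
    using coef_X[OF x] fib_op_delta by simp
qed (use X x in blast)

section \<open>The extended operator: continuity, tails and membership in the module\<close>

definition ext :: "'a oper" where
  "ext \<xi> p = (if p \<in> arrows then fib_op (gsrc G p) (chi (fib G (gsrc G p)) \<xi>) p else 0)"

lemma ext_fib: "p \<in> fib G y \<Longrightarrow> ext \<xi> p = fib_op y (chi (fib G y) \<xi>) p"
  using fibD by (auto simp: ext_def)

lemma chi_ext:
  assumes "\<xi> \<in> L2 G" "y \<in> units G"
  shows "chi (fib G y) (ext \<xi>) = fib_op y (chi (fib G y) \<xi>)"
proof
  fix p
  show "chi (fib G y) (ext \<xi>) p = fib_op y (chi (fib G y) \<xi>) p"
    using l2_outside[OF bounded_opsD(1)[OF fib_op_bounded[OF assms(2)] L2_chi[OF assms]], of p]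
    by (cases "p \<in> fib G y") (auto simp: chi_apply ext_fib)
qed

lemma ext_finite:
  assumes "\<xi> \<in> Cc G" "p \<in> fib G y" "finite F" "F \<subseteq> fib G y" "\<And>b. b \<in> fib G y - F \<Longrightarrow> \<xi> b = 0"
  shows "ext \<xi> p = (\<Sum>b\<in>F. coef p b * \<xi> b)"
proof -
  have y: "y \<in> units G" by (rule fib_units[OF assms(2)])
  have l: "chi (fib G y) \<xi> \<in> l2 (fib G y)" using L2_chi[OF _ y] assms(1) Cc_subset_L2 by blast
  have "((\<lambda>b. coef p b * chi (fib G y) \<xi> b) has_sum ext \<xi> p) (fib G y)"
    unfolding ext_fib[OF assms(2)] fib_op_def
    by (rule matop_apply_has_sum[OF coef_bounded[OF y] assms(2) l])
  moreover have "((\<lambda>b. coef p b * chi (fib G y) \<xi> b) has_sum (\<Sum>b\<in>F. coef p b * \<xi> b)) (fib G y)"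
    by (rule has_sum_finite_neutralI) (use assms(3-5) in \<open>auto simp: chi_apply intro!: sum.cong\<close>)
  ultimately show ?thesis by (rule has_sum_unique)
qed

text \<open>The neighbourhoods that control the coefficients over \<open>X\<close> also control
  those over any unit \<open>y\<close>: the latter are limits along sections that stay in these
  neighbourhoods. Passing to the limit weakens the strict inequality.\<close>

lemma coef_continuous:
  assumes ab: "a \<in> fib G w" "b \<in> fib G w" and e: "0 < e"
  shows "\<exists>U' U''. openin (gtop G) U' \<and> b \<in> U' \<and> openin (gtop G) U'' \<and> a \<in> U'' \<and>
    (\<forall>y. \<forall>g'\<in>U' \<inter> fib G y. \<forall>g''\<in>U'' \<inter> fib G y. cmod (coef g'' g' - coef a b) \<le> e)"
proof -
  obtain U' U'' where U: "openin (gtop G) U'" "b \<in> U'" "openin (gtop G) U''" "a \<in> U''"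
    and U3: "\<forall>x\<in>X. \<forall>g'\<in>U' \<inter> fib G x. \<forall>g''\<in>U'' \<inter> fib G x.
      cmod (T x (delta g') g'' - coef a b) < e"
    by (rule coeff_limitE[OF coeff_limit_coef[OF ab(2,1)] e]) (rule that)
  have "cmod (coef g'' g' - coef a b) \<le> e" if g: "g' \<in> U' \<inter> fib G y" "g'' \<in> U'' \<inter> fib G y" for y g' g''
  proof -
    have g1: "g' \<in> fib G y" "g' \<in> U'" and g2: "g'' \<in> fib G y" "g'' \<in> U''" using g by auto
    show ?thesis
    proof (rule tendsto_upperbound)
      show "((\<lambda>x. cmod (T x (delta (sec g' x)) (sec g'' x) - coef a b)) \<longlongrightarrow>
          cmod (coef g'' g' - coef a b)) (near X y)"
        by (intro tendsto_intros coeff_limit_sec[OF coeff_limit_coef[OF g1(1) g2(1)] g2(1) g1(1)])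
      show "\<forall>\<^sub>F x in near X y. cmod (T x (delta (sec g' x)) (sec g'' x) - coef a b) \<le> e"
        using eventually_sec_fib[OF g1(1) U(1) g1(2)] eventually_sec_fib[OF g2(1) U(3) g2(2)]
        by eventually_elim (intro less_imp_le U3[rule_format], auto)
    qed (rule near_X[OF fib_units[OF g1(1)]])
  qed
  then have "\<forall>y. \<forall>g'\<in>U' \<inter> fib G y. \<forall>g''\<in>U'' \<inter> fib G y. cmod (coef g'' g' - coef a b) \<le> e"
    by (intro allI ballI)
  then show ?thesis using U by - (rule exI[of _ U'], rule exI[of _ U''], simp)
qed

lemma coef_tendsto:
  assumes ab: "a \<in> fib G w" "b \<in> fib G w"
    and l: "limitin (gtop G) g' b F" "limitin (gtop G) g'' a F"
    and ev: "\<forall>\<^sub>F i in F. g' i \<in> fib G (y i) \<and> g'' i \<in> fib G (y i)"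
  shows "((\<lambda>i. coef (g'' i) (g' i)) \<longlongrightarrow> coef a b) F"
proof (rule tendstoI)
  fix e :: real assume "0 < e"
  then have "0 < e / 2" by simp
  obtain U' U'' where U: "openin (gtop G) U' \<and> b \<in> U' \<and> openin (gtop G) U'' \<and> a \<in> U'' \<and>
    (\<forall>y. \<forall>g'\<in>U' \<inter> fib G y. \<forall>g''\<in>U'' \<inter> fib G y. cmod (coef g'' g' - coef a b) \<le> e / 2)"
    using coef_continuous[OF ab \<open>0 < e / 2\<close>] by (elim exE) (rule that)
  note U3 = U[THEN conjunct2, THEN conjunct2, THEN conjunct2, THEN conjunct2, rule_format]
  have "\<forall>\<^sub>F i in F. g' i \<in> U'" "\<forall>\<^sub>F i in F. g'' i \<in> U''"
    using l U by (simp_all add: limitin_def)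
  then show "\<forall>\<^sub>F i in F. dist (coef (g'' i) (g' i)) (coef a b) < e"
    using ev
  proof eventually_elim
    case (elim i)
    then have "cmod (coef (g'' i) (g' i) - coef a b) \<le> e / 2" by (intro U3[of _ "y i"]) auto
    then show ?case using \<open>0 < e\<close> by (simp add: dist_norm)
  qed
qed

text \<open>Let \<open>F\<close> be the finite part of the support lying over the source of
  \<open>p\<close>. For \<open>g\<close> near \<open>p\<close>, the support of \<xi> in the fibre of
  \<open>g\<close> lies among the arrows to which the sections through \<open>F\<close> move. So
  near \<open>p\<close> the function is a sum over the fixed set \<open>F\<close> of products of
  continuous terms.\<close>

lemma ext_continuous:
  assumes \<xi>: "\<xi> \<in> Cc G"
  shows "continuous_map (gtop G) euclidean (ext \<xi>)"
  unfolding continuous_map_euclidean_iff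
proof
  fix p assume p: "p \<in> arrows"
  define w where "w = gsrc G p"
  have pw: "p \<in> fib G w" unfolding w_def by (rule in_fib_src[OF p])
  have w: "w \<in> units G" by (rule fib_units[OF pw])
  obtain K where K: "compactin (gtop G) K" "\<And>p. p \<notin> K \<Longrightarrow> \<xi> p = 0"
    using Cc_support[OF \<xi>] by blast
  define F where "F = fib G w \<inter> K"
  have F: "finite F" "F \<subseteq> fib G w" using fib_compact_finite[OF K(1)] by (auto simp: F_def)
  have Ft: "b \<in> arrows" if "b \<in> F" for b using that F fibD(1) by blast
  let ?N = "nhdsin (gtop G) p"
  have evN: "\<forall>\<^sub>F g in ?N. g \<in> V" if "openin (gtop G) V" "p \<in> V" for V
    using that unfolding eventually_nhdsin by blast
  have idN: "limitin (gtop G) (\<lambda>g. g) p ?N"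
    using evN p by (simp add: limitin_def)
  have srcN: "\<forall>\<^sub>F g in ?N. P (gsrc G g)" if P: "\<forall>\<^sub>F x in near (units G) w. P x" for P
  proof -
    obtain W where W: "openin (gtop G) W" "w \<in> W" "\<forall>x\<in>W \<inter> units G. P x"
      using P unfolding eventually_near[OF w] by blast
    have "openin (gtop G) {g \<in> arrows. gsrc G g \<in> W}"
      by (rule openin_continuous_map_preimage[OF src_continuous W(1)])
    moreover have "p \<in> {g \<in> arrows. gsrc G g \<in> W}" using W(2) p by (simp add: w_def)
    ultimately have "\<forall>\<^sub>F g in ?N. g \<in> {g \<in> arrows. gsrc G g \<in> W}" by (rule evN)
    then show ?thesis by eventually_elim (use W(3) src_units in blast)
  qed
  have secN: "\<forall>\<^sub>F g in ?N. sec b (gsrc G g) \<in> V \<and> sec b (gsrc G g) \<in> fib G (gsrc G g)"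
    if b: "b \<in> F" and V: "openin (gtop G) V" "b \<in> V" for b V
  proof -
    have "gsrc G b = w" using b F fibD(2) by blast
    then have "\<forall>\<^sub>F x in near (units G) w. x \<in> units G \<and> sec b x \<in> V \<and> sec b x \<in> bis b \<and> sec b x \<in> fib G x"
      using eventually_sec[OF Ft[OF b] subset_refl V] by simp
    then have "\<forall>\<^sub>F x in near (units G) w. sec b x \<in> V \<and> sec b x \<in> fib G x"
      by eventually_elim blast
    then show ?thesis by (rule srcN)
  qed
  have secL: "limitin (gtop G) (\<lambda>g. sec b (gsrc G g)) b ?N" if b: "b \<in> F" for b
    unfolding limitin_def
  proof (intro conjI allI impI)
    fix V assume "openin (gtop G) V \<and> b \<in> V"
    then have "\<forall>\<^sub>F g in ?N. sec b (gsrc G g) \<in> V \<and> sec b (gsrc G g) \<in> fib G (gsrc G g)"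
      using secN[OF b] by blast
    then show "\<forall>\<^sub>F g in ?N. sec b (gsrc G g) \<in> V" by eventually_elim blast
  qed (rule Ft[OF b])
  have secfib: "\<forall>\<^sub>F g in ?N. \<forall>b\<in>F. sec b (gsrc G g) \<in> fib G (gsrc G g)"
  proof (intro eventually_ball_finite[OF F(1)] ballI)
    fix b assume b: "b \<in> F"
    from secN[OF b openin_topspace Ft[OF b]]
    show "\<forall>\<^sub>F g in ?N. sec b (gsrc G g) \<in> fib G (gsrc G g)" by eventually_elim blast
  qed
  have disj: "\<forall>\<^sub>F g in ?N. \<forall>a\<in>F. \<forall>b\<in>F. a \<noteq> b \<longrightarrow> sec a (gsrc G g) \<noteq> sec b (gsrc G g)"
  proof (intro eventually_ball_finite[OF F(1)] ballI)
    fix a b assume a: "a \<in> F" and b: "b \<in> F"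
    show "\<forall>\<^sub>F g in ?N. a \<noteq> b \<longrightarrow> sec a (gsrc G g) \<noteq> sec b (gsrc G g)"
    proof (cases "a = b")
      case False
      obtain U V where UV: "openin (gtop G) U" "openin (gtop G) V" "a \<in> U" "b \<in> V" "disjnt U V"
        using Hausdorff False Ft[OF a] Ft[OF b] unfolding Hausdorff_space_def by meson
      show ?thesis
        using secN[OF a UV(1,3)] secN[OF b UV(2,4)]
        by eventually_elim (use UV(5) in \<open>auto simp: disjnt_iff\<close>)
    qed simp
  qed
  \<comment> \<open>No support can appear nearby away from the bisections around \<open>F\<close>:
    the part of \<open>K\<close> outside them is compact, so its source image is closed, and this
    image misses \<open>w\<close>.\<close>
  have cover: "\<forall>\<^sub>F g in ?N. \<forall>k\<in>fib G (gsrc G g) \<inter> K. k \<in> \<Union>(bis ` F)"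
  proof -
    let ?K = "K \<inter> (arrows - \<Union>(bis ` F))"
    have "openin (gtop G) (\<Union>(bis ` F))" using bis_props(1) Ft by blast
    then have "compactin (gtop G) ?K"
      by (intro compact_Int_closedin[OF K(1)]) blast
    then have c: "closedin (gtop G) (gsrc G ` ?K)"
      using image_compactin[OF _ src_continuous] compactin_imp_closedin[OF Hausdorff] by blast
    have "w \<notin> gsrc G ` ?K"
    proof
      assume "w \<in> gsrc G ` ?K"
      then obtain k where k: "k \<in> K" "k \<in> arrows" "k \<notin> \<Union>(bis ` F)" "gsrc G k = w" by auto
      then have "k \<in> F" by (simp add: F_def fib_def)
      then show False using bis_props(2)[OF k(2)] k(3) by blast
    qed
    then have "\<forall>\<^sub>F x in near (units G) w. x \<notin> gsrc G ` ?K"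
      unfolding eventually_near[OF w] using c w units_subset
      by (intro exI[of _ "arrows - gsrc G ` ?K"]) auto
    then have "\<forall>\<^sub>F g in ?N. gsrc G g \<notin> gsrc G ` ?K" by (rule srcN)
    then show ?thesis
    proof eventually_elim
      case (elim g)
      show ?case
      proof
        fix k assume k: "k \<in> fib G (gsrc G g) \<inter> K"
        then have "k \<in> arrows" "gsrc G k = gsrc G g" "k \<in> K" using fibD by auto
        then show "k \<in> \<Union>(bis ` F)" using elim by (metis Diff_iff IntI image_eqI)
      qed
    qed
  qed
  have evt: "\<forall>\<^sub>F g in ?N. g \<in> fib G (gsrc G g)"
    using evN[OF openin_topspace p] by eventually_elim (rule in_fib_src)
  have eq: "\<forall>\<^sub>F g in ?N. (\<Sum>b\<in>F. coef g (sec b (gsrc G g)) * \<xi> (sec b (gsrc G g))) = ext \<xi> g"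
    using secfib disj cover evt
  proof eventually_elim
    case (elim g)
    have inj: "inj_on (\<lambda>b. sec b (gsrc G g)) F" using elim(2) by (auto intro!: inj_onI)
    have "\<xi> k = 0" if k: "k \<in> fib G (gsrc G g) - (\<lambda>b. sec b (gsrc G g)) ` F" for k
    proof (rule ccontr)
      assume "\<xi> k \<noteq> 0"
      then have "k \<in> K" using K(2) by blast
      then obtain b where b: "b \<in> F" "k \<in> bis b" using elim(3) k by blast
      have "sec b (gsrc G g) = k"
        using sec_src[OF b(2) Ft[OF b(1)]] k fibD(2) by auto
      then show False using k b(1) by blast
    qed
    then have "ext \<xi> g = (\<Sum>b\<in>(\<lambda>b. sec b (gsrc G g)) ` F. coef g b * \<xi> b)"
      using elim F by (intro ext_finite[OF \<xi> elim(4)]) auto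
    also have "\<dots> = (\<Sum>b\<in>F. coef g (sec b (gsrc G g)) * \<xi> (sec b (gsrc G g)))"
      by (simp only: sum.reindex[OF inj] o_def)
    finally show ?case by simp
  qed
  have "((\<lambda>g. \<Sum>b\<in>F. coef g (sec b (gsrc G g)) * \<xi> (sec b (gsrc G g))) \<longlongrightarrow> (\<Sum>b\<in>F. coef p b * \<xi> b)) ?N"
  proof (intro tendsto_intros)
    fix b assume b: "b \<in> F"
    then have bw: "b \<in> fib G w" using F by blast
    show "((\<lambda>g. coef g (sec b (gsrc G g))) \<longlongrightarrow> coef p b) ?N"
      by (rule coef_tendsto[OF pw bw secL[OF b] idN, of "gsrc G"])
        (use evt secfib in eventually_elim, use b in blast)
    have "limitin euclidean (\<xi> \<circ> (\<lambda>g. sec b (gsrc G g))) (\<xi> b) ?N"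
      by (rule continuous_map_limit[OF Cc_continuous[OF \<xi>] secL[OF b]])
    then show "((\<lambda>g. \<xi> (sec b (gsrc G g))) \<longlongrightarrow> \<xi> b) ?N" by (simp add: o_def)
  qed
  moreover have "ext \<xi> p = (\<Sum>b\<in>F. coef p b * \<xi> b)"
    by (rule ext_finite[OF \<xi> pw F]) (use K(2) in \<open>auto simp: F_def\<close>)
  ultimately show "(ext \<xi> \<longlongrightarrow> ext \<xi> p) ?N"
    using filterlim_cong[OF refl refl eq] by simp
qed

text \<open>Since the complement of \<open>L\<close> is open, the sections carry \<open>F\<close> to
  arrows over \<open>X\<close> that still avoid \<open>L\<close>. There the operator is
  \<open>T x\<close> and the hypothesis applies; continuity of \<open>ext \<xi>\<close> brings the
  bound back to \<open>w\<close>.\<close>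

lemma ext_tail:
  assumes \<xi>: "\<xi> \<in> Cc G" and L: "closedin (gtop G) L"
    and tail: "\<And>x. x \<in> X \<Longrightarrow> l2_norm (fib G x) (chi (fib G x - L) (T x (chi (fib G x) \<xi>))) \<le> e"
    and F: "finite F" "F \<subseteq> fib G w - L" and w: "w \<in> units G"
  shows "L2_set (\<lambda>a. cmod (ext \<xi> a)) F \<le> e"
proof (rule tendsto_upperbound)
  have Fw: "F \<subseteq> fib G w" using F by blast
  have lim: "((\<lambda>x. ext \<xi> (sec a x)) \<longlongrightarrow> ext \<xi> a) (near X w)" if "a \<in> F" for a
  proof -
    have "a \<in> fib G w" using that Fw by blast
    from continuous_map_limit[OF ext_continuous[OF \<xi>] sec_limit[OF this]]
    show ?thesis by (simp add: o_def)
  qed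
  show "((\<lambda>x. L2_set (\<lambda>a. cmod (ext \<xi> (sec a x))) F) \<longlongrightarrow> L2_set (\<lambda>a. cmod (ext \<xi> a)) F) (near X w)"
    unfolding L2_set_def by (intro tendsto_intros lim)
  have off: "\<forall>\<^sub>F x in near X w. \<forall>a\<in>F. sec a x \<notin> L"
  proof (intro eventually_ball_finite[OF F(1)] ballI)
    fix a assume a: "a \<in> F"
    then have "a \<in> fib G w" "a \<in> arrows - L" using F fibD(1) by auto
    from eventually_sec_fib[OF this(1) openin_diff[OF openin_topspace L] this(2)]
    show "\<forall>\<^sub>F x in near X w. sec a x \<notin> L" by eventually_elim blast
  qed
  show "\<forall>\<^sub>F x in near X w. L2_set (\<lambda>a. cmod (ext \<xi> (sec a x))) F \<le> e"
    using off eventually_sec_inj[OF F(1) Fw] eventually_mem_X[OF w]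
  proof eventually_elim
    case (elim x)
    have inj: "inj_on (\<lambda>a. sec a x) F" and sub: "(\<lambda>a. sec a x) ` F \<subseteq> fib G x" and x: "x \<in> X"
      using elim by auto
    have xu: "x \<in> units G" using x X by blast
    have xl: "chi (fib G x) \<xi> \<in> l2 (fib G x)" using L2_chi[OF _ xu] \<xi> Cc_subset_L2 by blast
    let ?h = "chi (fib G x - L) (T x (chi (fib G x) \<xi>))"
    have hs: "square_summable (fib G x) ?h"
      by (rule l2D[OF chi_in_l2[OF bounded_opsD(1)[OF T[OF x] xl]]])
    have val: "ext \<xi> (sec a x) = ?h (sec a x)" if "a \<in> F" for a
    proof -
      have "sec a x \<in> fib G x" "sec a x \<notin> L" using that sub elim(1) by auto
      then show ?thesis by (simp add: ext_fib fib_op_X[OF x] chi_apply)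
    qed
    have "L2_set (\<lambda>a. cmod (ext \<xi> (sec a x))) F = L2_set (\<lambda>a. cmod (?h (sec a x))) F"
      by (intro L2_set_cong) (simp_all add: val)
    also have "\<dots> = L2_set (\<lambda>g. cmod (?h g)) ((\<lambda>a. sec a x) ` F)"
      unfolding L2_set_def sum.reindex[OF inj] o_def ..
    also have "\<dots> \<le> l2_norm (fib G x) ?h"
      by (rule L2_set_le_l2_norm[OF hs _ sub]) (use F in simp)
    also have "\<dots> \<le> e" by (rule tail[OF x])
    finally show ?case .
  qed
qed (rule near_X[OF w])

lemma ext_Cc:
  assumes ql: "vectorwise_uniformly_quasi_local G X T" and \<xi>: "\<xi> \<in> Cc G"
  shows "ext \<xi> \<in> L2 G"
proof (rule L2_closed)
  show "ext \<xi> p = 0" if "p \<notin> arrows" for p using that by (simp add: ext_def)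
  fix e :: real assume "0 < e"
  obtain K where K: "compactin (gtop G) K" "\<forall>x\<in>X. \<forall>A B. A \<subseteq> fib G x \<and> B \<subseteq> fib G x \<and>
      A \<inter> set_mult G K B = {} \<longrightarrow> l2_norm (fib G x) (chi A (T x (chi B (chi (fib G x) \<xi>)))) < e"
    using ql[unfolded vectorwise_uniformly_quasi_local_def, rule_format, OF \<open>0 < e\<close> \<xi>]
    by (elim exE conjE) (rule that)
  obtain H where H: "compactin (gtop G) H" "\<And>p. p \<notin> H \<Longrightarrow> \<xi> p = 0"
    using Cc_support[OF \<xi>] by blast
  \<comment> \<open>In each fibre the complement of \<open>L\<close> is disjoint from the product of
    \<open>K\<close> with the part of the fibre in \<open>H\<close>, and cutting \<xi> down to
    \<open>H\<close> leaves it unchanged. So quasi-locality applies to the image of \<xi> itself off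
    \<open>L\<close>.\<close>
  define L where "L = set_mult G K H"
  have L: "compactin (gtop G) L" unfolding L_def by (rule compactin_set_mult[OF K(1) H(1)])
  have tail: "l2_norm (fib G x) (chi (fib G x - L) (T x (chi (fib G x) \<xi>))) \<le> e" if x: "x \<in> X" for x
  proof -
    have "(fib G x - L) \<inter> set_mult G K (fib G x \<inter> H) = {}"
      unfolding L_def set_mult_def by blast
    then have "l2_norm (fib G x) (chi (fib G x - L) (T x (chi (fib G x \<inter> H) (chi (fib G x) \<xi>)))) < e"
      using K(2)[rule_format, OF x, of "fib G x - L" "fib G x \<inter> H"] by blast
    moreover have "chi (fib G x \<inter> H) (chi (fib G x) \<xi>) = chi (fib G x) \<xi>"
      using H(2) by (auto simp: chi_apply fun_eq_iff)
    ultimately show ?thesis by simp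
  qed
  obtain z :: "'a \<Rightarrow> real" where z: "(\<lambda>p. complex_of_real (z p)) \<in> Cc G"
    "\<And>p. 0 \<le> z p" "\<And>p. z p \<le> 1" "\<And>p. p \<in> L \<Longrightarrow> z p = 1"
    using bump_compact[OF L openin_topspace compactin_subset_topspace[OF L]] by metis
  \<comment> \<open>The approximant in \<open>Cc G\<close> is \<open>ext \<xi>\<close> times a
    cut-off that is one on \<open>L\<close>. The difference vanishes on \<open>L\<close> and is
    dominated by \<open>ext \<xi>\<close> elsewhere.\<close>
  let ?\<eta> = "\<lambda>p. ext \<xi> p * complex_of_real (z p)"
  have "?\<eta> \<in> Cc G" by (rule Cc_mult[OF z(1) ext_continuous[OF \<xi>]])
  moreover have "fib_le (\<lambda>p. ext \<xi> p - ?\<eta> p) e"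
    unfolding fib_le_def
  proof
    fix y assume y: "y \<in> units G"
    have "L2_set (\<lambda>p. cmod (ext \<xi> p - ?\<eta> p)) F \<le> e" if F: "finite F" "F \<subseteq> fib G y" for F
    proof -
      have le: "cmod (ext \<xi> p - ?\<eta> p) \<le> cmod (ext \<xi> p)" for p
      proof -
        have "ext \<xi> p - ?\<eta> p = complex_of_real (1 - z p) * ext \<xi> p" by (simp add: algebra_simps)
        then have "cmod (ext \<xi> p - ?\<eta> p) = (1 - z p) * cmod (ext \<xi> p)"
          using z(3)[of p] by (simp only: norm_mult norm_of_real)
        also have "\<dots> \<le> 1 * cmod (ext \<xi> p)" using z(2)[of p] by (intro mult_right_mono) auto
        finally show ?thesis by simp
      qed
      have "(\<Sum>p\<in>F. (cmod (ext \<xi> p - ?\<eta> p))\<^sup>2) = (\<Sum>p\<in>F - L. (cmod (ext \<xi> p - ?\<eta> p))\<^sup>2)"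
        using F(1) z(4) by (intro sum.mono_neutral_right) auto
      also have "\<dots> \<le> (\<Sum>p\<in>F - L. (cmod (ext \<xi> p))\<^sup>2)"
        by (intro sum_mono power_mono le) simp
      finally have "L2_set (\<lambda>p. cmod (ext \<xi> p - ?\<eta> p)) F \<le> L2_set (\<lambda>p. cmod (ext \<xi> p)) (F - L)"
        by (simp add: L2_set_def)
      also have "\<dots> \<le> e"
        by (rule ext_tail[OF \<xi> compactin_imp_closedin[OF Hausdorff L] tail _ _ y]) (use F in auto)
      finally show ?thesis .
    qed
    from l2_bound[OF this]
    show "square_summable (fib G y) (\<lambda>p. ext \<xi> p - ?\<eta> p) \<and> l2_norm (fib G y) (\<lambda>p. ext \<xi> p - ?\<eta> p) \<le> e"
      by blast
  qed
  ultimately show "\<exists>\<eta>\<in>L2 G. fib_le (\<lambda>p. ext \<xi> p - \<eta> p) e"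
    using Cc_subset_L2 by (intro bexI[of _ ?\<eta>]) auto
qed

lemma ext_L2:
  assumes ql: "vectorwise_uniformly_quasi_local G X T" and \<xi>: "\<xi> \<in> L2 G"
  shows "ext \<xi> \<in> L2 G"
proof (rule L2_closed)
  show "ext \<xi> p = 0" if "p \<notin> arrows" for p using that by (simp add: ext_def)
  fix e :: real assume "0 < e"
  \<comment> \<open>Dividing by \<open>C + 1\<close> covers the case that \<open>C\<close> is
    0.\<close>
  then have "0 < e / (C + 1)" using C(1) by simp
  then obtain \<eta> where \<eta>: "\<eta> \<in> Cc G" "fib_le (\<lambda>p. \<xi> p - \<eta> p) (e / (C + 1))"
    using \<xi> unfolding L2_iff by blast
  have \<eta>L: "\<eta> \<in> L2 G" using \<eta>(1) Cc_subset_L2 by blast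
  have "fib_le (\<lambda>p. ext \<xi> p - ext \<eta> p) e"
    unfolding fib_le_def
  proof
    fix y assume y: "y \<in> units G"
    let ?A = "fib G y"
    note R = fib_op_bounded[OF y]
    let ?d = "chi ?A (\<lambda>p. \<xi> p - \<eta> p)"
    have d: "?d \<in> l2 ?A" "l2_norm ?A ?d \<le> e / (C + 1)"
      using \<eta>(2) y by (auto simp: fib_le_def chi_in_l2_iff)
    have "chi ?A \<xi> = (\<lambda>p. ?d p + chi ?A \<eta> p)" by (auto simp: chi_apply fun_eq_iff)
    then have "fib_op y (chi ?A \<xi>) = (\<lambda>p. fib_op y ?d p + fib_op y (chi ?A \<eta>) p)"
      using bounded_opsD(2)[OF R d(1) L2_chi[OF \<eta>L y]] by simp
    then have eq: "ext \<xi> p - ext \<eta> p = fib_op y ?d p" if "p \<in> ?A" for p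
      using that by (simp add: ext_fib)
    have "l2_norm ?A (fib_op y ?d) \<le> C * (e / (C + 1))"
      using fib_op_le[OF y d(1)] mult_left_mono[OF d(2) C(1)] by (rule order_trans)
    also have "\<dots> \<le> e"
    proof -
      have "C * e \<le> e * (C + 1)" using \<open>0 < e\<close> by (simp add: algebra_simps)
      then show ?thesis using C(1) by (simp add: pos_divide_le_eq)
    qed
    finally have le: "l2_norm ?A (fib_op y ?d) \<le> e" .
    have s: "square_summable ?A (fib_op y ?d)" by (rule l2D[OF bounded_opsD(1)[OF R d(1)]])
    have "cmod (ext \<xi> p - ext \<eta> p) \<le> cmod (fib_op y ?d p)" if "p \<in> ?A" for p
      using eq[OF that] by simp
    from l2_dominated[OF s this] le
    show "square_summable ?A (\<lambda>p. ext \<xi> p - ext \<eta> p) \<and> l2_norm ?A (\<lambda>p. ext \<xi> p - ext \<eta> p) \<le> e"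
      by simp
  qed
  then show "\<exists>\<eta>\<in>L2 G. fib_le (\<lambda>p. ext \<xi> p - \<eta> p) e" using ext_Cc[OF ql \<eta>(1)] by blast
qed

lemma op_adj_entry:
  assumes "x \<in> X" "a \<in> fib G x" "b \<in> fib G x"
  shows "op_adj (fib G x) (T x) (delta b) a = cnj (T x (delta a) b)"
  by (rule op_adj(4)[OF T[OF assms(1)] C(1) C(2)[OF assms(1)] assms(2,3)])

text \<open>The coefficients of the adjoints are conjugates with the two arrows exchanged, so each
  limit is obtained by swapping the two neighbourhoods and conjugating.\<close>

lemma adjoint_family: "coefficient_family G X (\<lambda>x. op_adj (fib G x) (T x)) C"
proof unfold_locales
  show "X \<subseteq> units G" "unit_space G closure_of X = units G" "0 \<le> C" by (rule X dense C(1))+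
  show "op_adj (fib G x) (T x) \<in> bounded_ops (fib G x)" if x: "x \<in> X" for x
    by (rule op_adj(1)[OF T[OF x] C(1) C(2)[OF x]])
  show "l2_norm (fib G x) (op_adj (fib G x) (T x) f) \<le> C * l2_norm (fib G x) f"
    if x: "x \<in> X" and f: "f \<in> l2 (fib G x)" for x f
    by (rule op_adj(3)[OF T[OF x] C(1) C(2)[OF x] f])
  have lim: "coeff_limit X (\<lambda>x. op_adj (fib G x) (T x)) a b (cnj c)" if c: "coeff_limit X T b a c" for a b c
    unfolding coeff_limit_def
  proof (intro allI impI)
    fix e :: real assume "0 < e"
    obtain U' U'' where U: "openin (gtop G) U'" "b \<in> U'" "openin (gtop G) U''" "a \<in> U''"
      and U3: "\<forall>x\<in>X. \<forall>g'\<in>U' \<inter> fib G x. \<forall>g''\<in>U'' \<inter> fib G x.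
        cmod (T x (delta g') g'' - c) < e"
      by (rule coeff_limitE[OF c \<open>0 < e\<close>]) (rule that)
    have "cmod (op_adj (fib G x) (T x) (delta g'') g' - cnj c) < e"
      if x: "x \<in> X" and g: "g' \<in> U' \<inter> fib G x" "g'' \<in> U'' \<inter> fib G x" for x g' g''
    proof -
      have "op_adj (fib G x) (T x) (delta g'') g' = cnj (T x (delta g') g'')"
        using op_adj_entry[OF x] g by blast
      then have "op_adj (fib G x) (T x) (delta g'') g' - cnj c = cnj (T x (delta g') g'' - c)" by simp
      then show ?thesis using U3[rule_format, OF x g] by (simp only: complex_mod_cnj)
    qed
    then show "\<exists>V' V''. openin (gtop G) V' \<and> a \<in> V' \<and> openin (gtop G) V'' \<and> b \<in> V'' \<and>
        (\<forall>x\<in>X. \<forall>g'\<in>V' \<inter> fib G x. \<forall>g''\<in>V'' \<inter> fib G x.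
          cmod (op_adj (fib G x) (T x) (delta g') g'' - cnj c) < e)"
      using U by - (rule exI[of _ U''], rule exI[of _ U'], simp)
  qed
  show "coeff_limit X (\<lambda>x. op_adj (fib G x) (T x)) p' p'' (op_adj (fib G x) (T x) (delta p') p'')"
    if "x \<in> X" "p' \<in> fib G x" "p'' \<in> fib G x" for x p' p''
    unfolding op_adj_entry[OF that(1) that(3) that(2)]
    by (rule lim[OF coeff_X[OF that(1) that(3) that(2)]])
  show "\<exists>c. coeff_limit X (\<lambda>x. op_adj (fib G x) (T x)) p' p'' c"
    if "w \<in> units G" "p' \<in> fib G w" "p'' \<in> fib G w" for w p' p''
    using lim[OF coeff_limit_coef[OF that(3,2)]] by blast
qed

text \<open>On every fibre the coefficients of the extended adjoint family and the conjugate
  transposed coefficients of the extended family are limits of the same numbers over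
  \<open>X\<close>. Hence the two extensions are fibrewise adjoint, which is what the module-valued
  inner product requires.\<close>

lemma adjointable_extension:
  assumes ql: "vectorwise_uniformly_quasi_local G X T"
    and qla: "vectorwise_uniformly_quasi_local G X (\<lambda>x. op_adj (fib G x) (T x))"
  shows "\<exists>S\<in>adjointable G. \<forall>x\<in>X. slice G x S = T x"
proof -
  interpret A: coefficient_family G X "\<lambda>x. op_adj (fib G x) (T x)" C by (rule adjoint_family)
  have adj: "op_adj (fib G y) (fib_op y) = A.fib_op y" if y: "y \<in> units G" for y
  proof (rule bounded_ops_eqI)
    show "op_adj (fib G y) (fib_op y) \<in> bounded_ops (fib G y)"
      by (rule op_adj(1)[OF fib_op_bounded[OF y] C(1) fib_op_le[OF y]])
    show "A.fib_op y \<in> bounded_ops (fib G y)" by (rule A.fib_op_bounded[OF y])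
    fix a b assume a: "a \<in> fib G y" and b: "b \<in> fib G y"
    have lim: "((\<lambda>x. op_adj (fib G x) (T x) (delta (sec b x)) (sec a x)) \<longlongrightarrow> A.coef a b) (near X y)"
      by (rule A.coeff_limit_sec[OF A.coeff_limit_coef[OF b a] a b])
    have "((\<lambda>x. cnj (T x (delta (sec a x)) (sec b x))) \<longlongrightarrow> cnj (coef b a)) (near X y)"
      by (intro tendsto_intros coeff_limit_sec[OF coeff_limit_coef[OF a b] b a])
    moreover have "\<forall>\<^sub>F x in near X y. cnj (T x (delta (sec a x)) (sec b x)) =
        op_adj (fib G x) (T x) (delta (sec b x)) (sec a x)"
      using eventually_in_fib[OF a] eventually_in_fib[OF b]
      by eventually_elim (simp add: op_adj_entry)
    ultimately have "((\<lambda>x. op_adj (fib G x) (T x) (delta (sec b x)) (sec a x)) \<longlongrightarrow> cnj (coef b a)) (near X y)"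
      by (rule Lim_transform_eventually)
    then have "cnj (coef b a) = A.coef a b"
      by (rule tendsto_unique[OF near_X[OF y] _ lim])
    moreover have "op_adj (fib G y) (fib_op y) (delta b) a = cnj (fib_op y (delta a) b)"
      by (rule op_adj(4)[OF fib_op_bounded[OF y] C(1) fib_op_le[OF y] a b])
    ultimately show "op_adj (fib G y) (fib_op y) (delta b) a = A.fib_op y (delta b) a"
      using fib_op_delta[OF b a] A.fib_op_delta[OF a b] by simp
  qed
  \<comment> \<open>Members of \<open>adjointable G\<close> are extensional on \<open>L2 G\<close>,
    while \<open>ext\<close> is defined on all functions.\<close>
  define S where "S = restrict ext (L2 G)"
  have S: "S \<in> L2 G \<rightarrow>\<^sub>E L2 G" unfolding S_def using ext_L2[OF ql] by auto
  have A: "restrict A.ext (L2 G) \<in> L2 G \<rightarrow>\<^sub>E L2 G" using A.ext_L2[OF qla] by auto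
  have "L2_inner G (S \<xi>) \<eta> y = L2_inner G \<xi> (restrict A.ext (L2 G) \<eta>) y"
    if \<xi>: "\<xi> \<in> L2 G" and \<eta>: "\<eta> \<in> L2 G" and y: "y \<in> units G" for \<xi> \<eta> y
  proof -
    let ?c = "chi (fib G y)"
    have c: "l2_inner (fib G y) f g = l2_inner (fib G y) (?c f) (?c g)" for f g
      by (rule l2_inner_cong) (simp_all add: chi_apply)
    have "l2_inner (fib G y) (ext \<xi>) \<eta> = l2_inner (fib G y) (fib_op y (?c \<xi>)) (?c \<eta>)"
      unfolding c[of "ext \<xi>"] chi_ext[OF \<xi> y] ..
    also have "\<dots> = l2_inner (fib G y) (?c \<xi>) (op_adj (fib G y) (fib_op y) (?c \<eta>))"
      by (rule op_adj(2)[OF fib_op_bounded[OF y] C(1) fib_op_le[OF y] L2_chi[OF \<xi> y] L2_chi[OF \<eta> y]])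
    also have "\<dots> = l2_inner (fib G y) \<xi> (A.ext \<eta>)"
      unfolding adj[OF y] A.chi_ext[OF \<eta> y, symmetric] c[symmetric] ..
    finally show ?thesis using \<xi> \<eta> by (simp add: L2_inner_def S_def)
  qed
  then have "S \<in> adjointable G"
    unfolding adjointable_def using S A by blast
  moreover have "slice G x S = T x" if x: "x \<in> X" for x
  proof (rule slice_eqI[OF _ T[OF x]])
    show xu: "x \<in> units G" using x X by blast
    show "T x (chi (fib G x) \<xi>) = chi (fib G x) (S \<xi>)" if "\<xi> \<in> L2 G" for \<xi>
      using chi_ext[OF that xu] that by (simp add: S_def fib_op_X[OF x])
  qed
  ultimately show ?thesis by blast
qed

end

section \<open>The characterization\<close>

context etale_groupoid
begin

lemma bounded_familiesD:
  assumes "T \<in> bounded_families G X"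
  shows "x \<in> X \<Longrightarrow> T x \<in> bounded_ops (fib G x)"
    and "\<exists>C\<ge>0. \<forall>x\<in>X. \<forall>f\<in>l2 (fib G x). l2_norm (fib G x) (T x f) \<le> C * l2_norm (fib G x) f"
proof -
  show T: "T x \<in> bounded_ops (fib G x)" if "x \<in> X" for x
    using assms that by (simp add: bounded_families_def)
  obtain C where C: "\<forall>x\<in>X. op_norm (fib G x) (T x) \<le> C"
    using assms by (auto simp: bounded_families_def)
  have "l2_norm (fib G x) (T x f) \<le> max 0 C * l2_norm (fib G x) f"
    if x: "x \<in> X" and f: "f \<in> l2 (fib G x)" for x f
  proof -
    have "l2_norm (fib G x) (T x f) \<le> op_norm (fib G x) (T x) * l2_norm (fib G x) f"
      by (rule op_norm_bound[OF T[OF x] f])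
    also have "\<dots> \<le> max 0 C * l2_norm (fib G x) f"
      using C x by (intro mult_right_mono) (auto simp: le_max_iff_disj)
    finally show ?thesis .
  qed
  then show "\<exists>C\<ge>0. \<forall>x\<in>X. \<forall>f\<in>l2 (fib G x). l2_norm (fib G x) (T x f) \<le> C * l2_norm (fib G x) f"
    by (intro exI[of _ "max 0 C"]) simp
qed

lemma bounded_family_continuous_section_iff:
  assumes "X \<subseteq> units G" "T \<in> bounded_families G X"
  shows "continuous_section G X T \<longleftrightarrow>
     (\<forall>w\<in>X. \<forall>\<gamma>'\<in>fib G w. \<forall>\<gamma>''\<in>fib G w. coeff_limit X T \<gamma>' \<gamma>'' (T w (delta \<gamma>') \<gamma>''))"
  by (rule continuous_section_iff[OF assms(1) bounded_familiesD(1)[OF assms(2)]])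

lemma adjointable_adj_pair:
  assumes "S \<in> adjointable G"
  obtains S' where "adj_pair S S'"
proof -
  obtain S' where S': "S' \<in> L2 G \<rightarrow>\<^sub>E L2 G"
    "\<forall>\<xi>\<in>L2 G. \<forall>\<eta>\<in>L2 G. \<forall>x\<in>units G. L2_inner G (S \<xi>) \<eta> x = L2_inner G \<xi> (S' \<eta>) x"
    and S: "S \<in> L2 G \<rightarrow>\<^sub>E L2 G"
    using assms unfolding adjointable_def by blast
  have "adj_pair S S'"
    unfolding adj_pair_def
    using S'(2) PiE_mem[OF S] PiE_mem[OF S'(1)] by (simp add: L2_inner_def)
  then show thesis by (rule that)
qed

text \<open>The adjoints of the slices are the slices of the adjoint, so the second quasi-locality
  is the first one with the two operators exchanged.\<close>

lemma slices_imp: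
  assumes X: "X \<subseteq> units G" and T: "T \<in> bounded_families G X"
    and S: "S \<in> adjointable G" "\<forall>x\<in>X. slice G x S = T x"
  shows "continuous_section G X T" "extendable G X T"
    "vectorwise_uniformly_quasi_local G X T"
    "vectorwise_uniformly_quasi_local G X (\<lambda>x. op_adj (fib G x) (T x))"
proof -
  obtain S' where SS': "adj_pair S S'" using adjointable_adj_pair[OF S(1)] by metis
  have c: "coeff_limit X T \<gamma>' \<gamma>'' c \<longleftrightarrow> coeff_limit X (\<lambda>x. slice G x S) \<gamma>' \<gamma>'' c" for \<gamma>' \<gamma>'' c
    unfolding coeff_limit_def using S(2) by simp
  have lim: "coeff_limit X T \<gamma>' \<gamma>'' (slice G w S (delta \<gamma>') \<gamma>'')"
    if "w \<in> units G" "\<gamma>' \<in> fib G w" "\<gamma>'' \<in> fib G w" for w \<gamma>' \<gamma>''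
    unfolding c by (rule slice_coeff_limit[OF SS' X that])
  show "extendable G X T" unfolding extendable_iff using lim by blast
  show "continuous_section G X T"
    unfolding bounded_family_continuous_section_iff[OF X T]
  proof (intro ballI)
    fix w \<gamma>' \<gamma>'' assume w: "w \<in> X" and f: "\<gamma>' \<in> fib G w" "\<gamma>'' \<in> fib G w"
    have "slice G w S = T w" using S(2) w by blast
    then show "coeff_limit X T \<gamma>' \<gamma>'' (T w (delta \<gamma>') \<gamma>'')"
      using lim[of w, OF _ f] w X by auto
  qed
  show "vectorwise_uniformly_quasi_local G X T"
    using slice_quasi_local[OF SS' X] S(2) by (simp add: vectorwise_uniformly_quasi_local_def)
  have "op_adj (fib G x) (T x) = slice G x S'" if "x \<in> X" for x
    using slice(3)[OF SS', of x] S(2) that X by auto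
  then show "vectorwise_uniformly_quasi_local G X (\<lambda>x. op_adj (fib G x) (T x))"
    using slice_quasi_local[OF adj_pair_sym[OF SS'] X] by (simp add: vectorwise_uniformly_quasi_local_def)
qed

text \<open>The two alternatives in \<open>ext\<close> enter only through the existence of the
  coefficient limits over every unit; from there both cases share one construction.\<close>

lemma quasi_local_imp:
  assumes X: "X \<subseteq> units G" and dense: "unit_space G closure_of X = units G"
    and T: "T \<in> bounded_families G X" and cont: "continuous_section G X T"
    and ext: "extendable G X T \<or> is_Stone_Cech_compactification (unit_space G) X"
    and ql: "vectorwise_uniformly_quasi_local G X T"
      "vectorwise_uniformly_quasi_local G X (\<lambda>x. op_adj (fib G x) (T x))"
  shows "\<exists>S\<in>adjointable G. \<forall>x\<in>X. slice G x S = T x"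
proof -
  note B = bounded_familiesD(1)[OF T]
  obtain C where C: "0 \<le> C"
    "\<And>x f. x \<in> X \<Longrightarrow> f \<in> l2 (fib G x) \<Longrightarrow> l2_norm (fib G x) (T x f) \<le> C * l2_norm (fib G x) f"
    using bounded_familiesD(2)[OF T] by blast
  have cX: "coeff_limit X T \<gamma>' \<gamma>'' (T x (delta \<gamma>') \<gamma>'')"
    if "x \<in> X" "\<gamma>' \<in> fib G x" "\<gamma>'' \<in> fib G x" for x \<gamma>' \<gamma>''
    using cont that unfolding bounded_family_continuous_section_iff[OF X T] by blast
  have "\<exists>c. coeff_limit X T \<gamma>' \<gamma>'' c"
    if w: "w \<in> units G" and f: "\<gamma>' \<in> fib G w" "\<gamma>'' \<in> fib G w" for w \<gamma>' \<gamma>''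
    using ext
  proof
    assume "extendable G X T"
    then show ?thesis using cX w f unfolding extendable_iff by blast
  next
    assume "is_Stone_Cech_compactification (unit_space G) X"
    then show ?thesis by (rule Stone_Cech_coeff_limit[OF _ X B C cX w f])
  qed
  then interpret coefficient_family G X T C
    by unfold_locales (use X dense B C cX in blast)+
  show ?thesis by (rule adjointable_extension[OF ql])
qed

end

theorem corollary3p19:
  fixes G :: "'g tgroupoid" and X :: "'g set" and T :: "'g \<Rightarrow> 'g oper"
  assumes "lc_etale_groupoid G"
    and "X \<subseteq> units G" and "unit_space G closure_of X = units G"
    and "T \<in> bounded_families G X"
  shows "((\<exists>S \<in> adjointable G. \<forall>x \<in> X. slice G x S = T x) \<longleftrightarrow>
          (continuous_section G X T \<and> extendable G X T \<and>
           vectorwise_uniformly_quasi_local G X T \<and>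
           vectorwise_uniformly_quasi_local G X (\<lambda>x. op_adj (fib G x) (T x)))) \<and>
         (is_Stone_Cech_compactification (unit_space G) X \<longrightarrow>
          ((\<exists>S \<in> adjointable G. \<forall>x \<in> X. slice G x S = T x) \<longleftrightarrow>
           (continuous_section G X T \<and>
            vectorwise_uniformly_quasi_local G X T \<and>
            vectorwise_uniformly_quasi_local G X (\<lambda>x. op_adj (fib G x) (T x)))))"
proof -
  interpret etale_groupoid G by unfold_locales (rule assms(1))
  show ?thesis
    using slices_imp[OF assms(2,4)] quasi_local_imp[OF assms(2-4)] by blast
qed

end
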